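(* Let $\rho\in(-\infty,0]$, $\alpha\in(-1,\infty)$, $\beta\in\mathbb{R}$ with $2\beta>\alpha+1$, let $x_0\ge0$ and let $X$ be the solution of $$dX_t=dB_t+\rho\,\mathrm{sgn}(X_t)\frac{|X_t|^\alpha}{t^\beta}\,dt,\qquad t\ge1,\quad X_1=x_0.$$ Then $X$ is recurrent in $\mathbb{R}$, $X_t/\sqrt t$ converges in distribution to $\mathcal N(0,1)$ as $t\to\infty$, and $$\limsup_{t\to\infty}\frac{X_t}{(2t\ln\ln t)^{1/2}}=1\quad\text{a.s.}$$
   Context: $B$ is a standard Brownian motion; $\mathrm{sgn}$ is the sign function. $X$ is recurrent in $E\subset\mathbb R$ if for every $x\in E$ the set $\{t\ge1:X_t=x\}$ is a.s. unbounded. *)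

theory Defs
  imports "HOL-Probability.Probability"
begin

definition std_brownian_motion :: "'a measure \<Rightarrow> (real \<Rightarrow> 'a \<Rightarrow> real) \<Rightarrow> bool" where
  "std_brownian_motion M B \<longleftrightarrow>
     prob_space M \<and>
     (\<forall>t. B t \<in> borel_measurable M) \<and>
     (\<forall>\<omega>\<in>space M. B 0 \<omega> = 0 \<and> continuous_on {0..} (\<lambda>t. B t \<omega>)) \<and>
     (\<forall>s t. 0 \<le> s \<and> s < t \<longrightarrow>
        distributed M lborel (\<lambda>\<omega>. B t \<omega> - B s \<omega>) (normal_density 0 (sqrt (t - s)))) \<and>
     (\<forall>ts :: real list. sorted_wrt (<) ts \<and> (\<forall>t\<in>set ts. 0 \<le> t) \<longrightarrow>
        prob_space.indep_vars M (\<lambda>_. borel)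
          (\<lambda>i \<omega>. B (ts ! Suc i) \<omega> - B (ts ! i) \<omega>) {..<length ts - 1})"

text \<open>Drift coefficient  rho * sgn(x) * |x|^alpha / t^beta  (with the convention 0 powr a = 0,
  harmless since sgn 0 = 0).\<close>
definition drift :: "real \<Rightarrow> real \<Rightarrow> real \<Rightarrow> real \<Rightarrow> real \<Rightarrow> real" where
  "drift \<rho> \<alpha> \<beta> t x = \<rho> * sgn x * \<bar>x\<bar> powr \<alpha> / t powr \<beta>"

definition is_solution ::
  "'a measure \<Rightarrow> (real \<Rightarrow> 'a \<Rightarrow> real) \<Rightarrow> real \<Rightarrow> real \<Rightarrow> real \<Rightarrow> real \<Rightarrow> (real \<Rightarrow> 'a \<Rightarrow> real) \<Rightarrow> bool" where
  "is_solution M B \<rho> \<alpha> \<beta> x0 X \<longleftrightarrow>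
     (\<forall>t. X t \<in> borel_measurable M) \<and>
     (AE \<omega> in M. continuous_on {1..} (\<lambda>t. X t \<omega>) \<and>
        (\<forall>t\<ge>1. set_integrable lborel {1..t} (\<lambda>s. drift \<rho> \<alpha> \<beta> s (X s \<omega>)) \<and>
           X t \<omega> = x0 + (B t \<omega> - B 1 \<omega>) + (LINT s:{1..t}|lborel. drift \<rho> \<alpha> \<beta> s (X s \<omega>))))"

end

(*
The whole theorem follows from V_t = o(sqrt t) almost surely, where V_t is the drift integral:
then X_t - B_t = o(sqrt t), and the law of the iterated logarithm, the Gaussian limit and
(through limsup = -liminf = infinity and continuity) recurrence pass from B to X.

X is not assumed to be adapted, so the bound on V has to hold for every solution of the integral
equation driven by a typical path of B. If alpha >= 0, the drift points towards 0, hence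
|X_t| <= |x0| + 2 max |B| and the drift can be integrated directly. If alpha < 0, the drift is
singular at 0, and the point is a bound on the time that B + V spends near 0, uniform over all V
of total variation at most K: on a time window of length E^2 this time is of order
r^(1-kappa) E^(1+kappa) (1 + K/E) in the interval [-r,r]. It is proved over a ladder of scales:
a block of one scale on which V moves little contains few visited sub-blocks of the next scale, by
a moment bound for the local time of B, and the blocks on which V moves much are few, because
their variations add up to at most K. Integrating |x|^alpha against this occupation bound gives
K/E <= theta (1 + K/E) with theta -> 0, since 2 beta > alpha + 1; hence K = o(E).
*)

theory Submission
  imports Defs "HOL-Real_Asymp.Real_Asymp"
begin

section \<open>Gaussian tails and the maximal inequality\<close>

text \<open>Since V may depend on the whole path of B, no probability estimate may contain V.
  \<open>regular_block\<close> therefore places the quantifier over all constant centres v inside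
  the event, and V enters only afterwards, frozen on a block where it moves little. The exponents
  balance as follows. A ladder has q rungs, each shrinking the spatial scale by 2^(b q). A local
  time would multiply the number of visited blocks by about 2^(b q) per rung; 2^(b (q + 2)) is
  allowed. By high moments the surplus 2^(2 b) makes exceptions rarer than 2^(-b K) for every K,
  which beats the number 2^(2 b q^2) of blocks. Over the ladder, surplus and freezing together cost
  2^(4 b q) against r / E = 2^(-b q^2), that is \<kappa> = 4 / q, so a large q reaches every
  \<alpha> > -1. Regularity is only eventual in b, while the windows 4^n are infinitely many. Taking
  n \<le> d b makes each b serve finitely many windows; distances too large for the admissible b are
  bounded trivially, which the strict inequality 2 \<beta> > \<alpha> + 1 pays for when d is
  large.\<close>

lemma nn_integral_normal_density [simp]:
  assumes "0 < \<sigma>"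
  shows "(\<integral>\<^sup>+x. ennreal (normal_density \<mu> \<sigma> x) \<partial>lborel) = 1"
  using assms by (subst nn_integral_eq_integral) auto

text \<open>Shift the density by x: for u > 0 one has (x + u)^2 \<ge> x^2 + u^2, so the shift costs
  exactly the claimed factor and the remaining density integrates to 1.\<close>

lemma (in prob_space) normal_upper_tail:
  assumes D: "distributed M lborel X (normal_density 0 \<sigma>)" and \<sigma>: "0 < \<sigma>" and x: "0 \<le> x"
  shows "prob {\<omega>\<in>space M. x < X \<omega>} \<le> exp (- (x / \<sigma>)\<^sup>2 / 2)"
proof -
  have set: "{\<omega>\<in>space M. x < X \<omega>} = X -` {x<..} \<inter> space M" by auto
  have "emeasure M {\<omega>\<in>space M. x < X \<omega>} = (\<integral>\<^sup>+u. ennreal (normal_density 0 \<sigma> u) * indicator {x<..} u \<partial>lborel)"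
    unfolding set by (rule distributed_emeasure[OF D]) auto
  also have "\<dots> = (\<integral>\<^sup>+u. ennreal (normal_density 0 \<sigma> (x + u)) * indicator {x<..} (x + u) \<partial>lborel)"
    by (subst nn_integral_real_affine[where c = 1 and t = x]) auto
  also have "\<dots> \<le> (\<integral>\<^sup>+u. ennreal (exp (- (x / \<sigma>)\<^sup>2 / 2)) * ennreal (normal_density 0 \<sigma> u) \<partial>lborel)"
  proof (rule nn_integral_mono)
    fix u :: real
    show "ennreal (normal_density 0 \<sigma> (x + u)) * indicator {x<..} (x + u)
       \<le> ennreal (exp (- (x / \<sigma>)\<^sup>2 / 2)) * ennreal (normal_density 0 \<sigma> u)"
    proof (cases "0 < u")
      case True
      have "x\<^sup>2 + u\<^sup>2 \<le> (x + u)\<^sup>2" using True x by (simp add: power2_sum)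
      then have "exp (- ((x + u)\<^sup>2) / (2 * \<sigma>\<^sup>2)) \<le> exp (- (x / \<sigma>)\<^sup>2 / 2 + - (u\<^sup>2) / (2 * \<sigma>\<^sup>2))"
        using \<sigma> by (simp add: field_simps power2_eq_square)
      then have "exp (- ((x + u)\<^sup>2) / (2 * \<sigma>\<^sup>2)) \<le> exp (- (x / \<sigma>)\<^sup>2 / 2) * exp (- (u\<^sup>2) / (2 * \<sigma>\<^sup>2))"
        by (simp only: exp_add)
      then have "1 / sqrt (2 * pi * \<sigma>\<^sup>2) * exp (- ((x + u)\<^sup>2) / (2 * \<sigma>\<^sup>2))
          \<le> 1 / sqrt (2 * pi * \<sigma>\<^sup>2) * (exp (- (x / \<sigma>)\<^sup>2 / 2) * exp (- (u\<^sup>2) / (2 * \<sigma>\<^sup>2)))"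
        by (rule mult_left_mono) simp
      then have "normal_density 0 \<sigma> (x + u) \<le> exp (- (x / \<sigma>)\<^sup>2 / 2) * normal_density 0 \<sigma> u"
        by (simp add: normal_density_def mult_ac)
      then show ?thesis
        using True by (simp add: ennreal_mult[symmetric])
    qed (simp add: indicator_def)
  qed
  also have "\<dots> = ennreal (exp (- (x / \<sigma>)\<^sup>2 / 2))"
    using \<sigma> by (subst nn_integral_cmult) auto
  finally show ?thesis
    by (simp add: emeasure_eq_measure)
qed

text \<open>On \<open>{x<..x+\<sigma>}\<close>, an interval of length \<sigma>, the density is at
  least its value at the right end. The added 1 in the exponent is of lower order when
  \<open>x / \<sigma>\<close> tends to infinity, as it does in the iterated logarithm.\<close>

lemma (in prob_space) normal_lower_tail:
  assumes D: "distributed M lborel X (normal_density 0 \<sigma>)" and \<sigma>: "0 < \<sigma>" and x: "0 \<le> x"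
  shows "exp (- (x / \<sigma> + 1)\<^sup>2 / 2) / sqrt (2 * pi) \<le> prob {\<omega>\<in>space M. x < X \<omega>}"
proof -
  have set: "{\<omega>\<in>space M. x < X \<omega>} = X -` {x<..} \<inter> space M" by auto
  have "ennreal (exp (- (x / \<sigma> + 1)\<^sup>2 / 2) / sqrt (2 * pi))
      = ennreal (normal_density 0 \<sigma> (x + \<sigma>)) * ennreal \<sigma>"
  proof -
    have "- (x / \<sigma> + 1)\<^sup>2 / 2 = - (x + \<sigma>)\<^sup>2 / (2 * \<sigma>\<^sup>2)"
      using \<sigma> by (simp add: field_simps power2_eq_square)
    then show ?thesis
      using \<sigma> by (subst ennreal_mult[symmetric]) (auto simp: normal_density_def real_sqrt_mult)
  qed
  also have "\<dots> = (\<integral>\<^sup>+u. ennreal (normal_density 0 \<sigma> (x + \<sigma>)) * indicator {x<..x+\<sigma>} u \<partial>lborel)"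
    using \<sigma> by (subst nn_integral_cmult_indicator) auto
  also have "\<dots> \<le> (\<integral>\<^sup>+u. ennreal (normal_density 0 \<sigma> u) * indicator {x<..} u \<partial>lborel)"
  proof (rule nn_integral_mono)
    fix u :: real
    show "ennreal (normal_density 0 \<sigma> (x + \<sigma>)) * indicator {x<..x+\<sigma>} u
        \<le> ennreal (normal_density 0 \<sigma> u) * indicator {x<..} u"
    proof (cases "u \<in> {x<..x+\<sigma>}")
      case True
      then have "u\<^sup>2 \<le> (x + \<sigma>)\<^sup>2" using x by (intro power_mono) auto
      then have "normal_density 0 \<sigma> (x + \<sigma>) \<le> normal_density 0 \<sigma> u"
        using \<sigma> by (simp add: normal_density_def divide_simps)
      then show ?thesis using True by (simp add: ennreal_leI)
    qed simp
  qed
  also have "\<dots> = emeasure M {\<omega>\<in>space M. x < X \<omega>}"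
    unfolding set by (rule distributed_emeasure[OF D, symmetric]) auto
  finally show ?thesis
    by (simp add: emeasure_eq_measure)
qed

lemma (in prob_space) normal_small_ball:
  assumes D: "distributed M lborel X (normal_density 0 \<sigma>)" and \<sigma>: "0 < \<sigma>" and r: "0 \<le> r"
  shows "prob {\<omega>\<in>space M. \<bar>X \<omega>\<bar> \<le> r} \<le> r / \<sigma>"
proof -
  have set: "{\<omega>\<in>space M. \<bar>X \<omega>\<bar> \<le> r} = X -` {-r..r} \<inter> space M" by auto
  have "sqrt 4 \<le> sqrt (2 * pi)" using pi_gt3 by (intro real_sqrt_le_mono) simp
  then have pi2: "2 \<le> sqrt (2 * pi)" by simp
  have "emeasure M {\<omega>\<in>space M. \<bar>X \<omega>\<bar> \<le> r} = (\<integral>\<^sup>+u. ennreal (normal_density 0 \<sigma> u) * indicator {-r..r} u \<partial>lborel)"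
    unfolding set by (rule distributed_emeasure[OF D]) auto
  also have "\<dots> \<le> (\<integral>\<^sup>+u. ennreal (1 / (2 * \<sigma>)) * indicator {-r..r} u \<partial>lborel)"
  proof (intro nn_integral_mono mult_right_mono ennreal_leI)
    fix u :: real
    have "normal_density 0 \<sigma> u \<le> 1 / (sqrt (2 * pi) * \<sigma>)"
      using \<sigma> by (simp add: normal_density_def real_sqrt_mult divide_simps)
    also have "\<dots> \<le> 1 / (2 * \<sigma>)"
      using \<sigma> pi2 by (intro divide_left_mono mult_right_mono) auto
    finally show "normal_density 0 \<sigma> u \<le> 1 / (2 * \<sigma>)" .
  qed simp
  also have "\<dots> = ennreal (1 / (2 * \<sigma>)) * ennreal (2 * r)"
    using r by (subst nn_integral_cmult_indicator) auto
  also have "\<dots> = ennreal (r / \<sigma>)"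
    using \<sigma> r by (subst ennreal_mult[symmetric]) auto
  finally show ?thesis
    using \<sigma> r by (simp add: emeasure_eq_measure)
qed

lemma (in prob_space) normal_nonneg_ge_half:
  assumes D: "distributed M lborel X (normal_density 0 \<sigma>)"
  shows "1 / 2 \<le> prob {\<omega>\<in>space M. 0 \<le> X \<omega>}"
proof -
  have X [measurable]: "X \<in> borel_measurable M"
    using distributed_measurable[OF D] by simp
  have set: "{\<omega>\<in>space M. 0 \<le> X \<omega>} = X -` {0..} \<inter> space M"
    "{\<omega>\<in>space M. X \<omega> \<le> 0} = X -` {..0} \<inter> space M" by auto
  have "emeasure M {\<omega>\<in>space M. 0 \<le> X \<omega>} = (\<integral>\<^sup>+u. ennreal (normal_density 0 \<sigma> u) * indicator {0..} u \<partial>lborel)"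
    unfolding set by (rule distributed_emeasure[OF D]) auto
  also have "\<dots> = (\<integral>\<^sup>+u. ennreal (normal_density 0 \<sigma> u) * indicator {..0} u \<partial>lborel)"
    by (subst nn_integral_real_affine[where c = "-1" and t = 0])
       (auto simp: normal_density_def indicator_def intro!: nn_integral_cong)
  also have "\<dots> = emeasure M {\<omega>\<in>space M. X \<omega> \<le> 0}"
    unfolding set by (rule distributed_emeasure[OF D, symmetric]) auto
  finally have eq: "prob {\<omega>\<in>space M. 0 \<le> X \<omega>} = prob {\<omega>\<in>space M. X \<omega> \<le> 0}"
    by (simp add: measure_def)
  have "1 = prob ({\<omega>\<in>space M. 0 \<le> X \<omega>} \<union> {\<omega>\<in>space M. X \<omega> \<le> 0})"
    by (subst prob_space[symmetric], rule arg_cong[where f = prob]) auto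
  also have "\<dots> \<le> prob {\<omega>\<in>space M. 0 \<le> X \<omega>} + prob {\<omega>\<in>space M. X \<omega> \<le> 0}"
    by (rule measure_Un_le) auto
  finally show ?thesis using eq by simp
qed

text \<open>First passage decomposition. \<open>F k\<close> (the level is first exceeded at step k)
  depends on the first k variables, and \<open>R k\<close> (the remaining sum is nonnegative) on the
  others. On \<open>F k \<inter> R k\<close> the final sum still exceeds the level, and independence
  gives this intersection at least half the probability of \<open>F k\<close>.\<close>

lemma (in prob_space) levy_maximal_inequality:
  fixes Z :: "nat \<Rightarrow> 'a \<Rightarrow> real"
  assumes ind: "indep_vars (\<lambda>_. borel) Z {..<n}"
    and half: "\<And>k. k \<le> n \<Longrightarrow> 1 / 2 \<le> prob {\<omega>\<in>space M. 0 \<le> (\<Sum>i\<in>{k..<n}. Z i \<omega>)}"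
  shows "prob {\<omega>\<in>space M. \<exists>k\<le>n. a < (\<Sum>i<k. Z i \<omega>)} \<le> 2 * prob {\<omega>\<in>space M. a < (\<Sum>i<n. Z i \<omega>)}"
proof -
  have Z [measurable]: "Z i \<in> borel_measurable M" if "i < n" for i
    using ind that by (auto simp: indep_vars_def)
  have S [measurable]: "(\<lambda>\<omega>. \<Sum>i\<in>I. Z i \<omega>) \<in> borel_measurable M" if "I \<subseteq> {..<n}" for I
    using that by (intro borel_measurable_sum Z) auto
  define F where "F k = {\<omega>\<in>space M. a < (\<Sum>i<k. Z i \<omega>) \<and> (\<forall>j<k. (\<Sum>i<j. Z i \<omega>) \<le> a)}" for k
  define R where "R k = {\<omega>\<in>space M. 0 \<le> (\<Sum>i\<in>{k..<n}. Z i \<omega>)}" for k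
  have F_ev [measurable]: "F k \<in> events" if "k \<le> n" for k
  proof -
    have "(\<lambda>\<omega>. \<Sum>i<j. Z i \<omega>) \<in> borel_measurable M" if "j \<le> k" for j
      using that \<open>k \<le> n\<close> by (intro S) auto
    then have [measurable]: "{\<omega>\<in>space M. (\<Sum>i<j. Z i \<omega>) \<le> a} \<in> events" "{\<omega>\<in>space M. a < (\<Sum>i<j. Z i \<omega>)} \<in> events"
      if "j \<le> k" for j using that by measurable
    have "{\<omega>\<in>space M. \<forall>j\<in>{..<k}. (\<Sum>i<j. Z i \<omega>) \<le> a} \<in> events"
      by (rule sets.sets_Collect_finite_All) auto
    then have "{\<omega>\<in>space M. a < (\<Sum>i<k. Z i \<omega>) \<and> (\<forall>j\<in>{..<k}. (\<Sum>i<j. Z i \<omega>) \<le> a)} \<in> events"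
      by (intro sets.sets_Collect_conj) auto
    then show ?thesis unfolding F_def by simp
  qed
  have R_ev [measurable]: "R k \<in> events" for k
    unfolding R_def using S[of "{k..<n}"] by measurable auto
  have disj: "disjoint_family_on F {..n}"
    unfolding disjoint_family_on_def F_def
    by (auto, metis linorder_neqE_nat not_less)
  have FR: "prob (F k) \<le> 2 * prob (F k \<inter> R k)" if k: "k \<le> n" for k
  proof -
    \<comment> \<open>Both events are written as preimages under blocks of coordinates, because
      independence is available for the two restricted families.\<close>
    let ?A = "{..<k}" and ?B = "{k..<n}"
    define SA where "SA = {f \<in> space (PiM ?A (\<lambda>_. borel)). a < (\<Sum>i<k. f i) \<and> (\<forall>j<k. (\<Sum>i<j. f i :: real) \<le> a)}"
    define SB where "SB = {f \<in> space (PiM ?B (\<lambda>_. borel)). 0 \<le> (\<Sum>i\<in>?B. f i :: real)}"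
    have SA: "SA \<in> sets (PiM ?A (\<lambda>_. borel))"
    proof -
      have T: "(\<lambda>f. \<Sum>i<j. f i :: real) \<in> borel_measurable (PiM ?A (\<lambda>_. borel))" if "j \<le> k" for j
        by (intro borel_measurable_sum measurable_component_singleton) (use that in auto)
      have "{f \<in> space (PiM ?A (\<lambda>_. borel)). (\<Sum>i<j. f i :: real) \<le> a} \<in> sets (PiM ?A (\<lambda>_. borel))" if "j < k" for j
        using that by (intro borel_measurable_le T) auto
      then have "{f \<in> space (PiM ?A (\<lambda>_. borel)). \<forall>j\<in>{..<k}. (\<Sum>i<j. f i :: real) \<le> a} \<in> sets (PiM ?A (\<lambda>_. borel))"
        by (intro sets.sets_Collect_finite_All) auto
      moreover have "{f \<in> space (PiM ?A (\<lambda>_. borel)). a < (\<Sum>i<k. f i :: real)} \<in> sets (PiM ?A (\<lambda>_. borel))"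
        by (intro borel_measurable_less T) auto
      ultimately have "{f \<in> space (PiM ?A (\<lambda>_. borel)). a < (\<Sum>i<k. f i) \<and> (\<forall>j\<in>{..<k}. (\<Sum>i<j. f i :: real) \<le> a)}
          \<in> sets (PiM ?A (\<lambda>_. borel))"
        by (intro sets.sets_Collect_conj)
      then show ?thesis unfolding SA_def by simp
    qed
    have SB: "SB \<in> sets (PiM ?B (\<lambda>_. borel))"
      unfolding SB_def by measurable
    have "indep_var (PiM ?A (\<lambda>_. borel)) (\<lambda>\<omega>. restrict (\<lambda>i. Z i \<omega>) ?A) (PiM ?B (\<lambda>_. borel)) (\<lambda>\<omega>. restrict (\<lambda>i. Z i \<omega>) ?B)"
      using k by (intro indep_var_restrict[OF ind]) auto
    from indep_varD[OF this SA SB]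
    have "prob ((\<lambda>\<omega>. (restrict (\<lambda>i. Z i \<omega>) ?A, restrict (\<lambda>i. Z i \<omega>) ?B)) -` (SA \<times> SB) \<inter> space M)
      = prob ((\<lambda>\<omega>. restrict (\<lambda>i. Z i \<omega>) ?A) -` SA \<inter> space M) * prob ((\<lambda>\<omega>. restrict (\<lambda>i. Z i \<omega>) ?B) -` SB \<inter> space M)" .
    moreover have FA: "(\<lambda>\<omega>. restrict (\<lambda>i. Z i \<omega>) ?A) -` SA \<inter> space M = F k"
      by (auto simp: SA_def F_def space_PiM)
    moreover have RB: "(\<lambda>\<omega>. restrict (\<lambda>i. Z i \<omega>) ?B) -` SB \<inter> space M = R k"
      by (auto simp: SB_def R_def space_PiM)
    moreover have "(\<lambda>\<omega>. (restrict (\<lambda>i. Z i \<omega>) ?A, restrict (\<lambda>i. Z i \<omega>) ?B)) -` (SA \<times> SB) \<inter> space M = F k \<inter> R k"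
      unfolding FA[symmetric] RB[symmetric] by auto
    ultimately have "prob (F k \<inter> R k) = prob (F k) * prob (R k)" by simp
    moreover have "prob (F k) * (1 / 2) \<le> prob (F k) * prob (R k)"
      using half[OF k] unfolding R_def by (intro mult_left_mono) auto
    ultimately show ?thesis by simp
  qed
  have "{\<omega>\<in>space M. \<exists>k\<le>n. a < (\<Sum>i<k. Z i \<omega>)} = (\<Union>k\<le>n. F k)"
  proof safe
    fix \<omega> k assume *: "\<omega> \<in> space M" "k \<le> n" "a < (\<Sum>i<k. Z i \<omega>)"
    define m where "m = (LEAST k. a < (\<Sum>i<k. Z i \<omega>))"
    have "a < (\<Sum>i<m. Z i \<omega>)" unfolding m_def using *(3) by (rule LeastI)
    moreover have "m \<le> k" unfolding m_def using *(3) by (rule Least_le)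
    moreover have "\<forall>j<m. (\<Sum>i<j. Z i \<omega>) \<le> a" unfolding m_def using not_less_Least by (metis not_less)
    ultimately show "\<omega> \<in> (\<Union>k\<le>n. F k)" using * by (auto simp: F_def intro!: bexI[of _ m])
  qed (auto simp: F_def)
  then have "prob {\<omega>\<in>space M. \<exists>k\<le>n. a < (\<Sum>i<k. Z i \<omega>)} = (\<Sum>k\<le>n. prob (F k))"
    using disj by (simp, intro finite_measure_finite_Union) auto
  also have "\<dots> \<le> (\<Sum>k\<le>n. 2 * prob (F k \<inter> R k))"
    by (intro sum_mono FR) auto
  also have "\<dots> = 2 * prob (\<Union>k\<le>n. F k \<inter> R k)"
    using disj by (subst finite_measure_finite_Union) (auto simp: sum_distrib_left disjoint_family_on_def)
  also have "prob (\<Union>k\<le>n. F k \<inter> R k) \<le> prob {\<omega>\<in>space M. a < (\<Sum>i<n. Z i \<omega>)}"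
  proof (rule finite_measure_mono)
    show "(\<Union>k\<le>n. F k \<inter> R k) \<subseteq> {\<omega>\<in>space M. a < (\<Sum>i<n. Z i \<omega>)}"
    proof safe
      fix \<omega> k assume "k \<le> n" "\<omega> \<in> F k" "\<omega> \<in> R k"
      moreover have "(\<Sum>i<n. Z i \<omega>) = (\<Sum>i<k. Z i \<omega>) + (\<Sum>i\<in>{k..<n}. Z i \<omega>)"
        using sum.atLeastLessThan_concat[of 0 k n "\<lambda>i. Z i \<omega>"] \<open>k \<le> n\<close> by (simp add: atLeast0LessThan)
      ultimately show "a < (\<Sum>i<n. Z i \<omega>)" by (auto simp: F_def R_def)
    qed (auto simp: F_def)
    show "{\<omega>\<in>space M. a < (\<Sum>i<n. Z i \<omega>)} \<in> events"
      by (intro borel_measurable_less S) auto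
  qed
  finally show ?thesis by simp
qed

section \<open>Brownian motion: increments, reflection and the maximal inequality in continuous
  time\<close>

locale brownian_motion = prob_space M for M :: "'a measure" +
  fixes B :: "real \<Rightarrow> 'a \<Rightarrow> real"
  assumes bm: "std_brownian_motion M B"
begin

lemma measurable_B [measurable]: "B t \<in> borel_measurable M"
  using bm by (simp add: std_brownian_motion_def)

lemma continuous_B: "\<omega> \<in> space M \<Longrightarrow> continuous_on {0..} (\<lambda>t. B t \<omega>)"
  using bm by (simp add: std_brownian_motion_def)

lemma B_0: "\<omega> \<in> space M \<Longrightarrow> B 0 \<omega> = 0"
  using bm by (simp add: std_brownian_motion_def)

lemma distributed_increment:
  "0 \<le> s \<Longrightarrow> s < t \<Longrightarrow> distributed M lborel (\<lambda>\<omega>. B t \<omega> - B s \<omega>) (normal_density 0 (sqrt (t - s)))"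
  using bm by (simp add: std_brownian_motion_def)

lemma indep_increments_list:
  assumes "sorted_wrt (<) ts" "\<forall>t\<in>set ts. 0 \<le> t"
  shows "indep_vars (\<lambda>_. borel) (\<lambda>i \<omega>. B (ts ! Suc i) \<omega> - B (ts ! i) \<omega>) {..<length ts - 1}"
  using bm assms by (simp add: std_brownian_motion_def)

lemma indep_increments:
  fixes t :: "nat \<Rightarrow> real"
  assumes "strict_mono t" "0 \<le> t 0"
  shows "indep_vars (\<lambda>_. borel) (\<lambda>i \<omega>. B (t (Suc i)) \<omega> - B (t i) \<omega>) {..<n}"
proof -
  let ?ts = "map t [0..<Suc n]"
  have "0 \<le> t i" for i
    using assms strict_mono_mono[OF assms(1)] by (meson monoD order_trans zero_le)
  moreover have "sorted_wrt (<) ?ts"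
    using assms(1) by (auto simp: sorted_wrt_iff_nth_less strict_mono_def simp del: upt_Suc)
  ultimately have "indep_vars (\<lambda>_. borel) (\<lambda>i \<omega>. B (?ts ! Suc i) \<omega> - B (?ts ! i) \<omega>) {..<length ?ts - 1}"
    by (intro indep_increments_list) auto
  then show ?thesis
    by (subst indep_vars_cong[where J = "{..<length ?ts - 1}" and Y = "\<lambda>i \<omega>. B (?ts ! Suc i) \<omega> - B (?ts ! i) \<omega>"])
       (auto simp: fun_eq_iff simp del: upt_Suc)
qed

text \<open>Symmetry: one-sided estimates become two-sided by interpreting the locale a second time
  for the reflected path.\<close>

lemma minus: "brownian_motion M (\<lambda>t \<omega>. - B t \<omega>)"
proof unfold_locales
  have "distributed M lborel (\<lambda>\<omega>. - B t \<omega> - - B s \<omega>) (normal_density 0 (sqrt (t - s)))" if "0 \<le> s" "s < t" for s t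
    using normal_density_affine[OF distributed_increment[OF that], where \<alpha> = "-1" and \<beta> = 0] that
    by (simp add: algebra_simps)
  moreover have "indep_vars (\<lambda>_. borel) (\<lambda>i \<omega>. - B (ts ! Suc i) \<omega> - - B (ts ! i) \<omega>) {..<length ts - 1}"
    if "sorted_wrt (<) ts" "\<forall>t\<in>set ts. 0 \<le> t" for ts
    using indep_vars_compose2[OF indep_increments_list[OF that], where Y = "\<lambda>_. uminus" and N = "\<lambda>_. borel"]
    by (simp add: algebra_simps)
  ultimately show "std_brownian_motion M (\<lambda>t \<omega>. - B t \<omega>)"
    using B_0 continuous_B prob_space_axioms unfolding std_brownian_motion_def
    by (auto intro!: continuous_on_minus)
qed

lemma maximal_inequality_grid:
  assumes "0 \<le> s" "0 < h" "0 \<le> a" "0 < n"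
  shows "prob {\<omega>\<in>space M. \<exists>k\<le>n. a < B (s + real k * (h / real n)) \<omega> - B s \<omega>} \<le> 2 * exp (- (a / sqrt h)\<^sup>2 / 2)"
proof -
  define t where "t k = s + real k * (h / real n)" for k
  have t: "strict_mono t" "0 \<le> t 0" "t 0 = s" "t n = s + h" "0 \<le> t k" for k
    using assms by (auto simp: t_def strict_mono_Suc_iff field_simps add_pos_nonneg)
  have tele: "(\<Sum>i\<in>{k..<m}. B (t (Suc i)) \<omega> - B (t i) \<omega>) = B (t m) \<omega> - B (t k) \<omega>" if "k \<le> m" for k m \<omega>
    using sum_Suc_diff'[OF that, of "\<lambda>i. B (t i) \<omega>"] by simp
  have tele0: "(\<Sum>i<m. B (t (Suc i)) \<omega> - B (t i) \<omega>) = B (t m) \<omega> - B s \<omega>" for m \<omega>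
    using tele[of 0 m \<omega>] t by (simp add: atLeast0LessThan)
  have "prob {\<omega>\<in>space M. \<exists>k\<le>n. a < (\<Sum>i<k. B (t (Suc i)) \<omega> - B (t i) \<omega>)}
      \<le> 2 * prob {\<omega>\<in>space M. a < (\<Sum>i<n. B (t (Suc i)) \<omega> - B (t i) \<omega>)}"
  proof (rule levy_maximal_inequality[OF indep_increments[OF t(1,2)]])
    fix k assume "k \<le> n"
    show "1 / 2 \<le> prob {\<omega>\<in>space M. 0 \<le> (\<Sum>i\<in>{k..<n}. B (t (Suc i)) \<omega> - B (t i) \<omega>)}"
    proof (cases "k = n")
      case False
      then have "t k < t n" using \<open>k \<le> n\<close> t(1) by (auto simp: strict_mono_def)
      then show ?thesis unfolding tele[OF \<open>k \<le> n\<close>]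
        using t by (intro normal_nonneg_ge_half[OF distributed_increment]) auto
    qed (simp add: prob_space)
  qed
  also have "prob {\<omega>\<in>space M. a < (\<Sum>i<n. B (t (Suc i)) \<omega> - B (t i) \<omega>)} \<le> exp (- (a / sqrt h)\<^sup>2 / 2)"
    unfolding tele0 t using normal_upper_tail[OF distributed_increment[of s "s + h"]] assms by simp
  finally show ?thesis unfolding tele0 by (simp add: t_def)
qed

text \<open>The dyadic grids are nested, so the exceptional events increase and their union inherits
  the common bound; path continuity then passes from dyadic times to all times. Stating the result
  with an exceptional event A avoids speaking of the measurability of a supremum over uncountably
  many times.\<close>

lemma maximal_inequality:
  assumes s: "0 \<le> s" and h: "0 < h" and a: "0 \<le> a"
  obtains A where "A \<in> events" "prob A \<le> 2 * exp (- (a / sqrt h)\<^sup>2 / 2)"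
    "\<And>\<omega> t. \<omega> \<in> space M - A \<Longrightarrow> t \<in> {s..s + h} \<Longrightarrow> B t \<omega> - B s \<omega> \<le> a"
proof -
  define A where "A m = {\<omega>\<in>space M. \<exists>k\<le>2 ^ m. a < B (s + real k * (h / real (2 ^ m))) \<omega> - B s \<omega>}" for m :: nat
  have A_ev: "range A \<subseteq> events"
    unfolding A_def by auto
  have "A m \<subseteq> A (Suc m)" for m
  proof
    fix \<omega> assume "\<omega> \<in> A m"
    then obtain k where "\<omega> \<in> space M" "k \<le> 2 ^ m" "a < B (s + real k * (h / real (2 ^ m))) \<omega> - B s \<omega>"
      by (auto simp: A_def)
    then show "\<omega> \<in> A (Suc m)" unfolding A_def by (auto intro!: exI[of _ "2 * k"])
  qed
  then have "incseq A" by (rule incseq_SucI)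
  then have lim: "(\<lambda>m. prob (A m)) \<longlonglongrightarrow> prob (\<Union>m. A m)"
    by (rule finite_Lim_measure_incseq[OF A_ev])
  have le: "prob (A m) \<le> 2 * exp (- (a / sqrt h)\<^sup>2 / 2)" for m
    unfolding A_def using maximal_inequality_grid[OF s h a, of "2 ^ m"] by simp
  show ?thesis
  proof (rule that)
    show "(\<Union>m. A m) \<in> events" using A_ev by auto
    show "prob (\<Union>m. A m) \<le> 2 * exp (- (a / sqrt h)\<^sup>2 / 2)"
      by (rule LIMSEQ_le_const2[OF lim]) (use le in auto)
    fix \<omega> t assume \<omega>: "\<omega> \<in> space M - (\<Union>m. A m)" and t: "t \<in> {s..s + h}"
    define k where "k m = nat \<lfloor>2 ^ m * ((t - s) / h)\<rfloor>" for m :: nat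
    define u where "u m = s + real (k m) * (h / real (2 ^ m))" for m
    have r: "0 \<le> (t - s) / h" "(t - s) / h \<le> 1" using t h by (auto simp: divide_simps)
    have k_real: "real (k m) = of_int \<lfloor>2 ^ m * ((t - s) / h)\<rfloor>" for m
      proof -
      have "0 \<le> 2 ^ m * ((t - s) / h)" by (intro mult_nonneg_nonneg r) simp
      then show ?thesis unfolding k_def by (intro of_nat_nat) linarith
    qed
    have k_le: "k m \<le> 2 ^ m" for m
    proof -
      have "real (k m) \<le> 2 ^ m * ((t - s) / h)" unfolding k_real by simp
      also have "\<dots> \<le> 2 ^ m" by (rule mult_left_le[OF r(2)]) simp
      finally show ?thesis by (metis of_nat_le_iff of_nat_numeral of_nat_power)
    qed
    have u_le: "B (u m) \<omega> - B s \<omega> \<le> a" for m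
      using \<omega> k_le[of m] unfolding A_def u_def by (auto simp: not_less)
    have u_bounds: "t - h * (1 / 2) ^ m \<le> u m" "u m \<le> t" for m
    proof -
      have "2 ^ m * ((t - s) / h) - 1 \<le> real (k m)" unfolding k_real by linarith
      then have "(2 ^ m * ((t - s) / h) - 1) * (h / 2 ^ m) \<le> real (k m) * (h / 2 ^ m)"
        using h by (intro mult_right_mono) auto
      moreover have "(2 ^ m * ((t - s) / h) - 1) * (h / 2 ^ m) = t - s - h * (1 / 2) ^ m"
        using h by (simp add: left_diff_distrib diff_divide_distrib power_divide)
      ultimately show "t - h * (1 / 2) ^ m \<le> u m"
        by (simp add: u_def)
      have "real (k m) * (h / 2 ^ m) \<le> (2 ^ m * ((t - s) / h)) * (h / 2 ^ m)"
        unfolding k_real using h by (intro mult_right_mono) auto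
      then show "u m \<le> t"
        using h by (simp add: u_def)
    qed
    have "(\<lambda>m. t - h * (1 / 2 :: real) ^ m) \<longlonglongrightarrow> t - h * 0"
      by (intro tendsto_intros LIMSEQ_realpow_zero) auto
    then have u_lim: "u \<longlonglongrightarrow> t"
      by (intro tendsto_sandwich[of "\<lambda>m. t - h * (1 / 2) ^ m" u sequentially "\<lambda>_. t"]) (use u_bounds in auto)
    have "(\<lambda>m. B (u m) \<omega>) \<longlonglongrightarrow> B t \<omega>"
    proof (rule continuous_on_tendsto_compose[OF continuous_B u_lim])
      have "0 \<le> u m" for m using s h by (simp add: u_def)
      then show "\<forall>\<^sub>F m in sequentially. u m \<in> {0..}" by simp
    qed (use \<omega> t s in auto)
    then have "(\<lambda>m. B (u m) \<omega> - B s \<omega>) \<longlonglongrightarrow> B t \<omega> - B s \<omega>"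
      by (intro tendsto_intros)
    then show "B t \<omega> - B s \<omega> \<le> a"
      by (rule LIMSEQ_le_const2) (use u_le in auto)
  qed
qed

lemma maximal_inequality_abs:
  assumes s: "0 \<le> s" and h: "0 < h" and a: "0 \<le> a"
  obtains A where "A \<in> events" "prob A \<le> 4 * exp (- (a / sqrt h)\<^sup>2 / 2)"
    "\<And>\<omega> t. \<omega> \<in> space M - A \<Longrightarrow> t \<in> {s..s + h} \<Longrightarrow> \<bar>B t \<omega> - B s \<omega>\<bar> \<le> a"
proof -
  interpret m: brownian_motion M "\<lambda>t \<omega>. - B t \<omega>" by (rule minus)
  from maximal_inequality[OF assms] obtain A where A: "A \<in> events" "prob A \<le> 2 * exp (- (a / sqrt h)\<^sup>2 / 2)"
    "\<And>\<omega> t. \<omega> \<in> space M - A \<Longrightarrow> t \<in> {s..s + h} \<Longrightarrow> B t \<omega> - B s \<omega> \<le> a"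
    by blast
  from m.maximal_inequality[OF assms] obtain A' where A': "A' \<in> events" "prob A' \<le> 2 * exp (- (a / sqrt h)\<^sup>2 / 2)"
    "\<And>\<omega> t. \<omega> \<in> space M - A' \<Longrightarrow> t \<in> {s..s + h} \<Longrightarrow> - B t \<omega> - - B s \<omega> \<le> a"
    by blast
  show ?thesis
  proof (rule that)
    show "A \<union> A' \<in> events" using A A' by auto
    show "prob (A \<union> A') \<le> 4 * exp (- (a / sqrt h)\<^sup>2 / 2)"
      using measure_Un_le[OF A(1) A'(1)] A(2) A'(2) by simp
    show "\<bar>B t \<omega> - B s \<omega>\<bar> \<le> a" if "\<omega> \<in> space M - (A \<union> A')" "t \<in> {s..s + h}" for \<omega> t
      using A(3)[of \<omega> t] A'(3)[of \<omega> t] that by auto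
  qed
qed

end

section \<open>The law of the iterated logarithm\<close>

text \<open>Independence is assumed for the complements, since their probabilities are what is
  multiplied: each factor 1 - p is at most exp (-p), and the divergent sum drives the product to
  0.\<close>

lemma (in prob_space) borel_cantelli_AE2:
  assumes ind: "indep_events (\<lambda>n. space M - A n) UNIV" and A: "\<And>n. A n \<in> events"
    and div: "\<not> summable (\<lambda>n. prob (A n))"
  shows "AE \<omega> in M. \<exists>\<^sub>F n in sequentially. \<omega> \<in> A n"
proof -
  have null: "prob (\<Inter>n\<in>{N..}. space M - A n) = 0" for N
  proof -
    have bound: "prob (\<Inter>n\<in>{N..}. space M - A n) \<le> exp (- (\<Sum>n\<in>{N..<Suc m}. prob (A n)))" if "N \<le> m" for m
    proof -
      have "prob (\<Inter>n\<in>{N..}. space M - A n) \<le> prob (\<Inter>n\<in>{N..<Suc m}. space M - A n)"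
        using A that by (intro finite_measure_mono) auto
      also have "\<dots> = (\<Prod>n\<in>{N..<Suc m}. prob (space M - A n))"
        using ind that unfolding indep_events_def by auto
      also have "\<dots> \<le> (\<Prod>n\<in>{N..<Suc m}. exp (- prob (A n)))"
        using A exp_ge_add_one_self[of "- prob (A n)" for n] by (intro prod_mono) (auto simp: prob_compl)
      also have "\<dots> = exp (- (\<Sum>n\<in>{N..<Suc m}. prob (A n)))"
        by (subst sum_negf[symmetric], subst exp_sum) auto
      finally show ?thesis .
    qed
    have "\<not> summable (\<lambda>n. prob (A (n + N)))"
      using div by (subst summable_iff_shift)
    have *: "\<exists>m. c < (\<Sum>n<m. prob (A (n + N)))" for c
    proof (rule ccontr)
      assume "\<nexists>m. c < (\<Sum>n<m. prob (A (n + N)))"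
      then have "(\<Sum>n\<le>m. prob (A (n + N))) \<le> c" for m
        by (simp add: not_less lessThan_Suc_atMost[symmetric] del: sum.lessThan_Suc)
      then have "summable (\<lambda>n. prob (A (n + N)))"
        by (intro bounded_imp_summable[of _ c]) auto
      then show False using \<open>\<not> summable (\<lambda>n. prob (A (n + N)))\<close> by contradiction
    qed
    show ?thesis
    proof (rule ccontr)
      assume "prob (\<Inter>n\<in>{N..}. space M - A n) \<noteq> 0"
      then have pos: "0 < prob (\<Inter>n\<in>{N..}. space M - A n)"
        by (simp add: zero_less_measure_iff)
      obtain m where m: "- ln (prob (\<Inter>n\<in>{N..}. space M - A n)) < (\<Sum>n<m. prob (A (n + N)))"
        using * by blast
      have "(\<Sum>n<m. prob (A (n + N))) = (\<Sum>n\<in>{N..<m+N}. prob (A n))"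
        using sum.shift_bounds_nat_ivl[of "\<lambda>n. prob (A n)" 0 N m] by (simp add: atLeast0LessThan)
      also have "\<dots> \<le> (\<Sum>n\<in>{N..<Suc (m+N)}. prob (A n))"
        by (intro sum_mono2) auto
      finally have "- ln (prob (\<Inter>n\<in>{N..}. space M - A n)) < (\<Sum>n\<in>{N..<Suc (m+N)}. prob (A n))"
        using m by linarith
      then have "exp (- (\<Sum>n\<in>{N..<Suc (m+N)}. prob (A n))) < exp (ln (prob (\<Inter>n\<in>{N..}. space M - A n)))"
        by simp
      then show False using bound[of "m + N", OF le_add2] unfolding exp_ln[OF pos] by linarith
    qed
  qed
  have "AE \<omega> in M. \<omega> \<notin> (\<Inter>n\<in>{N..}. space M - A n)" for N
    using A null[of N] by (intro AE_not_in) (auto simp: null_sets_def emeasure_eq_measure)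
  then have "AE \<omega> in M. \<forall>N. \<omega> \<notin> (\<Inter>n\<in>{N..}. space M - A n)"
    by (simp add: AE_all_countable)
  with AE_space show ?thesis
  proof eventually_elim
    case (elim \<omega>)
    show ?case unfolding frequently_sequentially
    proof
      fix N
      show "\<exists>n\<ge>N. \<omega> \<in> A n" using elim(1) elim(2)[rule_format, of N] by auto
    qed
  qed
qed

lemma geometric_interval:
  fixes q t :: real
  assumes "1 < q" "q ^ N \<le> t"
  obtains n where "N \<le> n" "q ^ n \<le> t" "t < q ^ Suc n"
proof -
  define m where "m = (LEAST m. t < q ^ m)"
  have ex: "\<exists>m. t < q ^ m" using assms(1) by (rule real_arch_pow)
  have m: "t < q ^ m" unfolding m_def using ex by (rule LeastI_ex)
  have "N < m"
  proof (rule ccontr)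
    assume "\<not> N < m"
    then have "q ^ m \<le> q ^ N" using assms(1) by (intro power_increasing) auto
    then show False using m assms(2) by simp
  qed
  then obtain n where n: "m = Suc n" "N \<le> n" by (cases m) auto
  have "\<not> t < q ^ n" using n not_less_Least[of n "\<lambda>m. t < q ^ m"] by (simp add: m_def)
  then show ?thesis using that[of n] n m by simp
qed

lemma iterated_log_mono:
  assumes "exp 1 \<le> s" "s \<le> t"
  shows "sqrt (2 * s * ln (ln s)) \<le> sqrt (2 * t * ln (ln t))"
proof -
  have s0: "0 < s" using assms(1) exp_gt_zero less_le_trans by blast
  with assms(1) have s: "0 < s" "1 \<le> ln s" by (auto simp: ln_ge_iff)
  then have "ln s \<le> ln t" using assms(2) by simp
  then have "ln (ln s) \<le> ln (ln t)"
    using s(2) by (subst ln_le_cancel_iff) linarith+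
  moreover have "0 \<le> ln (ln s)" using s(2) by (rule ln_ge_zero)
  ultimately show ?thesis using s assms(2) by (intro real_sqrt_le_mono mult_mono) auto
qed

context brownian_motion
begin

lemma iterated_log_upper:
  assumes \<epsilon>: "0 < \<epsilon>"
  shows "AE \<omega> in M. \<forall>\<^sub>F t in at_top. B t \<omega> \<le> (1 + \<epsilon>) * sqrt (2 * t * ln (ln t))"
proof -
  \<comment> \<open>The same q is the ratio of the times and the slack in the level
    \<open>a n\<close>. Of the two factors q in \<open>(a n)\<^sup>2\<close>, one pays for the
    passage from \<open>q ^ n\<close> to \<open>q ^ Suc n\<close>, and the other turns the tail into
    the summable \<open>real n powr - q\<close>.\<close>
  define q where "q = 1 + \<epsilon>"
  define a where "a n = q * sqrt (2 * q ^ n * ln (ln (q ^ n)))" for n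
  have q: "1 < q" using \<epsilon> by (simp add: q_def)
  obtain N where N: "exp 1 \<le> q ^ N" using real_arch_pow[OF q, of "exp 1"] by (meson less_imp_le)
  have N': "exp 1 \<le> q ^ n" if "N \<le> n" for n
    using N power_increasing[OF that, of q] q by (intro order_trans[OF N]) simp
  have pos: "0 \<le> ln (ln (q ^ n))" if "N \<le> n" for n
  proof -
    have "1 \<le> ln (q ^ n)" using N'[OF that] q by (subst ln_ge_iff) auto
    then show ?thesis by simp
  qed
  have "\<exists>A. A \<in> events \<and> (N \<le> n \<longrightarrow> prob A \<le> 2 * exp (- (a n / sqrt (q ^ Suc n))\<^sup>2 / 2) \<and>
     (\<forall>\<omega>\<in>space M - A. \<forall>t\<in>{0..q ^ Suc n}. B t \<omega> \<le> a n))" for n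
  proof (cases "N \<le> n")
    case True
    have "0 \<le> a n" using pos[OF True] q unfolding a_def by (intro mult_nonneg_nonneg real_sqrt_ge_zero) auto
    from maximal_inequality[OF _ _ this, of 0 "q ^ Suc n"] q
    obtain A where "A \<in> events" "prob A \<le> 2 * exp (- (a n / sqrt (q ^ Suc n))\<^sup>2 / 2)"
      "\<And>\<omega> t. \<omega> \<in> space M - A \<Longrightarrow> t \<in> {0..0 + q ^ Suc n} \<Longrightarrow> B t \<omega> - B 0 \<omega> \<le> a n" by auto
    then show ?thesis using B_0 by (intro exI[of _ A]) auto
  qed auto
  then obtain A where A: "\<And>n. A n \<in> events" "\<And>n. N \<le> n \<Longrightarrow> prob (A n) \<le> 2 * exp (- (a n / sqrt (q ^ Suc n))\<^sup>2 / 2)"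
     "\<And>n \<omega> t. N \<le> n \<Longrightarrow> \<omega>\<in>space M - A n \<Longrightarrow> t\<in>{0..q ^ Suc n} \<Longrightarrow> B t \<omega> \<le> a n" by metis
  have bound: "prob (A n) \<le> 2 * (ln q powr - q * real n powr - q)" if "max N 1 \<le> n" for n
  proof -
    have "(a n / sqrt (q ^ Suc n))\<^sup>2 / 2 = q * ln (ln (q ^ n))"
      using q pos[of n] that by (simp add: a_def power_divide power_mult_distrib field_simps power2_eq_square)
    then have "prob (A n) \<le> 2 * exp (- q * ln (ln (q ^ n)))" using A(2)[of n] that by simp
    also have "exp (- q * ln (ln (q ^ n))) = (real n * ln q) powr - q"
      using q that by (simp add: powr_def ln_realpow)
    also have "\<dots> = ln q powr - q * real n powr - q"
      using q by (simp add: powr_mult)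
    finally show ?thesis .
  qed
  have "summable (\<lambda>n. 2 * (ln q powr - q * real n powr - q))"
    using q by (intro summable_mult) (simp add: summable_real_powr_iff)
  then have summ: "summable (\<lambda>n. prob (A n))"
    by (rule summable_comparison_test_ev[rotated])
       (use bound in \<open>auto simp: eventually_sequentially intro!: exI[of _ "max N 1"]\<close>)
  have "AE \<omega> in M. eventually (\<lambda>n. \<omega> \<in> space M - A n) sequentially"
    using A(1) summ by (intro borel_cantelli_AE1) (auto simp: emeasure_eq_measure)
  then show ?thesis
  proof eventually_elim
    case (elim \<omega>)
    then obtain N1 where N1: "\<And>n. N1 \<le> n \<Longrightarrow> \<omega> \<in> space M - A n" by (auto simp: eventually_sequentially)
    show ?case unfolding eventually_at_top_linorder
    proof (intro exI allI impI)
      fix t assume "q ^ (max N N1) \<le> t"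
      then obtain n where n: "max N N1 \<le> n" "q ^ n \<le> t" "t < q ^ Suc n"
        using geometric_interval[OF q] by blast
      moreover have "0 \<le> t" using n q by (meson order_trans zero_le_power less_imp_le zero_less_one less_trans)
      ultimately have "B t \<omega> \<le> a n" using A(3)[of n \<omega> t] N1[of n] by auto
      also have "\<dots> \<le> (1 + \<epsilon>) * sqrt (2 * t * ln (ln t))"
        unfolding a_def q_def[symmetric] using q iterated_log_mono[OF N'[of n] n(2)] n by (intro mult_left_mono) auto
      finally show "B t \<omega> \<le> (1 + \<epsilon>) * sqrt (2 * t * ln (ln t))" .
    qed
  qed
qed

text \<open>Increments over successive geometric intervals are independent. Since d < 1, the
  exponent in the Gaussian lower bound is about d^2 ln n, eventually below ln n, so the
  probabilities dominate a multiple of the harmonic series.\<close>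

lemma iterated_log_increments:
  assumes q: "1 < q" and d: "0 < d" "d < 1"
  shows "AE \<omega> in M. \<exists>\<^sub>F n in sequentially.
    d * sqrt (2 * (q ^ Suc n - q ^ n) * ln (ln (q ^ Suc n))) < B (q ^ Suc n) \<omega> - B (q ^ n) \<omega>"
proof -
  define a where "a n = d * sqrt (2 * (q ^ Suc n - q ^ n) * ln (ln (q ^ Suc n)))" for n
  define A where "A n = {\<omega>\<in>space M. a n < B (q ^ Suc n) \<omega> - B (q ^ n) \<omega>}" for n
  have mono: "strict_mono (\<lambda>n. q ^ n)" using q by (simp add: strict_mono_Suc_iff)
  have "indep_vars (\<lambda>_. borel) (\<lambda>i \<omega>. B (q ^ Suc i) \<omega> - B (q ^ i) \<omega>) {..<n}" for n
    using indep_increments[OF mono] by simp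
  then have ind: "indep_events (\<lambda>n. {\<omega>\<in>space M. \<not> a n < B (q ^ Suc n) \<omega> - B (q ^ n) \<omega>}) {..<n}" for n
    by (rule indep_eventsI_indep_vars) auto
  have "indep_events (\<lambda>n. space M - A n) UNIV"
  proof (rule indep_eventsI)
    fix J :: "nat set" assume J: "finite J" "J \<noteq> {}"
    then obtain n where n: "J \<subseteq> {..<n}" by (metis finite_nat_iff_bounded)
    have "space M - A n = {\<omega>\<in>space M. \<not> a n < B (q ^ Suc n) \<omega> - B (q ^ n) \<omega>}" for n
      by (auto simp: A_def)
    then show "prob (\<Inter>n\<in>J. space M - A n) = (\<Prod>n\<in>J. prob (space M - A n))"
      using ind[of n] n J unfolding indep_events_def by auto
  qed (auto simp: A_def)
  moreover have "A n \<in> events" for n by (auto simp: A_def)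
  moreover have "\<not> summable (\<lambda>n. prob (A n))"
  proof
    assume summ: "summable (\<lambda>n. prob (A n))"
    define c where "c = ln q"
    have c: "0 < c" using q by (simp add: c_def)
    have ev1: "\<forall>\<^sub>F n in sequentially. (d * sqrt (2 * ln (real (Suc n) * c)) + 1)\<^sup>2 / 2 \<le> ln (real (Suc n))"
    proof -
      \<comment> \<open>The limit is d^2, written in the form that the asymptotics procedure
        returns; both c = ln q and the shift by 1 vanish in it.\<close>
      have 1: "((\<lambda>n. (d * sqrt (2 * ln (real (Suc n) * c)) + 1)\<^sup>2 / 2 / ln (real (Suc n))) \<longlongrightarrow> (d * 2 powr (1 / 2))\<^sup>2 / 2) sequentially"
        using c d by real_asymp
      have "(d * 2 powr (1 / 2))\<^sup>2 / 2 < 1" using d by (simp add: powr_half_sqrt power_mult_distrib power_less_one_iff)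
      from order_tendstoD(2)[OF 1 this] have "\<forall>\<^sub>F n in sequentially. (d * sqrt (2 * ln (real (Suc n) * c)) + 1)\<^sup>2 / 2 / ln (real (Suc n)) < 1" .
      moreover have "\<forall>\<^sub>F n in sequentially. 0 < ln (real (Suc n))" by real_asymp
      ultimately show ?thesis by eventually_elim (simp add: divide_simps)
    qed
    have ev2: "\<forall>\<^sub>F n in sequentially. 1 \<le> real (Suc n) * c" using c by real_asymp
    have "\<forall>\<^sub>F n in sequentially. norm (1 / real (Suc n)) \<le> sqrt (2 * pi) * prob (A n)"
      using ev1 ev2
    proof eventually_elim
      case (elim n)
      have lnln: "ln (q ^ Suc n) = real (Suc n) * c" using q by (simp add: ln_realpow c_def del: power_Suc)
      have pos: "0 < q ^ Suc n - q ^ n" using q by simp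
      have *: "a n / sqrt (q ^ Suc n - q ^ n) = d * sqrt (2 * ln (real (Suc n) * c))"
      proof -
        define D where "D = q ^ Suc n - q ^ n"
        have "0 < D" using pos by (simp only: D_def)
        then show ?thesis unfolding a_def lnln D_def[symmetric] by (simp add: real_sqrt_mult)
      qed
      have "0 \<le> ln (real (Suc n) * c)" using elim(2) by simp
      then have "0 \<le> a n" unfolding a_def lnln using pos d by (intro mult_nonneg_nonneg real_sqrt_ge_zero) auto
      then have "exp (- (a n / sqrt (q ^ Suc n - q ^ n) + 1)\<^sup>2 / 2) / sqrt (2 * pi) \<le> prob (A n)"
        unfolding A_def using q pos by (intro normal_lower_tail[OF distributed_increment]) auto
      then have "exp (- (d * sqrt (2 * ln (real (Suc n) * c)) + 1)\<^sup>2 / 2) \<le> sqrt (2 * pi) * prob (A n)"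
        unfolding * by (simp add: field_simps)
      moreover have "exp (- ln (real (Suc n))) \<le> exp (- (d * sqrt (2 * ln (real (Suc n) * c)) + 1)\<^sup>2 / 2)"
        using elim(1) by simp
      moreover have "exp (- ln (real (Suc n))) = 1 / real (Suc n)"
        by (simp add: exp_minus divide_inverse)
      moreover have "norm (1 / real (Suc n)) = 1 / real (Suc n)" by simp
      ultimately show ?case by linarith
    qed
    then have "summable (\<lambda>n. 1 / real (Suc n))"
      by (rule summable_comparison_test_ev) (intro summable_mult summ)
    then show False
      using not_summable_harmonic[where 'a = real] summable_Suc_iff[of "\<lambda>n. 1 / real n"] by (simp add: inverse_eq_divide)
  qed
  ultimately have "AE \<omega> in M. \<exists>\<^sub>F n in sequentially. \<omega> \<in> A n"
    by (rule borel_cantelli_AE2)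
  then show ?thesis
    by eventually_elim (auto simp: A_def a_def elim: frequently_mono[rotated])
qed

lemma iterated_log_lower:
  assumes \<epsilon>: "0 < \<epsilon>" "\<epsilon> < 1"
  shows "AE \<omega> in M. \<exists>\<^sub>F t in at_top. (1 - \<epsilon>) * sqrt (2 * t * ln (ln t)) \<le> B t \<omega>"
proof -
  interpret m: brownian_motion M "\<lambda>t \<omega>. - B t \<omega>" by (rule minus)
  define d where "d = 1 - \<epsilon> / 2"
  have d: "0 < d" "d < 1" using \<epsilon> by (auto simp: d_def)
  \<comment> \<open>For a large ratio q the last increment carries almost all of
    \<open>B (q ^ Suc n)\<close>: it contributes d sqrt (1 - 1/q) of the normalisation. The term 2 /
    sqrt q pays for a possibly negative \<open>B (q ^ n)\<close>, bounded by the upper half of the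
    law for -B with \<epsilon> = 1.\<close>
  have "((\<lambda>q. d * sqrt (1 - 1 / q) - 2 / sqrt q) \<longlongrightarrow> d) at_top"
    by real_asymp
  moreover have "1 - \<epsilon> < d" using \<epsilon> by (simp add: d_def)
  ultimately have "\<forall>\<^sub>F q in at_top. 1 - \<epsilon> < d * sqrt (1 - 1 / q) - 2 / sqrt q"
    by (rule order_tendstoD)
  then obtain q where q: "1 < q" "1 - \<epsilon> < d * sqrt (1 - 1 / q) - 2 / sqrt q"
    using eventually_happens[OF eventually_conj[OF _ eventually_gt_at_top[of 1]], of "\<lambda>q. 1 - \<epsilon> < d * sqrt (1 - 1 / q) - 2 / sqrt q"]
    by auto
  have top: "filterlim (\<lambda>n. q ^ n) at_top sequentially"
    using q(1) by real_asymp
  from iterated_log_increments[OF q(1) d] m.iterated_log_upper[of 1, simplified]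
  show ?thesis
  proof eventually_elim
    case (elim \<omega>)
    have "\<forall>\<^sub>F t in at_top. exp 1 \<le> (t::real)" by (rule eventually_ge_at_top)
    from eventually_conj[OF elim(2) this]
    have "\<forall>\<^sub>F n in sequentially. - B (q ^ n) \<omega> \<le> 2 * sqrt (2 * q ^ n * ln (ln (q ^ n))) \<and> exp 1 \<le> q ^ n"
      by (rule eventually_compose_filterlim[OF _ top])
    with elim(1) have "\<exists>\<^sub>F n in sequentially. (1 - \<epsilon>) * sqrt (2 * q ^ Suc n * ln (ln (q ^ Suc n))) \<le> B (q ^ Suc n) \<omega>"
    proof (rule frequently_rev_mp[OF _ eventually_mono])
      fix n
      define Q l L where "Q = q ^ n" and "l = ln (ln (q ^ Suc n))" and "L = sqrt (2 * q ^ Suc n * l)"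
      assume "- B (q ^ n) \<omega> \<le> 2 * sqrt (2 * q ^ n * ln (ln (q ^ n))) \<and> exp 1 \<le> q ^ n"
      then have 1: "- B Q \<omega> \<le> 2 * sqrt (2 * Q * ln (ln Q))" and Q: "exp 1 \<le> Q"
        by (auto simp: Q_def)
      have Q0: "0 < Q" using q(1) by (simp add: Q_def)
      have QQ: "q ^ Suc n = q * Q" by (simp add: Q_def)
      have lnQ: "1 \<le> ln Q" using Q Q0 by (simp add: ln_ge_iff)
      have "ln Q \<le> ln (q * Q)" using Q0 q(1) by (simp add: ln_mult)
      then have "ln (ln Q) \<le> ln (ln (q * Q))" using lnQ by (subst ln_le_cancel_iff) linarith+
      moreover have "0 \<le> ln (ln Q)" using lnQ by (rule ln_ge_zero)
      ultimately have "ln (ln Q) \<le> l" "0 \<le> l" by (simp_all only: l_def QQ)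
      have "sqrt (2 * Q * ln (ln Q)) \<le> sqrt (2 * Q * l)"
        using \<open>ln (ln Q) \<le> l\<close> Q0 by (intro real_sqrt_le_mono mult_left_mono) auto
      also have "2 * Q * l = (2 * (q * Q) * l) / q" using q(1) by simp
      also have "sqrt \<dots> = L / sqrt q" unfolding L_def QQ by (rule real_sqrt_divide)
      finally have 2: "sqrt (2 * Q * ln (ln Q)) \<le> L / sqrt q" .
      have "2 * (q * Q - Q) * l = (1 - 1 / q) * (2 * (q * Q) * l)"
        using q(1) by (simp add: field_simps)
      then have 3: "sqrt (2 * (q * Q - Q) * l) = sqrt (1 - 1 / q) * L"
        unfolding L_def QQ by (simp only: real_sqrt_mult[of "1 - 1 / q" "2 * (q * Q) * l"])
      have L: "0 \<le> L" using \<open>0 \<le> l\<close> Q0 q(1) by (simp add: L_def)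
      show "d * sqrt (2 * (q ^ Suc n - q ^ n) * ln (ln (q ^ Suc n))) < B (q ^ Suc n) \<omega> - B (q ^ n) \<omega> \<longrightarrow>
          (1 - \<epsilon>) * sqrt (2 * q ^ Suc n * ln (ln (q ^ Suc n))) \<le> B (q ^ Suc n) \<omega>"
      proof
        assume "d * sqrt (2 * (q ^ Suc n - q ^ n) * ln (ln (q ^ Suc n))) < B (q ^ Suc n) \<omega> - B (q ^ n) \<omega>"
        then have "d * (sqrt (1 - 1 / q) * L) < B (q ^ Suc n) \<omega> - B Q \<omega>"
          unfolding 3[symmetric] by (simp add: l_def Q_def)
        moreover have "(1 - \<epsilon>) * L \<le> (d * sqrt (1 - 1 / q) - 2 / sqrt q) * L"
          using q(2) L by (intro mult_right_mono) auto
        moreover have "(d * sqrt (1 - 1 / q) - 2 / sqrt q) * L = d * (sqrt (1 - 1 / q) * L) - 2 * (L / sqrt q)"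
          by (simp add: algebra_simps)
        ultimately have "(1 - \<epsilon>) * L \<le> B (q ^ Suc n) \<omega>"
          using 1 2 by linarith
        then show "(1 - \<epsilon>) * sqrt (2 * q ^ Suc n * ln (ln (q ^ Suc n))) \<le> B (q ^ Suc n) \<omega>"
          by (simp only: L_def l_def)
      qed
    qed
    moreover have "filterlim (\<lambda>n. q ^ Suc n) at_top sequentially"
      using top by (rule filterlim_sequentially_Suc[THEN iffD2])
    ultimately show ?case
      unfolding frequently_def by (blast dest: eventually_compose_filterlim)
  qed
qed

end

section \<open>Local times of Brownian motion\<close>

text \<open>A set of k + 1 times is determined by its least element and its k gaps. Letting the gaps
  range freely over \<open>{1..N}\<close> only enlarges the nonnegative sum and makes it a
  product.\<close>

lemma sum_chains_le:
  fixes f :: "nat \<Rightarrow> real"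
  assumes f: "\<And>d. 0 \<le> f d"
  shows "(\<Sum>S | S \<subseteq> {..<N} \<and> card S = Suc k.
      \<Prod>i<k. f (sorted_list_of_set S ! Suc i - sorted_list_of_set S ! i)) \<le> real N * (\<Sum>d=1..N. f d) ^ k"
proof -
  let ?\<S> = "{S. S \<subseteq> {..<N} \<and> card S = Suc k}"
  let ?l = "\<lambda>S::nat set. sorted_list_of_set S"
  define gaps where "gaps S = (?l S ! 0, \<lambda>i\<in>{..<k}. ?l S ! Suc i - ?l S ! i)" for S
  have S: "length (?l S) = Suc k" "sorted_wrt (<) (?l S)" "set (?l S) = S" "S \<subseteq> {..<N}" if "S \<in> ?\<S>" for S
    using that finite_subset[of S "{..<N}"] by auto
  have step: "?l S ! i < ?l S ! Suc i" if "S \<in> ?\<S>" "i < k" for S i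
    using S[OF that(1)] that(2) by (simp add: sorted_wrt_iff_nth_less)
  have mem: "?l S ! i < N" if "S \<in> ?\<S>" "i \<le> k" for S i
    using S[OF that(1)] that(2) nth_mem[of i "?l S"] by auto
  have inj: "inj_on gaps ?\<S>"
  proof (rule inj_onI)
    fix S T assume ST: "S \<in> ?\<S>" "T \<in> ?\<S>" and eq: "gaps S = gaps T"
    have "?l S ! i = ?l T ! i" if "i \<le> k" for i
      using that
    proof (induction i)
      case 0
      then show ?case using eq by (simp add: gaps_def)
    next
      case (Suc i)
      then have "(\<lambda>i\<in>{..<k}. ?l S ! Suc i - ?l S ! i) i = (\<lambda>i\<in>{..<k}. ?l T ! Suc i - ?l T ! i) i"
        using eq by (simp add: gaps_def)
      then show ?case using Suc step[OF ST(1), of i] step[OF ST(2), of i] by auto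
    qed
    then have "?l S = ?l T"
      using S(1)[OF ST(1)] S(1)[OF ST(2)] by (intro nth_equalityI) auto
    then show "S = T" using S(3)[OF ST(1)] S(3)[OF ST(2)] by metis
  qed
  have sub: "gaps ` ?\<S> \<subseteq> {..<N} \<times> ({..<k} \<rightarrow>\<^sub>E {1..N})"
  proof (rule image_subsetI)
    fix S assume S': "S \<in> ?\<S>"
    have "?l S ! Suc i - ?l S ! i \<in> {1..N}" if "i < k" for i
      using step[OF S' that] mem[OF S', of "Suc i"] that by auto
    then show "gaps S \<in> {..<N} \<times> ({..<k} \<rightarrow>\<^sub>E {1..N})"
      using mem[OF S', of 0] by (auto simp: gaps_def)
  qed
  have "(\<Sum>S\<in>?\<S>. \<Prod>i<k. f (?l S ! Suc i - ?l S ! i)) = (\<Sum>S\<in>?\<S>. \<Prod>i<k. f (snd (gaps S) i))"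
    by (intro sum.cong prod.cong) (auto simp: gaps_def)
  also have "\<dots> = (\<Sum>p\<in>gaps ` ?\<S>. \<Prod>i<k. f (snd p i))"
    by (subst sum.reindex[OF inj]) simp
  also have "\<dots> \<le> (\<Sum>p\<in>{..<N} \<times> ({..<k} \<rightarrow>\<^sub>E {1..N}). \<Prod>i<k. f (snd p i))"
    using f by (intro sum_mono2 sub prod_nonneg) (auto intro!: finite_PiE)
  also have "\<dots> = (\<Sum>x<N. \<Sum>g\<in>{..<k} \<rightarrow>\<^sub>E {1..N}. \<Prod>i<k. f (g i))"
    by (subst sum.cartesian_product) (simp add: case_prod_unfold)
  also have "\<dots> = real N * (\<Prod>i<k. \<Sum>d=1..N. f d)"
    by (subst prod_sum_PiE) auto
  finally show ?thesis by simp
qed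

context brownian_motion
begin

lemma prob_small_increments_le:
  assumes t: "sorted_wrt (<) ts" "\<forall>t\<in>set ts. 0 \<le> t" "length ts = Suc k" and r: "0 \<le> r"
  shows "prob {\<omega>\<in>space M. \<forall>i<k. \<bar>B (ts ! Suc i) \<omega> - B (ts ! i) \<omega>\<bar> \<le> r}
    \<le> (\<Prod>i<k. r / sqrt (ts ! Suc i - ts ! i))"
proof (cases "k = 0")
  case False
  have "prob {\<omega>\<in>space M. \<forall>i<k. \<bar>B (ts ! Suc i) \<omega> - B (ts ! i) \<omega>\<bar> \<le> r}
      = prob (\<Inter>i\<in>{..<k}. {\<omega>\<in>space M. \<bar>B (ts ! Suc i) \<omega> - B (ts ! i) \<omega>\<bar> \<le> r})"
    using False by (intro arg_cong[where f = prob]) auto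
  also have "\<dots> = (\<Prod>i<k. prob {\<omega>\<in>space M. \<bar>B (ts ! Suc i) \<omega> - B (ts ! i) \<omega>\<bar> \<le> r})"
  proof -
    have "indep_events (\<lambda>i. {\<omega>\<in>space M. \<bar>B (ts ! Suc i) \<omega> - B (ts ! i) \<omega>\<bar> \<le> r}) {..<k}"
      using indep_eventsI_indep_vars[OF indep_increments_list[OF t(1,2)], of "\<lambda>_ x. \<bar>x\<bar> \<le> r"] t(3) by simp
    then show ?thesis using False unfolding indep_events_def by auto
  qed
  also have "\<dots> \<le> (\<Prod>i<k. r / sqrt (ts ! Suc i - ts ! i))"
  proof (rule prod_mono, intro conjI)
    fix i assume "i \<in> {..<k}"
    then have "ts ! i < ts ! Suc i" "0 \<le> ts ! i"
      using t by (auto simp: sorted_wrt_iff_nth_less)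
    then show "prob {\<omega>\<in>space M. \<bar>B (ts ! Suc i) \<omega> - B (ts ! i) \<omega>\<bar> \<le> r} \<le> r / sqrt (ts ! Suc i - ts ! i)"
      using r by (intro normal_small_ball[OF distributed_increment]) auto
  qed simp
  finally show ?thesis .
qed (simp add: prob_space)

text \<open>Markov's inequality for the number of \<open>(k+1)\<close>-element sets of visit times. Two visits to an interval
  force a small increment of \<open>B\<close> between them, whatever the centre \<open>v\<close> is; so the bound is uniform in \<open>v\<close>.\<close>

lemma visits_bound:
  assumes s: "0 \<le> s" and h: "0 < h" and r: "0 \<le> r" and m: "Suc k \<le> m"
  obtains A where "A \<in> events"
    "prob A \<le> real N * (\<Sum>d=1..N. 2 * r / sqrt (real d * h)) ^ k / real (m choose Suc k)"
    "\<And>\<omega> v. \<omega> \<in> space M - A \<Longrightarrow> card {j. j < N \<and> \<bar>B (s + real j * h) \<omega> - v\<bar> \<le> r} < m"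
proof -
  let ?\<S> = "{S. S \<subseteq> {..<N} \<and> card S = Suc k}"
  let ?l = "\<lambda>S::nat set. sorted_list_of_set S"
  define t where "t j = s + real j * h" for j
  define E where "E S = {\<omega>\<in>space M. \<forall>i<k. \<bar>B (t (?l S ! Suc i)) \<omega> - B (t (?l S ! i)) \<omega>\<bar> \<le> 2 * r}" for S
  have E [measurable]: "E S \<in> events" for S unfolding E_def by measurable
  have t_mono: "t i < t j \<longleftrightarrow> i < j" for i j using h by (simp add: t_def)
  have S: "length (?l S) = Suc k" "sorted_wrt (<) (?l S)" if "S \<in> ?\<S>" for S
    using that finite_subset[of S "{..<N}"] by auto
  have prob_E: "prob (E S) \<le> (\<Prod>i<k. 2 * r / sqrt (real (?l S ! Suc i - ?l S ! i) * h))" if "S \<in> ?\<S>" for S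
  proof -
    let ?ts = "map t (?l S)"
    have "prob (E S) = prob {\<omega>\<in>space M. \<forall>i<k. \<bar>B (?ts ! Suc i) \<omega> - B (?ts ! i) \<omega>\<bar> \<le> 2 * r}"
      unfolding E_def using S(1)[OF that] by (intro arg_cong[where f = prob]) auto
    also have "\<dots> \<le> (\<Prod>i<k. 2 * r / sqrt (?ts ! Suc i - ?ts ! i))"
      using S[OF that] s h r
      by (intro prob_small_increments_le) (auto simp: t_mono t_def sorted_wrt_map)
    also have "\<dots> = (\<Prod>i<k. 2 * r / sqrt (real (?l S ! Suc i - ?l S ! i) * h))"
    proof (intro prod.cong refl)
      fix i assume "i \<in> {..<k}"
      then have "?l S ! i < ?l S ! Suc i" using S[OF that] by (simp add: sorted_wrt_iff_nth_less)
      then have "?ts ! Suc i - ?ts ! i = real (?l S ! Suc i - ?l S ! i) * h"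
        using S(1)[OF that] \<open>i \<in> {..<k}\<close> by (simp add: t_def of_nat_diff algebra_simps)
      then show "2 * r / sqrt (?ts ! Suc i - ?ts ! i) = 2 * r / sqrt (real (?l S ! Suc i - ?l S ! i) * h)" by simp
    qed
    finally show ?thesis .
  qed
  define U where "U \<omega> = (\<Sum>S\<in>?\<S>. indicator (E S) \<omega> :: real)" for \<omega>
  have pos: "0 < m choose Suc k" using m by simp
  have U_int: "integrable M U" unfolding U_def by (intro Bochner_Integration.integrable_sum) (auto simp: emeasure_eq_measure)
  have "expectation U = (\<Sum>S\<in>?\<S>. prob (E S))"
    unfolding U_def by (subst Bochner_Integration.integral_sum) (auto simp: emeasure_eq_measure)
  also have "\<dots> \<le> (\<Sum>S\<in>?\<S>. \<Prod>i<k. 2 * r / sqrt (real (?l S ! Suc i - ?l S ! i) * h))"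
    by (intro sum_mono prob_E)
  also have "\<dots> \<le> real N * (\<Sum>d=1..N. 2 * r / sqrt (real d * h)) ^ k"
    using r h by (intro sum_chains_le[where f = "\<lambda>d. 2 * r / sqrt (real d * h)"]) auto
  finally have EU: "expectation U \<le> real N * (\<Sum>d=1..N. 2 * r / sqrt (real d * h)) ^ k" .
  show ?thesis
  proof (rule that)
    let ?A = "{\<omega>\<in>space M. real (m choose Suc k) \<le> U \<omega>}"
    show "?A \<in> events" using U_int by measurable
    have "prob ?A \<le> expectation U / real (m choose Suc k)"
      using pos by (intro integral_Markov_inequality_measure[OF U_int sets.top]) (auto simp: U_def intro!: sum_nonneg)
    also have "\<dots> \<le> real N * (\<Sum>d=1..N. 2 * r / sqrt (real d * h)) ^ k / real (m choose Suc k)"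
      using EU by (intro divide_right_mono) auto
    finally show "prob ?A \<le> \<dots>" .
    fix \<omega> v assume \<omega>: "\<omega> \<in> space M - ?A"
    let ?J = "{j. j < N \<and> \<bar>B (s + real j * h) \<omega> - v\<bar> \<le> r}"
    show "card ?J < m"
    proof (rule ccontr)
      assume "\<not> card ?J < m"
      have "finite ?J" by simp
      have "\<omega> \<in> E S" if S': "S \<subseteq> ?J" "card S = Suc k" for S
        unfolding E_def
      proof safe
        fix i assume "i < k"
        have "S \<in> ?\<S>" using S' by auto
        from S(1)[OF this] have "?l S ! i \<in> S" "?l S ! Suc i \<in> S"
          using nth_mem[of i "?l S"] nth_mem[of "Suc i" "?l S"] \<open>i < k\<close> finite_subset[OF S'(1) \<open>finite ?J\<close>] by auto
        with S'(1) have "?l S ! i \<in> ?J" "?l S ! Suc i \<in> ?J" by blast+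
        then show "\<bar>B (t (?l S ! Suc i)) \<omega> - B (t (?l S ! i)) \<omega>\<bar> \<le> 2 * r"
          unfolding t_def mem_Collect_eq by linarith
      qed (use \<omega> in auto)
      then have "(\<Sum>S | S \<subseteq> ?J \<and> card S = Suc k. 1) = (\<Sum>S | S \<subseteq> ?J \<and> card S = Suc k. indicator (E S) \<omega> :: real)"
        by (intro sum.cong) auto
      also have "\<dots> \<le> U \<omega>"
        unfolding U_def by (intro sum_mono2) auto
      finally have "(\<Sum>S | S \<subseteq> ?J \<and> card S = Suc k. 1) \<le> U \<omega>" .
      then have "real (card ?J choose Suc k) \<le> U \<omega>"
        using n_subsets[OF \<open>finite ?J\<close>, of "Suc k"] by simp
      moreover have "m choose Suc k \<le> card ?J choose Suc k"
        using \<open>\<not> card ?J < m\<close> by (intro binomial_right_mono) simp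
      ultimately show False using \<omega> by (auto simp: not_le)
    qed
  qed
qed

end

section \<open>The probability that a block is not regular\<close>

lemma sum_inverse_sqrt_le: "(\<Sum>d=1..N. 1 / sqrt (real d)) \<le> 2 * sqrt (real N)"
proof (induction N)
  case (Suc N)
  have "1 / sqrt (real (Suc N)) \<le> 2 / (sqrt (real (Suc N)) + sqrt (real N))"
  proof -
    have "1 / a \<le> 2 / (a + c)" if "c \<le> a" "0 < a" "0 \<le> c" for a c :: real
      using that by (simp add: field_simps)
    from this[of "sqrt (real N)" "sqrt (real (Suc N))"] show ?thesis by simp
  qed
  also have "\<dots> = 2 * (sqrt (real (Suc N)) - sqrt (real N))"
  proof -
    have "(sqrt (real (Suc N)) - sqrt (real N)) * (sqrt (real (Suc N)) + sqrt (real N)) = 1"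
      by (simp add: algebra_simps)
    moreover have "0 < sqrt (real (Suc N)) + sqrt (real N)" by (simp add: add_pos_nonneg)
    moreover have *: "a * b = 1 \<Longrightarrow> 0 < b \<Longrightarrow> 2 / b = 2 * a" for a b :: real
      by (simp add: divide_eq_eq)
    ultimately show ?thesis by (intro *)
  qed
  finally show ?case using Suc by simp
qed simp

text \<open>One term of the exponential series. At \<open>x = 2 ^ b\<close> it turns a Gaussian tail
  into an arbitrarily high negative power of \<open>2 ^ b\<close>, the currency in which all
  exceptions are counted.\<close>

lemma exp_minus_square_le:
  assumes "0 < (x::real)"
  shows "exp (- x\<^sup>2 / 2) \<le> fact p * 2 ^ p / x ^ (2 * p)"
proof -
  have "(x\<^sup>2 / 2) ^ p / fact p = inverse (fact p) *\<^sub>R (x\<^sup>2 / 2) ^ p" by (simp only: divide_inverse real_scaleR_def mult.commute)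
  also have "\<dots> = (\<Sum>n\<in>{p}. (x\<^sup>2 / 2) ^ n /\<^sub>R fact n)" by simp
  also have "\<dots> \<le> exp (x\<^sup>2 / 2)"
    unfolding exp_def by (rule sum_le_suminf[OF summable_exp_generic]) auto
  finally have "1 / exp (x\<^sup>2 / 2) \<le> 1 / ((x\<^sup>2 / 2) ^ p / fact p)"
    using assms by (intro divide_left_mono) auto
  also have "\<dots> = fact p * 2 ^ p / x ^ (2 * p)"
    by (simp add: power_divide power_mult)
  finally show ?thesis
    by (simp add: exp_minus inverse_eq_divide)
qed

text \<open>A block of length \<open>2 ^ (2 * b * q) * e\<^sup>2\<close> consists of sub-blocks of length \<open>e\<^sup>2\<close>, the diffusive time scale of \<open>e\<close>.
  A local time would allow about \<open>2 ^ (b * q)\<close> visited sub-blocks; the extra factor \<open>2 ^ (2 * b)\<close> makes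
  exceptions summable.\<close>

definition regular_block :: "nat \<Rightarrow> nat \<Rightarrow> (real \<Rightarrow> real) \<Rightarrow> real \<Rightarrow> real \<Rightarrow> bool" where
  "regular_block q b w \<sigma> e \<longleftrightarrow> (\<forall>v. card {k. k < 2 ^ (2 * b * q) \<and>
     (\<exists>t\<in>{\<sigma> + real k * e\<^sup>2..\<sigma> + real (Suc k) * e\<^sup>2}. \<bar>w t - v\<bar> \<le> 2 * e)} \<le> 2 ^ (b * (q + 2)))"

context brownian_motion
begin

text \<open>A block fails to be regular for one of two reasons: too many left ends of sub-blocks lie
  near a common centre (first term, of free moment order k), or the path oscillates by more than
  \<open>2 ^ b * e\<close> within a sub-block (second term, of free order p).\<close>

lemma regular_block_aux:
  assumes \<sigma>: "0 \<le> \<sigma>" and e: "0 < e" and k: "Suc k \<le> 2 ^ (b * (q + 2))"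
  shows "\<exists>A\<in>events. prob A \<le> 12 ^ k * real (Suc k) ^ Suc k * 2 ^ (b * q) / 2 ^ (b * (k + 2))
      + 4 * fact p * 2 ^ p * 2 ^ (2 * b * q) / 2 ^ (2 * b * p) \<and>
    (\<forall>\<omega>\<in>space M - A. regular_block q b (\<lambda>t. B t \<omega>) \<sigma> e)"
proof -
  define N u where "N = (2::nat) ^ (2 * b * q)" and "u = (2::real) ^ b"
  define m where "m = (2::nat) ^ (b * (q + 2))"
  have u: "1 \<le> u" by (simp add: u_def)
  have N: "real N = (u ^ q)\<^sup>2" by (simp add: N_def u_def power_mult[symmetric] mult_ac)
  have m: "real m = u ^ (q + 2)" by (simp only: m_def u_def power_mult of_nat_power of_nat_numeral)
  obtain A1 where A1: "A1 \<in> events"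
    "prob A1 \<le> real N * (\<Sum>d=1..N. 2 * (3 * u * e) / sqrt (real d * e\<^sup>2)) ^ k / real (m choose Suc k)"
    "\<And>\<omega> v. \<omega> \<in> space M - A1 \<Longrightarrow> card {j. j < N \<and> \<bar>B (\<sigma> + real j * e\<^sup>2) \<omega> - v\<bar> \<le> 3 * u * e} < m"
    using visits_bound[OF \<sigma>, of "e\<^sup>2" "3 * u * e" k m N] e u k unfolding m_def by auto
  \<comment> \<open>As sqrt N = u^q, each link of a chain of visits contributes at most 12 u^(q+1),
    whereas the threshold m is u^(q+2). Every further moment therefore wins a factor u, up to
    constants.\<close>
  have "(\<Sum>d=1..N. 2 * (3 * u * e) / sqrt (real d * e\<^sup>2)) = 6 * u * (\<Sum>d=1..N. 1 / sqrt (real d))"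
    unfolding sum_distrib_left using e by (intro sum.cong) (auto simp: real_sqrt_mult)
  also have "\<dots> \<le> 6 * u * (2 * sqrt (real N))"
    using u by (intro mult_left_mono sum_inverse_sqrt_le) auto
  also have "\<dots> = 12 * u ^ (q + 1)"
    unfolding N using u by simp
  finally have Q: "(\<Sum>d=1..N. 2 * (3 * u * e) / sqrt (real d * e\<^sup>2)) \<le> 12 * u ^ (q + 1)" .
  have ch: "(real m / real (Suc k)) ^ Suc k \<le> real (m choose Suc k)"
    using binomial_ge_n_over_k_pow_k[OF k, where 'a = real] unfolding m_def by simp
  have "prob A1 \<le> real N * (12 * u ^ (q + 1)) ^ k / (real m / real (Suc k)) ^ Suc k"
  proof (rule order_trans[OF A1(2)], rule frac_le)
    show "real N * (\<Sum>d=1..N. 2 * (3 * u * e) / sqrt (real d * e\<^sup>2)) ^ k \<le> real N * (12 * u ^ (q + 1)) ^ k"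
      using e u by (intro mult_left_mono power_mono Q sum_nonneg) auto
    show "0 < (real m / real (Suc k)) ^ Suc k" by (simp add: m_def)
  qed (use u ch in auto)
  also have "\<dots> = 12 ^ k * real (Suc k) ^ Suc k * (u ^ (2 * q) * u ^ ((q + 1) * k) / u ^ ((q + 2) * Suc k))"
  proof -
    have "a * (b * c) / (x / y) = b * y * (a * c / x)" for a b c x y :: real by simp
    moreover have "real N = u ^ (2 * q)" unfolding N by (simp add: power_mult[symmetric] mult.commute)
    moreover have "(12 * u ^ (q + 1)) ^ k = 12 ^ k * u ^ ((q + 1) * k)"
      by (simp only: power_mult_distrib power_mult)
    moreover have "(real m / real (Suc k)) ^ Suc k = u ^ ((q + 2) * Suc k) / real (Suc k) ^ Suc k"
      by (simp only: m power_divide power_mult)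
    ultimately show ?thesis by simp
  qed
  also have "u ^ (2 * q) * u ^ ((q + 1) * k) / u ^ ((q + 2) * Suc k) = u ^ q / u ^ (k + 2)"
  proof -
    have "u ^ (2 * q) * u ^ ((q + 1) * k) * u ^ (k + 2) = u ^ q * u ^ ((q + 2) * Suc k)"
      unfolding power_add[symmetric] by (rule arg_cong[where f = "\<lambda>n. u ^ n"]) (simp add: algebra_simps)
    then show ?thesis using u by (simp add: divide_simps)
  qed
  finally have PA1: "prob A1 \<le> 12 ^ k * real (Suc k) ^ Suc k * (u ^ q / u ^ (k + 2))" .
  have "\<exists>A\<in>events. prob A \<le> 4 * exp (- u\<^sup>2 / 2) \<and> (\<forall>\<omega>\<in>space M - A.
     \<forall>t\<in>{\<sigma> + real j * e\<^sup>2..\<sigma> + real j * e\<^sup>2 + e\<^sup>2}. \<bar>B t \<omega> - B (\<sigma> + real j * e\<^sup>2) \<omega>\<bar> \<le> u * e)" for j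
  proof -
    have "0 \<le> \<sigma> + real j * e\<^sup>2" "0 < e\<^sup>2" "0 \<le> u * e" using e u \<sigma> by auto
    from maximal_inequality_abs[OF this] obtain A where "A \<in> events" "prob A \<le> 4 * exp (- (u * e / sqrt (e\<^sup>2))\<^sup>2 / 2)"
      "\<And>\<omega> t. \<omega> \<in> space M - A \<Longrightarrow> t \<in> {\<sigma> + real j * e\<^sup>2..\<sigma> + real j * e\<^sup>2 + e\<^sup>2} \<Longrightarrow>
        \<bar>B t \<omega> - B (\<sigma> + real j * e\<^sup>2) \<omega>\<bar> \<le> u * e" by blast
    moreover have "u * e / sqrt (e\<^sup>2) = u" using e by simp
    ultimately show ?thesis by (intro bexI[of _ A]) auto
  qed
  then obtain A2 where A2: "\<And>j. A2 j \<in> events" "\<And>j. prob (A2 j) \<le> 4 * exp (- u\<^sup>2 / 2)"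
    "\<And>j \<omega> t. \<omega> \<in> space M - A2 j \<Longrightarrow> t \<in> {\<sigma> + real j * e\<^sup>2..\<sigma> + real j * e\<^sup>2 + e\<^sup>2} \<Longrightarrow>
      \<bar>B t \<omega> - B (\<sigma> + real j * e\<^sup>2) \<omega>\<bar> \<le> u * e" by metis
  have "prob (\<Union>j<N. A2 j) \<le> (\<Sum>j<N. prob (A2 j))"
    using A2(1) by (intro finite_measure_subadditive_finite) auto
  also have "\<dots> \<le> (\<Sum>j<N. 4 * exp (- u\<^sup>2 / 2))" by (intro sum_mono A2(2))
  also have "\<dots> = real N * (4 * exp (- u\<^sup>2 / 2))" by simp
  also have "\<dots> \<le> real N * (4 * (fact p * 2 ^ p / u ^ (2 * p)))"
    using u by (intro mult_left_mono exp_minus_square_le) auto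
  finally have PA2: "prob (\<Union>j<N. A2 j) \<le> 4 * fact p * 2 ^ p * (u ^ (2 * q)) / u ^ (2 * p)"
    unfolding N by (simp add: power_mult[symmetric] mult_ac)
  show ?thesis
  proof (intro bexI[of _ "A1 \<union> (\<Union>j<N. A2 j)"] conjI ballI)
    show "A1 \<union> (\<Union>j<N. A2 j) \<in> events" using A1(1) A2(1) by auto
    have "prob (A1 \<union> (\<Union>j<N. A2 j)) \<le> prob A1 + prob (\<Union>j<N. A2 j)"
      using A1(1) A2(1) by (intro measure_Un_le) auto
    then show "prob (A1 \<union> (\<Union>j<N. A2 j)) \<le> 12 ^ k * real (Suc k) ^ Suc k * 2 ^ (b * q) / 2 ^ (b * (k + 2))
      + 4 * fact p * 2 ^ p * 2 ^ (2 * b * q) / 2 ^ (2 * b * p)"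
    proof -
      have "u ^ q = 2 ^ (b * q)" "u ^ (k + 2) = 2 ^ (b * (k + 2))" "u ^ (2 * q) = 2 ^ (2 * b * q)" "u ^ (2 * p) = 2 ^ (2 * b * p)"
        unfolding u_def power_mult[symmetric] by (simp_all only: mult.assoc mult.left_commute)
      then show ?thesis using \<open>prob (A1 \<union> (\<Union>j<N. A2 j)) \<le> prob A1 + prob (\<Union>j<N. A2 j)\<close> PA1 PA2
        by (simp only: times_divide_eq_right)
    qed
    fix \<omega> assume \<omega>: "\<omega> \<in> space M - (A1 \<union> (\<Union>j<N. A2 j))"
    show "regular_block q b (\<lambda>t. B t \<omega>) \<sigma> e"
      unfolding regular_block_def
    proof
      fix v
      let ?J = "{k. k < 2 ^ (2 * b * q) \<and> (\<exists>t\<in>{\<sigma> + real k * e\<^sup>2..\<sigma> + real (Suc k) * e\<^sup>2}. \<bar>B t \<omega> - v\<bar> \<le> 2 * e)}"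
      \<comment> \<open>A visit anywhere in a sub-block is seen at its left end: the radius grows
        from 2 e by the oscillation u e, and 2 e + u e \<le> 3 u e because u \<ge> 1.\<close>
      have "?J \<subseteq> {j. j < N \<and> \<bar>B (\<sigma> + real j * e\<^sup>2) \<omega> - v\<bar> \<le> 3 * u * e}"
      proof safe
        fix j t assume j: "j < 2 ^ (2 * b * q)" and t: "t \<in> {\<sigma> + real j * e\<^sup>2..\<sigma> + real (Suc j) * e\<^sup>2}"
          and "\<bar>B t \<omega> - v\<bar> \<le> 2 * e"
        have "\<bar>B t \<omega> - B (\<sigma> + real j * e\<^sup>2) \<omega>\<bar> \<le> u * e"
          using \<omega> j t by (intro A2(3)[of \<omega> j]) (auto simp: N_def algebra_simps)
        moreover have "e \<le> u * e" using u e by simp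
        ultimately show "\<bar>B (\<sigma> + real j * e\<^sup>2) \<omega> - v\<bar> \<le> 3 * u * e"
          using \<open>\<bar>B t \<omega> - v\<bar> \<le> 2 * e\<close> by linarith
      qed (simp add: N_def)
      then have "card ?J \<le> card {j. j < N \<and> \<bar>B (\<sigma> + real j * e\<^sup>2) \<omega> - v\<bar> \<le> 3 * u * e}"
        by (intro card_mono) auto
      also have "\<dots> < m" using A1(3) \<omega> by auto
      finally show "card ?J \<le> 2 ^ (b * (q + 2))" by (simp add: m_def)
    qed
  qed
qed

lemma regular_block_prob:
  shows "\<exists>C. \<forall>\<^sub>F b in sequentially. \<forall>\<sigma>\<ge>0. \<forall>e>0. \<exists>A\<in>events. prob A \<le> C / 2 ^ (b * K) \<and>
    (\<forall>\<omega>\<in>space M - A. regular_block q b (\<lambda>t. B t \<omega>) \<sigma> e)"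
proof -
  \<comment> \<open>One order serves both error terms: q compensates the powers
    \<open>2 ^ (b * q)\<close> and \<open>2 ^ (2 * b * q)\<close> in the numerators, and K leaves at
    least the required decay. The condition \<open>Suc k \<le> b\<close> below ensures that the
    threshold of visits is at least k + 1.\<close>
  define k C1 C2 where "k = q + K" and "C1 = (12 ^ k * real (Suc k) ^ Suc k)" and "C2 = (4 * fact k * 2 ^ k :: real)"
  show ?thesis unfolding eventually_sequentially
  proof (rule exI[of _ "C1 + C2"], rule exI[of _ "Suc k"], intro allI impI)
    fix b and \<sigma> e :: real assume b: "Suc k \<le> b" and "0 \<le> \<sigma>" "0 < e"
    have "Suc k < 2 ^ Suc k" by (rule less_exp)
    also have "(2::nat) ^ Suc k \<le> 2 ^ (b * (q + 2))" using b by (intro power_increasing) (auto intro: order_trans)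
    finally have k: "Suc k \<le> 2 ^ (b * (q + 2))" by simp
    from regular_block_aux[OF \<open>0 \<le> \<sigma>\<close> \<open>0 < e\<close> this, of k] obtain A where A: "A \<in> events"
      "prob A \<le> C1 * 2 ^ (b * q) / 2 ^ (b * (k + 2)) + C2 * 2 ^ (2 * b * q) / 2 ^ (2 * b * k)"
      "\<forall>\<omega>\<in>space M - A. regular_block q b (\<lambda>t. B t \<omega>) \<sigma> e"
      unfolding C1_def C2_def by blast
    have pow: "(2::real) ^ x / 2 ^ y \<le> 1 / 2 ^ z" if "x + z \<le> y" for x y z :: nat
    proof -
      have "(2::real) ^ x * 2 ^ z \<le> 2 ^ y"
        unfolding power_add[symmetric] using that by (intro power_increasing) auto
      then show ?thesis by (simp add: divide_simps mult_ac)
    qed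
    have "C1 * (2 ^ (b * q) / 2 ^ (b * (k + 2))) \<le> C1 * (1 / 2 ^ (b * K))"
      by (intro mult_left_mono pow) (auto simp: C1_def k_def algebra_simps)
    moreover have "C2 * (2 ^ (2 * b * q) / 2 ^ (2 * b * k)) \<le> C2 * (1 / 2 ^ (b * K))"
      by (intro mult_left_mono pow) (auto simp: C2_def k_def algebra_simps)
    ultimately have "prob A \<le> (C1 + C2) / 2 ^ (b * K)"
      using A(2) by (simp add: add_divide_distrib)
    with A show "\<exists>A\<in>events. prob A \<le> (C1 + C2) / 2 ^ (b * K) \<and>
      (\<forall>\<omega>\<in>space M - A. regular_block q b (\<lambda>t. B t \<omega>) \<sigma> e)" by blast
  qed
qed

text \<open>Borel-Cantelli in b. The window with indices n and j starts at
  \<open>real j * 4 ^ n\<close> and has length \<open>4 ^ n\<close>; on rung i it consists of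
  \<open>2 ^ (2 * b * q * i)\<close> blocks, numbered by l. Bounding n by \<open>d * b\<close> keeps
  the number of events finite for each b, while every fixed window is covered from some b
  on.\<close>

lemma AE_regular_blocks:
  "AE \<omega> in M. \<forall>\<^sub>F b in sequentially. \<forall>n\<le>d * b. \<forall>j\<in>{1..3::nat}. \<forall>i<q. \<forall>l<2 ^ (2 * b * q * i).
    regular_block q b (\<lambda>t. B t \<omega>) (real j * 4 ^ n + real l * (2 ^ n / 2 ^ (b * q * i))\<^sup>2) (2 ^ n / 2 ^ (b * q * Suc i))"
proof -
  \<comment> \<open>The index set has (d b + 1) 3 q 2^(2 b q^2) elements, with l running up to the
    size of the lowest rung throughout. This K cancels the exponential factor and leaves 2^(-b)
    times a linear function of b.\<close>
  define K where "K = 2 * q * q + 1"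
  define I where "I b = {..d * b} \<times> {1..3::nat} \<times> {..<q} \<times> {..<(2::nat) ^ (2 * b * q * q)}" for b
  define \<sigma> e where "\<sigma> b = (\<lambda>(n, j, i, l). real j * 4 ^ n + real l * (2 ^ n / 2 ^ (b * q * i))\<^sup>2)"
    and "e b = (\<lambda>(n, j::nat, i, l::nat). 2 ^ n / 2 ^ (b * q * Suc i) :: real)" for b
  obtain C b0 where C: "\<forall>b\<ge>b0. \<forall>\<sigma>\<ge>0. \<forall>e>0. \<exists>A\<in>events. prob A \<le> C / 2 ^ (b * K) \<and>
    (\<forall>\<omega>\<in>space M - A. regular_block q b (\<lambda>t. B t \<omega>) \<sigma> e)"
    using regular_block_prob[of K q] unfolding eventually_sequentially by blast
  have "\<exists>A\<in>events. b0 \<le> b \<longrightarrow> prob A \<le> C / 2 ^ (b * K) \<and>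
    (\<forall>\<omega>\<in>space M - A. regular_block q b (\<lambda>t. B t \<omega>) (\<sigma> b x) (e b x))" for b x
  proof (cases "b0 \<le> b")
    case True
    have "0 \<le> \<sigma> b x" "0 < e b x" by (auto simp: \<sigma>_def e_def case_prod_unfold)
    then show ?thesis using C True by blast
  qed auto
  then obtain A where A: "\<And>b x. A b x \<in> events" "\<And>b x. b0 \<le> b \<Longrightarrow> prob (A b x) \<le> C / 2 ^ (b * K)"
    "\<And>b x \<omega>. b0 \<le> b \<Longrightarrow> \<omega> \<in> space M - A b x \<Longrightarrow> regular_block q b (\<lambda>t. B t \<omega>) (\<sigma> b x) (e b x)"
    by metis
  have bound: "prob (\<Union>x\<in>I b. A b x) \<le> real (Suc (d * b)) * (3 * real q) * (C / 2 ^ b)" if "b0 \<le> b" for b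
  proof -
    have "prob (\<Union>x\<in>I b. A b x) \<le> (\<Sum>x\<in>I b. prob (A b x))"
      using A(1) by (intro finite_measure_subadditive_finite) (auto simp: I_def)
    also have "\<dots> \<le> (\<Sum>x\<in>I b. C / 2 ^ (b * K))" by (intro sum_mono A(2) that)
    also have "\<dots> = real (Suc (d * b)) * (3 * real q) * (2 ^ (2 * b * q * q) * (C / 2 ^ (b * K)))"
    proof -
      have "real (card (I b)) = real (Suc (d * b)) * (3 * real q) * 2 ^ (2 * b * q * q)"
        by (simp add: I_def card_cartesian_product algebra_simps)
      then show ?thesis by (simp only: sum_constant mult.assoc)
    qed
    also have "2 ^ (2 * b * q * q) * (C / 2 ^ (b * K)) = C / 2 ^ b"
    proof -
      have "b * K = 2 * b * q * q + b" by (simp add: K_def algebra_simps)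
      then show ?thesis by (simp add: power_add)
    qed
    finally show ?thesis .
  qed
  have "summable (\<lambda>b. real (Suc (d * b)) * (3 * real q) * (C / 2 ^ b))"
  proof -
    have 1: "summable (\<lambda>b. real b * (1 / 2) ^ b)" 
    proof (rule summable_comparison_test_bigo)
      show "(\<lambda>b. real b * (1 / 2) ^ b) \<in> O(\<lambda>b. (3 / 4) ^ b)" by real_asymp
    qed simp
    have "summable (\<lambda>b. (3 * real q * C * d) * (real b * (1 / 2) ^ b) + (3 * real q * C) * (1 / 2) ^ b)"
      by (intro summable_add summable_mult 1 summable_geometric) auto
    then show ?thesis by (simp add: algebra_simps power_divide)
  qed
  then have "summable (\<lambda>b. prob (\<Union>x\<in>I b. A b x))"
    by (rule summable_comparison_test_ev[rotated]) (use bound in \<open>auto simp: eventually_sequentially\<close>)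
  then have "AE \<omega> in M. eventually (\<lambda>b. \<omega> \<in> space M - (\<Union>x\<in>I b. A b x)) sequentially"
    using A(1) by (intro borel_cantelli_AE1) (auto simp: emeasure_eq_measure I_def intro!: sets.finite_UN)
  then show ?thesis
  proof eventually_elim
    case (elim \<omega>)
    with eventually_ge_at_top[of b0] show ?case
    proof eventually_elim
      case (elim b)
      show ?case
      proof (intro allI impI ballI)
        fix n j i l :: nat assume *: "n \<le> d * b" "j \<in> {1..3}" "i < q" "l < 2 ^ (2 * b * q * i)"
        have "(2::nat) ^ (2 * b * q * i) \<le> 2 ^ (2 * b * q * q)"
          using * by (intro power_increasing) auto
        with *(4) have "l < 2 ^ (2 * b * q * q)" by linarith
        then have "(n, j, i, l) \<in> I b" using *(1-3) by (auto simp: I_def)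
        then have "regular_block q b (\<lambda>t. B t \<omega>) (\<sigma> b (n, j, i, l)) (e b (n, j, i, l))"
          by (intro A(3)) (use elim in blast)+
        then show "regular_block q b (\<lambda>t. B t \<omega>) (real j * 4 ^ n + real l * (2 ^ n / 2 ^ (b * q * i))\<^sup>2) (2 ^ n / 2 ^ (b * q * Suc i))"
          by (simp add: \<sigma>_def e_def)
      qed
    qed
  qed
qed

end

section \<open>Occupation times of perturbed paths\<close>

text \<open>Compares the visited blocks of size \<open>d\<^sup>2\<close> with the visited sub-blocks of size \<open>e\<^sup>2\<close>. Where \<open>A\<close> grows by at most \<open>e\<close>
  in a block, \<open>V\<close> can be frozen and regularity applies; the other blocks are paid for by the growth of \<open>A\<close>.\<close>

lemma card_hit_blocks_Suc:
  fixes w V A :: "real \<Rightarrow> real"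
  assumes e: "0 < e" and d: "d\<^sup>2 = 2 ^ (2 * b * q) * e\<^sup>2" "e \<le> d"
    and A: "\<And>t u. s \<le> t \<Longrightarrow> t \<le> u \<Longrightarrow> u \<le> s + real N * d\<^sup>2 \<Longrightarrow> \<bar>V u - V t\<bar> \<le> A u - A t"
    and reg: "\<And>l. l < N \<Longrightarrow> regular_block q b w (s + real l * d\<^sup>2) e"
  shows "real (card {l. l < N * 2 ^ (2 * b * q) \<and> (\<exists>t\<in>{s + real l * e\<^sup>2..s + real (Suc l) * e\<^sup>2}. \<bar>w t + V t\<bar> \<le> e)})
    \<le> 2 ^ (b * (q + 2)) * real (card {l. l < N \<and> (\<exists>t\<in>{s + real l * d\<^sup>2..s + real (Suc l) * d\<^sup>2}. \<bar>w t + V t\<bar> \<le> d)})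
      + 2 ^ (2 * b * q) * (A (s + real N * d\<^sup>2) - A s) / e"
proof -
  define R P where "R = (2::nat) ^ (2 * b * q)" and "P = (2::nat) ^ (b * (q + 2))"
  have R: "0 < R" by (simp add: R_def)
  have dR: "d\<^sup>2 = real R * e\<^sup>2" using d by (simp add: R_def)
  define \<sigma> where "\<sigma> l = s + real l * d\<^sup>2" for l
  let ?H' = "{l. l < N * R \<and> (\<exists>t\<in>{s + real l * e\<^sup>2..s + real (Suc l) * e\<^sup>2}. \<bar>w t + V t\<bar> \<le> e)}"
  let ?H = "{l. l < N \<and> (\<exists>t\<in>{s + real l * d\<^sup>2..s + real (Suc l) * d\<^sup>2}. \<bar>w t + V t\<bar> \<le> d)}"
  define C where "C l = {k. k < R \<and> (\<exists>t\<in>{\<sigma> l + real k * e\<^sup>2..\<sigma> l + real (Suc k) * e\<^sup>2}. \<bar>w t + V t\<bar> \<le> e)}" for l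
  have sub: "{\<sigma> l + real k * e\<^sup>2..\<sigma> l + real (Suc k) * e\<^sup>2} \<subseteq> {\<sigma> l..\<sigma> (Suc l)}" if "k < R" for l k
  proof -
    have "real (Suc k) * e\<^sup>2 \<le> real R * e\<^sup>2"
      using that by (intro mult_right_mono) auto
    then show ?thesis by (auto simp: \<sigma>_def dR algebra_simps)
  qed
  have \<sigma>_le: "s \<le> \<sigma> l" "l < N \<Longrightarrow> \<sigma> (Suc l) \<le> s + real N * d\<^sup>2" "\<sigma> l \<le> \<sigma> (Suc l)" for l
    by (auto simp: \<sigma>_def intro!: mult_right_mono)
  have "card ?H' \<le> card (SIGMA l:?H. C l)"
  proof (rule card_inj_on_le[where f = "\<lambda>l. (l div R, l mod R)"])
    show "inj_on (\<lambda>l. (l div R, l mod R)) ?H'"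
      by (rule inj_onI) (metis div_mult_mod_eq prod.inject)
    show "(\<lambda>l. (l div R, l mod R)) ` ?H' \<subseteq> (SIGMA l:?H. C l)"
    proof safe
      fix l t assume l: "l < N * R" and t: "t \<in> {s + real l * e\<^sup>2..s + real (Suc l) * e\<^sup>2}" and x: "\<bar>w t + V t\<bar> \<le> e"
      have "real l = real (l div R) * real R + real (l mod R)"
        by (metis div_mult_mod_eq of_nat_add of_nat_mult)
      then have eq: "s + real l * e\<^sup>2 = \<sigma> (l div R) + real (l mod R) * e\<^sup>2"
        "s + real (Suc l) * e\<^sup>2 = \<sigma> (l div R) + real (Suc (l mod R)) * e\<^sup>2"
        by (simp_all add: \<sigma>_def dR algebra_simps)
      have mod: "l mod R < R" using R by simp
      show "l div R < N" using l by (simp add: less_mult_imp_div_less)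
      have "t \<in> {\<sigma> (l div R)..\<sigma> (Suc (l div R))}"
        using sub[OF mod, of "l div R"] t unfolding eq by blast
      then show "\<exists>t\<in>{s + real (l div R) * d\<^sup>2..s + real (Suc (l div R)) * d\<^sup>2}. \<bar>w t + V t\<bar> \<le> d"
        using x d(2) unfolding \<sigma>_def by (intro bexI[of _ t]) auto
      show "l mod R \<in> C (l div R)"
        using mod t x unfolding C_def eq by auto
    qed
    show "finite (SIGMA l:?H. C l)" by (intro finite_SigmaI) (auto simp: C_def)
  qed
  also have "card (SIGMA l:?H. C l) = (\<Sum>l\<in>?H. card (C l))"
    by (rule card_SigmaI) (auto simp: C_def)
  finally have "real (card ?H') \<le> (\<Sum>l\<in>?H. real (card (C l)))"
    by (simp only: of_nat_sum[symmetric] of_nat_le_iff)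
  also have "\<dots> \<le> (\<Sum>l\<in>?H. real P + real R / e * (A (\<sigma> (Suc l)) - A (\<sigma> l)))"
  proof (rule sum_mono)
    fix l assume "l \<in> ?H"
    then have l: "l < N" by simp
    have A0: "0 \<le> A (\<sigma> (Suc l)) - A (\<sigma> l)"
      using A[of "\<sigma> l" "\<sigma> (Suc l)"] \<sigma>_le[of l] l by linarith
    show "real (card (C l)) \<le> real P + real R / e * (A (\<sigma> (Suc l)) - A (\<sigma> l))"
    proof (cases "A (\<sigma> (Suc l)) - A (\<sigma> l) \<le> e")
      case True
      have "C l \<subseteq> {k. k < 2 ^ (2 * b * q) \<and>
          (\<exists>t\<in>{\<sigma> l + real k * e\<^sup>2..\<sigma> l + real (Suc k) * e\<^sup>2}. \<bar>w t - (- V (\<sigma> l))\<bar> \<le> 2 * e)}"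
      proof
        fix k assume "k \<in> C l"
        then obtain t where k: "k < R" and t: "t \<in> {\<sigma> l + real k * e\<^sup>2..\<sigma> l + real (Suc k) * e\<^sup>2}" "\<bar>w t + V t\<bar> \<le> e"
          by (auto simp: C_def)
        have "t \<in> {\<sigma> l..\<sigma> (Suc l)}" using sub[OF k, of l] t(1) by blast
        then have t': "\<sigma> l \<le> t" "t \<le> \<sigma> (Suc l)" by auto
        have "\<bar>V t - V (\<sigma> l)\<bar> \<le> A t - A (\<sigma> l)" using t' \<sigma>_le[of l] l by (intro A) auto
        \<comment> \<open>This yields \<open>A t \<le> A (\<sigma> (Suc l))\<close>: the hypothesis
          on A contains its monotonicity. Hence V moves by at most e up to t, and with the distance
          e from 0 this gives the radius \<open>2 * e\<close> in
          \<open>regular_block\<close>.\<close>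
        moreover have "\<bar>V (\<sigma> (Suc l)) - V t\<bar> \<le> A (\<sigma> (Suc l)) - A t" using t' \<sigma>_le[of l] l by (intro A) auto
        ultimately have "\<bar>w t - (- V (\<sigma> l))\<bar> \<le> 2 * e" using t(2) True by linarith
        then show "k \<in> {k. k < 2 ^ (2 * b * q) \<and>
          (\<exists>t\<in>{\<sigma> l + real k * e\<^sup>2..\<sigma> l + real (Suc k) * e\<^sup>2}. \<bar>w t - (- V (\<sigma> l))\<bar> \<le> 2 * e)}"
          using k t(1) by (auto simp: R_def)
      qed
      then have "card (C l) \<le> card {k. k < 2 ^ (2 * b * q) \<and>
          (\<exists>t\<in>{\<sigma> l + real k * e\<^sup>2..\<sigma> l + real (Suc k) * e\<^sup>2}. \<bar>w t - (- V (\<sigma> l))\<bar> \<le> 2 * e)}"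
        by (intro card_mono) auto
      also have "\<dots> \<le> P"
        using reg[OF l] unfolding regular_block_def P_def \<sigma>_def by blast
      finally have "real (card (C l)) \<le> real P" by simp
      moreover have "0 \<le> real R / e * (A (\<sigma> (Suc l)) - A (\<sigma> l))" using e A0 by simp
      ultimately show ?thesis by linarith
    next
      case False
      have "C l \<subseteq> {..<R}" by (auto simp: C_def)
      then have "card (C l) \<le> card {..<R}" by (intro card_mono) auto
      then have "real (card (C l)) \<le> real R / e * e" using e by simp
      also have "\<dots> \<le> real R / e * (A (\<sigma> (Suc l)) - A (\<sigma> l))"
        using False e by (intro mult_left_mono) auto
      finally show ?thesis by simp
    qed
  qed
  also have "\<dots> = real P * real (card ?H) + real R / e * (\<Sum>l\<in>?H. A (\<sigma> (Suc l)) - A (\<sigma> l))"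
    by (simp only: sum.distrib sum_distrib_left sum_constant mult.commute)
  also have "\<dots> \<le> real P * real (card ?H) + real R / e * (\<Sum>l<N. A (\<sigma> (Suc l)) - A (\<sigma> l))"
  proof (intro add_left_mono mult_left_mono sum_mono2)
    fix l assume "l \<in> {..<N} - ?H"
    then have l: "l < N" by simp
    show "0 \<le> A (\<sigma> (Suc l)) - A (\<sigma> l)"
      using A[of "\<sigma> l" "\<sigma> (Suc l)"] \<sigma>_le[of l] l by linarith
  qed (use e in auto)
  also have "(\<Sum>l<N. A (\<sigma> (Suc l)) - A (\<sigma> l)) = A (\<sigma> N) - A (\<sigma> 0)"
    by (rule sum_lessThan_telescope)
  finally show ?thesis
    by (simp add: R_def P_def \<sigma>_def)
qed

text \<open>The comparison of two scales is iterated q times from the single block of length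
  \<open>E\<^sup>2\<close>. Relative to \<open>P ^ i\<close> each rung adds at most R K / E: the
  cost of moving blocks is K / e on the new scale e, and \<open>1 / e (Suc i)\<close> is at most
  \<open>P ^ Suc i / E\<close>. The visited blocks of the last rung cover the set.\<close>

lemma emeasure_near_zero_le:
  fixes w V A :: "real \<Rightarrow> real"
  assumes E: "0 < E" and q: "1 \<le> q"
    and A: "\<And>t u. s \<le> t \<Longrightarrow> t \<le> u \<Longrightarrow> u \<le> s + E\<^sup>2 \<Longrightarrow> \<bar>V u - V t\<bar> \<le> A u - A t"
    and reg: "\<And>i l. i < q \<Longrightarrow> l < 2 ^ (2 * b * q * i) \<Longrightarrow>
      regular_block q b w (s + real l * (E / 2 ^ (b * q * i))\<^sup>2) (E / 2 ^ (b * q * Suc i))"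
  shows "emeasure lborel {t\<in>{s..s+E\<^sup>2}. \<bar>w t + V t\<bar> \<le> E / 2 ^ (b * q * q)}
    \<le> ennreal (E\<^sup>2 * (real q * (1 + (A (s + E\<^sup>2) - A s) / E)) * (2 ^ (4 * b * q) / 2 ^ (b * q * q)))"
proof -
  define e where "e i = E / 2 ^ (b * q * i)" for i
  define N where "N i = (2::nat) ^ (2 * b * q * i)" for i
  define R P where "R = (2::real) ^ (2 * b * q)" and "P = (2::real) ^ (b * (q + 2))"
  define K where "K = A (s + E\<^sup>2) - A s"
  define H where "H i = {l. l < N i \<and> (\<exists>t\<in>{s + real l * (e i)\<^sup>2..s + real (Suc l) * (e i)\<^sup>2}. \<bar>w t + V t\<bar> \<le> e i)}" for i
  have e: "0 < e i" for i using E by (simp add: e_def)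
  have Ne: "real (N i) * (e i)\<^sup>2 = E\<^sup>2" for i
    by (simp add: N_def e_def power_divide power_mult[symmetric] mult_ac)
  have K: "0 \<le> K" using A[of s "s + E\<^sup>2"] by (simp add: K_def)
  have P: "2 ^ (b * q) \<le> P" unfolding P_def by (intro power_increasing) auto
  have P1: "1 \<le> P" by (simp add: P_def)
  have R0: "0 < R" by (simp add: R_def)
  have card_H: "real (card (H i)) \<le> P ^ i * (1 + real i * R * K / E)" if "i \<le> q" for i
    using that
  proof (induction i)
    case 0
    have "H 0 \<subseteq> {0}" by (auto simp: H_def N_def)
    then have "card (H 0) \<le> card {0::nat}" by (intro card_mono) auto
    then show ?case by simp
  next
    case (Suc i)
    have NS: "N (Suc i) = N i * 2 ^ (2 * b * q)" by (simp add: N_def power_add algebra_simps)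
    have es: "(e i)\<^sup>2 = 2 ^ (2 * b * q) * (e (Suc i))\<^sup>2"
    proof -
      have "e i = 2 ^ (b * q) * e (Suc i)" by (simp add: e_def power_add)
      then show ?thesis by (simp add: power_mult_distrib power_mult[symmetric] mult_ac)
    qed
    have el: "e (Suc i) \<le> e i" unfolding e_def using E by (intro divide_left_mono power_increasing) auto
    have "real (card (H (Suc i))) \<le> P * real (card (H i)) + R * (A (s + real (N i) * (e i)\<^sup>2) - A s) / e (Suc i)"
      unfolding H_def NS P_def R_def
    proof (rule card_hit_blocks_Suc[OF e es el])
      show "\<bar>V u - V t\<bar> \<le> A u - A t" if "s \<le> t" "t \<le> u" "u \<le> s + real (N i) * (e i)\<^sup>2" for t u
        using that unfolding Ne by (rule A)
      show "regular_block q b w (s + real l * (e i)\<^sup>2) (e (Suc i))" if "l < N i" for l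
        using reg[of i l] that Suc.prems unfolding N_def e_def by simp
    qed
    also have "\<dots> = P * real (card (H i)) + R * K / E * 2 ^ (b * q * Suc i)"
      unfolding Ne K_def[symmetric] by (simp add: e_def)
    also have "\<dots> \<le> P * (P ^ i * (1 + real i * R * K / E)) + R * K / E * P ^ Suc i"
    proof (intro add_mono mult_left_mono)
      show "(2::real) ^ (b * q * Suc i) \<le> P ^ Suc i"
        unfolding power_mult[of 2 "b * q" "Suc i"] using P by (intro power_mono) auto
    qed (use Suc P1 R0 K E in auto)
    also have "\<dots> = P ^ Suc i * (1 + real (Suc i) * R * K / E)"
      by (simp add: algebra_simps add_divide_distrib)
    finally show ?case .
  qed
  have cover: "{t\<in>{s..s+E\<^sup>2}. \<bar>w t + V t\<bar> \<le> E / 2 ^ (b * q * q)}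
      \<subseteq> (\<Union>l\<in>H q. {s + real l * (e q)\<^sup>2..s + real (Suc l) * (e q)\<^sup>2})"
  proof safe
    fix t assume t: "t \<in> {s..s+E\<^sup>2}" and x: "\<bar>w t + V t\<bar> \<le> E / 2 ^ (b * q * q)"
    define y where "y = (t - s) / (e q)\<^sup>2"
    have ep: "0 < (e q)\<^sup>2" using e[of q] by simp
    have y: "0 \<le> y" "y \<le> real (N q)"
      using t ep Ne[of q] by (auto simp: y_def divide_simps)
    have ty: "t = s + y * (e q)\<^sup>2" using ep by (simp add: y_def)
    have N1: "1 \<le> N q" by (simp add: N_def)
    \<comment> \<open>The minimum assigns the right end of the window, where y = N q, to the last
      block.\<close>
    define l where "l = min (nat \<lfloor>y\<rfloor>) (N q - 1)"
    have l: "l < N q" "real l \<le> y" "y \<le> real (Suc l)"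
    proof -
      show "l < N q" using N1 by (auto simp: l_def)
      have "real (nat \<lfloor>y\<rfloor>) \<le> y" "y < real (nat \<lfloor>y\<rfloor>) + 1" using y by linarith+
      then have "real l \<le> y \<and> y \<le> real (Suc l)"
      proof (cases "nat \<lfloor>y\<rfloor> \<le> N q - 1")
        case True
        then have "l = nat \<lfloor>y\<rfloor>" by (simp add: l_def)
        then have "real l = real (nat \<lfloor>y\<rfloor>)" by simp
        then show ?thesis using \<open>real (nat \<lfloor>y\<rfloor>) \<le> y\<close> \<open>y < real (nat \<lfloor>y\<rfloor>) + 1\<close> by linarith
      next
        case False
        then have "real (N q) \<le> real (nat \<lfloor>y\<rfloor>)" "real l = real (N q) - 1"
          using N1 by (auto simp: l_def of_nat_diff)
        then show ?thesis using y(2) \<open>real (nat \<lfloor>y\<rfloor>) \<le> y\<close> by simp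
      qed
      then show "real l \<le> y" "y \<le> real (Suc l)" by auto
    qed
    have "t \<in> {s + real l * (e q)\<^sup>2..s + real (Suc l) * (e q)\<^sup>2}"
      unfolding ty using mult_right_mono[OF l(2), of "(e q)\<^sup>2"] mult_right_mono[OF l(3), of "(e q)\<^sup>2"] by auto
    moreover have "l \<in> H q" using calculation l x unfolding H_def e_def by auto
    ultimately show "t \<in> (\<Union>l\<in>H q. {s + real l * (e q)\<^sup>2..s + real (Suc l) * (e q)\<^sup>2})" by blast
  qed
  have finH: "finite (H q)" by (simp add: H_def)
  have "emeasure lborel {t\<in>{s..s+E\<^sup>2}. \<bar>w t + V t\<bar> \<le> E / 2 ^ (b * q * q)}
      \<le> emeasure lborel (\<Union>l\<in>H q. {s + real l * (e q)\<^sup>2..s + real (Suc l) * (e q)\<^sup>2})"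
    by (intro emeasure_mono cover) (auto simp: finH)
  also have "\<dots> \<le> (\<Sum>l\<in>H q. emeasure lborel {s + real l * (e q)\<^sup>2..s + real (Suc l) * (e q)\<^sup>2})"
    using finH by (intro emeasure_subadditive_finite) auto
  also have "\<dots> = (\<Sum>l\<in>H q. ennreal ((e q)\<^sup>2))"
    by (intro sum.cong) (auto simp: algebra_simps)
  also have "\<dots> = ennreal (real (card (H q)) * (e q)\<^sup>2)"
    by (simp add: ennreal_mult ennreal_of_nat_eq_real_of_nat)
  also have "\<dots> \<le> ennreal (E\<^sup>2 * (real q * (1 + K / E)) * (2 ^ (4 * b * q) / 2 ^ (b * q * q)))"
  proof (rule ennreal_leI)
    have R1: "1 \<le> R" by (simp add: R_def)
    have "1 + real q * R * K / E \<le> real q * R * (1 + K / E)"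
    proof -
      have "1 * 1 \<le> real q * R" using q R1 by (intro mult_mono) auto
      then show ?thesis by (simp add: distrib_left)
    qed
    then have "real (card (H q)) * (e q)\<^sup>2 \<le> P ^ q * (real q * R * (1 + K / E)) * (e q)\<^sup>2"
      using card_H[of q] P1 by (intro mult_right_mono order_trans[OF card_H[of q]] mult_left_mono) auto
    also have "\<dots> = E\<^sup>2 * (real q * (1 + K / E)) * (P ^ q * R / (2 ^ (b * q * q))\<^sup>2)"
      by (simp add: e_def power_divide)
    \<comment> \<open>Half of the loss \<open>2 ^ (4 * b * q)\<close> comes from the q surplus
      factors \<open>2 ^ (2 * b)\<close> contained in \<open>P ^ q\<close>, the other half from R,
      the price of a block on which V cannot be frozen.\<close>
    also have "P ^ q * R / (2 ^ (b * q * q))\<^sup>2 = 2 ^ (4 * b * q) / 2 ^ (b * q * q)"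
    proof -
      have "P ^ q * R = 2 ^ (b * q * q) * 2 ^ (4 * b * q)"
        unfolding P_def R_def power_mult[symmetric] power_add[symmetric]
        by (rule arg_cong[where f = "\<lambda>n. 2 ^ n"]) (simp add: algebra_simps)
      then show ?thesis by (simp add: power2_eq_square)
    qed
    finally show "real (card (H q)) * (e q)\<^sup>2 \<le> E\<^sup>2 * (real q * (1 + K / E)) * (2 ^ (4 * b * q) / 2 ^ (b * q * q))" .
  qed
  finally show ?thesis by (simp add: K_def)
qed

text \<open>Layers around 0: the radii \<open>r k\<close> are exactly those of
  \<open>emeasure_near_zero_le\<close> for the parameter b0 + k. Where
  \<open>r (Suc k) < \<bar>x t\<bar> \<le> r k\<close>, the integrand is at most
  \<open>E powr \<alpha> * c k\<close>; against the occupation time of \<open>S k\<close> this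
  leaves a geometric series.\<close>

lemma nn_integral_powr_le:
  fixes w V A :: "real \<Rightarrow> real"
  assumes E: "0 < E" and \<alpha>: "-1 < \<alpha>" "\<alpha> < 0" and q: "5 \<le> real q * (1 + \<alpha>)"
    and A: "\<And>t u. s \<le> t \<Longrightarrow> t \<le> u \<Longrightarrow> u \<le> s + E\<^sup>2 \<Longrightarrow> \<bar>V u - V t\<bar> \<le> A u - A t"
    and cont: "continuous_on {s..s+E\<^sup>2} (\<lambda>t. w t + V t)"
    and reg: "\<And>b i l. b0 \<le> b \<Longrightarrow> i < q \<Longrightarrow> l < 2 ^ (2 * b * q * i) \<Longrightarrow>
      regular_block q b w (s + real l * (E / 2 ^ (b * q * i))\<^sup>2) (E / 2 ^ (b * q * Suc i))"
  shows "(\<integral>\<^sup>+t. ennreal (\<bar>w t + V t\<bar> powr \<alpha>) * indicator {s..s+E\<^sup>2} t \<partial>lborel)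
    \<le> ennreal (E\<^sup>2 * E powr \<alpha> * (2 ^ (b0 * q * q) + 2 * real q * 2 ^ (q * q) * (1 + (A (s + E\<^sup>2) - A s) / E)))"
proof -
  define x where "x t = w t + V t" for t
  define K where "K = A (s + E\<^sup>2) - A s"
  define r where "r k = E / 2 ^ ((b0 + k) * q * q)" for k
  define S where "S k = {t\<in>{s..s+E\<^sup>2}. \<bar>x t\<bar> \<le> r k}" for k
  define c where "c k = 2 powr (- \<alpha> * real q * real q * real (b0 + Suc k))" for k
  have K: "0 \<le> K" using A[of s "s + E\<^sup>2"] by (simp add: K_def)
  have q1: "1 \<le> q" using q by (cases q) auto
  have r: "0 < r k" for k using E by (simp add: r_def)
  have S_meas [measurable]: "S k \<in> sets borel" for k
  proof -
    have "closed ({s..s+E\<^sup>2} \<inter> (\<lambda>t. \<bar>x t\<bar>) -` {..r k})"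
      unfolding x_def by (intro continuous_closed_preimage continuous_on_rabs[OF cont]) auto
    moreover have "S k = {s..s+E\<^sup>2} \<inter> (\<lambda>t. \<bar>x t\<bar>) -` {..r k}" by (auto simp: S_def)
    ultimately show ?thesis by simp
  qed
  have r_powr: "r k powr \<alpha> = E powr \<alpha> * 2 powr (- \<alpha> * real q * real q * real (b0 + k))" for k
  proof -
    have "r k = E * 2 powr (- real ((b0 + k) * q * q))"
      unfolding r_def powr_minus by (subst powr_realpow) (simp_all add: divide_inverse)
    then have "r k powr \<alpha> = E powr \<alpha> * 2 powr (- real ((b0 + k) * q * q) * \<alpha>)"
      by (simp only: powr_mult powr_powr)
    also have "- real ((b0 + k) * q * q) * \<alpha> = - \<alpha> * real q * real q * real (b0 + k)"
      by (simp only: of_nat_mult) (simp add: algebra_simps)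
    finally show ?thesis .
  qed
  have pointwise: "ennreal (\<bar>x t\<bar> powr \<alpha>) * indicator {s..s+E\<^sup>2} t
    \<le> ennreal (E powr \<alpha>) * (ennreal (2 ^ (b0 * q * q)) * indicator {s..s+E\<^sup>2} t + (\<Sum>k. ennreal (c k) * indicator (S k) t))" for t
  \<comment> \<open>Since \<open>0 powr \<alpha> = 0\<close>, times with \<open>x t = 0\<close>
    contribute nothing to the left side; they lie in every layer but need no bound there.\<close>
  proof (cases "t \<in> {s..s+E\<^sup>2} \<and> x t \<noteq> 0")
    case True
    show ?thesis
    proof (cases "\<bar>x t\<bar> \<le> r 0")
      \<comment> \<open>Beyond \<open>r 0\<close> only the largest value
        \<open>r 0 powr \<alpha>\<close> is used. It produces the term
        \<open>2 ^ (b0 * q * q)\<close>, which grows with the first parameter b0 from which blocks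
        are regular.\<close>
      case False
      then have "\<bar>x t\<bar> powr \<alpha> \<le> r 0 powr \<alpha>"
        using \<alpha> r[of 0] by (intro powr_mono2') auto
      also have "\<dots> \<le> E powr \<alpha> * 2 powr (real (b0 * q * q))"
      proof -
        have "- \<alpha> * (real q * real q * real b0) \<le> 1 * (real q * real q * real b0)"
          using \<alpha> by (intro mult_right_mono) auto
        then show ?thesis unfolding r_powr by (intro mult_left_mono powr_mono) (auto simp: mult_ac)
      qed
      also have "\<dots> = E powr \<alpha> * 2 ^ (b0 * q * q)" by (subst powr_realpow) auto
      finally have "ennreal (\<bar>x t\<bar> powr \<alpha>) \<le> ennreal (E powr \<alpha>) * ennreal (2 ^ (b0 * q * q))"
        by (subst ennreal_mult[symmetric]) (auto intro: ennreal_leI)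
      also have "\<dots> \<le> ennreal (E powr \<alpha>) * (ennreal (2 ^ (b0 * q * q)) + (\<Sum>k. ennreal (c k) * indicator (S k) t))"
        by (intro mult_left_mono) auto
      finally show ?thesis using True by simp
    next
      case small: True
      have "(\<lambda>k. r k) \<longlonglongrightarrow> 0"
      proof -
        have "r k \<le> E * (1 / 2) ^ k" for k
        proof -
          have "k * 1 \<le> (b0 + k) * (q * q)" using q1 by (intro mult_mono) auto
          then have "(2::real) ^ k \<le> 2 ^ ((b0 + k) * q * q)"
            by (intro power_increasing) (auto simp: mult.assoc)
          then show ?thesis using E by (simp add: r_def power_divide frac_le)
        qed
        moreover have "(\<lambda>k. E * (1 / 2 :: real) ^ k) \<longlonglongrightarrow> E * 0"
          by (intro tendsto_intros LIMSEQ_realpow_zero) auto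
        ultimately show ?thesis
          by (intro tendsto_sandwich[of "\<lambda>_. 0" r sequentially "\<lambda>k. E * (1 / 2) ^ k"]) (use r in \<open>auto simp: less_imp_le\<close>)
      qed
      moreover have "0 < \<bar>x t\<bar>" using True by simp
      ultimately have "\<forall>\<^sub>F k in sequentially. r k < \<bar>x t\<bar>" by (rule order_tendstoD)
      then have ex: "\<exists>k. r k < \<bar>x t\<bar>" by (meson eventually_sequentially order_refl)
      define m where "m = (LEAST k. r k < \<bar>x t\<bar>)"
      have m: "r m < \<bar>x t\<bar>" unfolding m_def by (rule LeastI_ex[OF ex])
      with small have "m \<noteq> 0" by (metis not_le)
      then obtain k where k: "m = Suc k" by (cases m) auto
      have "\<not> r k < \<bar>x t\<bar>" using not_less_Least[of k "\<lambda>k. r k < \<bar>x t\<bar>"] k by (simp add: m_def)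
      then have tS: "t \<in> S k" using True by (simp add: S_def)
      have "\<bar>x t\<bar> powr \<alpha> \<le> r (Suc k) powr \<alpha>"
        using \<alpha> r m k by (intro powr_mono2') auto
      then have "ennreal (\<bar>x t\<bar> powr \<alpha>) \<le> ennreal (E powr \<alpha>) * (ennreal (c k) * indicator (S k) t)"
        using tS by (subst (asm) r_powr) (simp add: c_def ennreal_mult[symmetric] ennreal_leI)
      also have "ennreal (c k) * indicator (S k) t \<le> (\<Sum>k. ennreal (c k) * indicator (S k) t)"
      proof -
        have "f k \<le> (\<Sum>j. f j)" for f :: "nat \<Rightarrow> ennreal"
          using sum_le_suminf[OF summableI, of "{k}" f] by simp
        then show ?thesis .
      qed
      also have "\<dots> \<le> ennreal (2 ^ (b0 * q * q)) + (\<Sum>k. ennreal (c k) * indicator (S k) t)"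
        by simp
      finally show ?thesis using True by (simp add: mult_left_mono)
    qed
  qed (auto simp: indicator_def)
  define D where "D = E\<^sup>2 * (real q * (1 + K / E)) * 2 ^ (q * q)"
  have D: "0 \<le> D" using E K by (simp add: D_def)
  have S_le: "ennreal (c k) * emeasure lborel (S k) \<le> ennreal (D * (1 / 2) ^ k)" for k
  proof -
    define b where "b = b0 + k"
    have "emeasure lborel (S k) \<le> ennreal (E\<^sup>2 * (real q * (1 + K / E)) * (2 ^ (4 * b * q) / 2 ^ (b * q * q)))"
      unfolding S_def r_def x_def K_def b_def[symmetric]
      by (rule emeasure_near_zero_le[OF E q1 A reg]) (auto simp: b_def)
    then have "ennreal (c k) * emeasure lborel (S k)
      \<le> ennreal (c k) * ennreal (E\<^sup>2 * (real q * (1 + K / E)) * (2 ^ (4 * b * q) / 2 ^ (b * q * q)))"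
      by (intro mult_left_mono) auto
    also have "\<dots> = ennreal (E\<^sup>2 * (real q * (1 + K / E)) * (c k * 2 ^ (4 * b * q) / 2 ^ (b * q * q)))"
      using E K by (subst ennreal_mult[symmetric]) (auto simp: c_def mult_ac)
    also have "\<dots> \<le> ennreal (D * (1 / 2) ^ k)"
    proof (rule ennreal_leI)
      have "c k * 2 ^ (4 * b * q) / 2 ^ (b * q * q)
          = 2 powr (- \<alpha> * real q * real q * real (Suc b)) * 2 powr (real (4 * b * q)) / 2 powr (real (b * q * q))"
        by (subst (1 2) powr_realpow) (auto simp: c_def b_def)
      also have "\<dots> = 2 powr (- \<alpha> * real q * real q * real (Suc b) + real (4 * b * q) - real (b * q * q))"
        by (simp only: powr_add powr_diff)
      also have "\<dots> \<le> 2 powr (real (q * q) - real k)"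
      \<comment> \<open>The exponent is -\<alpha> q^2 + 4 b q - b q^2 (1 + \<alpha>). Of the 5 in
        \<open>5 \<le> real q * (1 + \<alpha>)\<close>, four units cancel the loss 4 b q, and the
        fifth leaves -b q \<le> -k for the geometric decay.\<close>
      proof (rule powr_mono)
        have "- \<alpha> * (real q * real q) \<le> 1 * (real q * real q)" using \<alpha> by (intro mult_right_mono) auto
        moreover have "5 * (real b * real q) \<le> (real q * (1 + \<alpha>)) * (real b * real q)" using q by (intro mult_right_mono) auto
        moreover have "real b * 1 \<le> real b * real q" using q1 by (intro mult_left_mono) auto
        moreover have "real k \<le> real b" by (simp add: b_def)
        ultimately show "- \<alpha> * real q * real q * real (Suc b) + real (4 * b * q) - real (b * q * q) \<le> real (q * q) - real k"
          by (simp add: algebra_simps)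
      qed simp
      also have "\<dots> = 2 ^ (q * q) * (1 / 2) ^ k"
        by (simp add: powr_diff powr_realpow power_divide del: of_nat_mult)
      finally have "E\<^sup>2 * (real q * (1 + K / E)) * (c k * 2 ^ (4 * b * q) / 2 ^ (b * q * q))
          \<le> E\<^sup>2 * (real q * (1 + K / E)) * (2 ^ (q * q) * (1 / 2) ^ k)"
        using E K by (intro mult_left_mono) auto
      also have "\<dots> = D * (1 / 2) ^ k" by (simp only: D_def mult.assoc)
      finally show "E\<^sup>2 * (real q * (1 + K / E)) * (c k * 2 ^ (4 * b * q) / 2 ^ (b * q * q)) \<le> D * (1 / 2) ^ k" .
    qed
    finally show ?thesis .
  qed
  have sums: "(\<lambda>k. D * (1 / 2) ^ k) sums (D * 2)"
    using sums_mult[OF geometric_sums[of "1 / 2 :: real"], of D] by simp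
  have "(\<integral>\<^sup>+t. ennreal (\<bar>x t\<bar> powr \<alpha>) * indicator {s..s+E\<^sup>2} t \<partial>lborel)
     \<le> (\<integral>\<^sup>+t. ennreal (E powr \<alpha>) * (ennreal (2 ^ (b0 * q * q)) * indicator {s..s+E\<^sup>2} t + (\<Sum>k. ennreal (c k) * indicator (S k) t)) \<partial>lborel)"
    by (intro nn_integral_mono pointwise)
  also have "\<dots> = ennreal (E powr \<alpha>) * (ennreal (2 ^ (b0 * q * q)) * ennreal (E\<^sup>2) + (\<Sum>k. ennreal (c k) * emeasure lborel (S k)))"
    by (simp add: nn_integral_cmult nn_integral_add nn_integral_suminf nn_integral_cmult_indicator)
  also have "\<dots> \<le> ennreal (E powr \<alpha>) * (ennreal (2 ^ (b0 * q * q)) * ennreal (E\<^sup>2) + (\<Sum>k. ennreal (D * (1 / 2) ^ k)))"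
    by (intro mult_left_mono add_left_mono suminf_le S_le) auto
  also have "(\<Sum>k. ennreal (D * (1 / 2) ^ k)) = ennreal (D * 2)"
    using D sums by (intro suminf_ennreal_eq) auto
  also have "ennreal (E powr \<alpha>) * (ennreal (2 ^ (b0 * q * q)) * ennreal (E\<^sup>2) + ennreal (D * 2))
      = ennreal (E powr \<alpha> * (2 ^ (b0 * q * q) * E\<^sup>2 + D * 2))"
    using D by (simp add: ennreal_mult ennreal_plus del: ennreal_plus[symmetric])
  also have "E powr \<alpha> * (2 ^ (b0 * q * q) * E\<^sup>2 + D * 2)
      = E\<^sup>2 * E powr \<alpha> * (2 ^ (b0 * q * q) + 2 * real q * 2 ^ (q * q) * (1 + K / E))"
    by (simp add: D_def algebra_simps)
  finally show ?thesis by (simp add: x_def K_def)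
qed

section \<open>The variation of the drift\<close>

lemma set_integral_increment:
  fixes g :: "real \<Rightarrow> real"
  assumes int: "set_integrable lborel {a..u} g" and t: "a \<le> t" "t \<le> u"
  shows "(LINT s:{a..u}|lborel. g s) - (LINT s:{a..t}|lborel. g s) = (LINT s:{t<..u}|lborel. g s)"
    "set_integrable lborel {t<..u} g"
proof -
  show *: "set_integrable lborel {t<..u} g"
    by (rule set_integrable_subset[OF int]) (use t in auto)
  have **: "set_integrable lborel {a..t} g"
    by (rule set_integrable_subset[OF int]) (use t in auto)
  have "{a..t} \<inter> {t<..u} = {}" by auto
  from set_integral_Un[OF this ** *]
  have "(LINT s:{a..t} \<union> {t<..u}|lborel. g s) = (LINT s:{a..t}|lborel. g s) + (LINT s:{t<..u}|lborel. g s)" .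
  moreover have "{a..u} = {a..t} \<union> {t<..u}" using t by auto
  ultimately show "(LINT s:{a..u}|lborel. g s) - (LINT s:{a..t}|lborel. g s) = (LINT s:{t<..u}|lborel. g s)"
    by simp
qed

text \<open>Each step halves the memory of the past, so the limit is governed by the recent terms of
  y alone.\<close>

lemma tendsto_zero_averaging:
  fixes a y :: "nat \<Rightarrow> real"
  assumes y: "y \<longlonglongrightarrow> 0" and a: "\<And>n. a (Suc n) = (a n + y n) / 2" "\<And>n. 0 \<le> a n"
  shows "a \<longlonglongrightarrow> 0"
proof (rule LIMSEQ_I)
  fix r :: real assume r: "0 < r"
  from y r have "\<forall>\<^sub>F n in sequentially. y n < r / 2" by (intro order_tendstoD) auto
  then obtain N where N: "\<And>n. N \<le> n \<Longrightarrow> y n < r / 2" by (auto simp: eventually_sequentially)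
  have bound: "a (N + k) \<le> a N * (1 / 2) ^ k + r / 2" for k
  proof (induction k)
    case (Suc k)
    have "a (N + Suc k) = (a (N + k) + y (N + k)) / 2" using a(1) by simp
    also have "\<dots> \<le> ((a N * (1 / 2) ^ k + r / 2) + r / 2) / 2"
      using Suc N[of "N + k"] by (intro divide_right_mono add_mono) auto
    finally show ?case by simp
  qed (use r in simp)
  have "(\<lambda>k. a N * (1 / 2 :: real) ^ k) \<longlonglongrightarrow> a N * 0"
    by (intro tendsto_intros LIMSEQ_realpow_zero) auto
  then have "\<forall>\<^sub>F k in sequentially. a N * (1 / 2 :: real) ^ k < r / 2"
    using r by (intro order_tendstoD) auto
  then obtain k0 where k0: "\<And>k. k0 \<le> k \<Longrightarrow> a N * (1 / 2 :: real) ^ k < r / 2" by (auto simp: eventually_sequentially)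
  show "\<exists>n0. \<forall>n\<ge>n0. norm (a n - 0) < r"
  proof (intro exI allI impI)
    fix n assume n: "N + k0 \<le> n"
    have "a n \<le> a N * (1 / 2) ^ (n - N) + r / 2" using bound[of "n - N"] n by simp
    also have "\<dots> < r" using k0[of "n - N"] n by (simp add: field_simps)
    finally show "norm (a n - 0) < r" using a(2)[of n] by simp
  qed
qed

text \<open>The interval from 4^n to 4^(n+1) consists of three windows of length 4^n, which is why j
  runs through 1, 2, 3 everywhere. As the square root doubles from one power of 4 to the next,
  \<open>A (4 ^ n) / 2 ^ n\<close> obeys an averaging recursion. Between powers of 4 monotonicity
  costs a factor 2.\<close>

lemma negligible_from_windows:
  fixes A :: "real \<Rightarrow> real"
  assumes mono: "\<And>t u. 1 \<le> t \<Longrightarrow> t \<le> u \<Longrightarrow> A t \<le> A u" and A1: "0 \<le> A 1"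
    and win: "\<And>j. j \<in> {1..3::nat} \<Longrightarrow> (\<lambda>n. (A (real (Suc j) * 4 ^ n) - A (real j * 4 ^ n)) / 2 ^ n) \<longlonglongrightarrow> 0"
  shows "((\<lambda>t. A t / sqrt t) \<longlongrightarrow> 0) at_top"
proof -
  define a where "a n = A (4 ^ n) / 2 ^ n" for n :: nat
  define y where "y n = (\<Sum>j=1..3. (A (real (Suc j) * 4 ^ n) - A (real j * 4 ^ n)) / 2 ^ n)" for n :: nat
  have A0: "0 \<le> A t" if "1 \<le> t" for t using mono[OF _ that] A1 by force
  have "y \<longlonglongrightarrow> (\<Sum>j=1..3::nat. 0)"
    unfolding y_def by (intro tendsto_sum win)
  then have "y \<longlonglongrightarrow> 0" by simp
  moreover have "a (Suc n) = (a n + y n) / 2" for n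
  proof -
    have "y n = (A (4 * 4 ^ n) - A (4 ^ n)) / 2 ^ n"
      by (simp add: y_def numeral_3_eq_3 diff_divide_distrib)
    then show ?thesis by (simp add: a_def field_simps)
  qed
  moreover have "0 \<le> a n" for n using A0[of "4 ^ n"] by (simp add: a_def)
  ultimately have a: "a \<longlonglongrightarrow> 0" by (rule tendsto_zero_averaging)
  show ?thesis
  proof (rule tendstoI)
    fix r :: real assume r: "0 < r"
    have "\<forall>\<^sub>F n in sequentially. a n < r / 2" using a r by (intro order_tendstoD) auto
    then obtain N where N: "\<And>n. N \<le> n \<Longrightarrow> a n < r / 2" by (auto simp: eventually_sequentially)
    show "\<forall>\<^sub>F t in at_top. dist (A t / sqrt t) 0 < r"
      unfolding eventually_at_top_linorder
    proof (intro exI allI impI)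
      fix t :: real assume "4 ^ N \<le> t"
      then obtain n where n: "N \<le> n" "4 ^ n \<le> t" "t < 4 ^ Suc n"
        using geometric_interval[of 4 N t] by auto
      have t1: "1 \<le> t" using n(2) one_le_power[of "4::real" n] by linarith
      have "sqrt (4 ^ n) \<le> sqrt t" using n(2) by simp
      then have st: "2 ^ n \<le> sqrt t" by (simp add: real_sqrt_power)
      have "A t / sqrt t \<le> A (4 ^ Suc n) / 2 ^ n"
        using n t1 st A0[of t] mono[of t "4 ^ Suc n"] by (intro frac_le) auto
      also have "\<dots> = 2 * a (Suc n)" by (simp add: a_def)
      also have "\<dots> < r" using N[of "Suc n"] n by simp
      finally show "dist (A t / sqrt t) 0 < r" using A0[OF t1] t1 by simp
    qed
  qed
qed

text \<open>Here A is the growth function that the ladder estimates ask for. The second claim bounds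
  its growth by a nonnegative integral over a closed window, the form in which
  \<open>nn_integral_powr_le\<close> applies.\<close>

lemma variation_props:
  fixes g :: "real \<Rightarrow> real"
  assumes int: "\<forall>t\<ge>1. set_integrable lborel {1..t} g"
  defines "A \<equiv> \<lambda>t. LINT s:{1..t}|lborel. \<bar>g s\<bar>"
  shows "1 \<le> t \<Longrightarrow> t \<le> u \<Longrightarrow> \<bar>(LINT s:{1..u}|lborel. g s) - (LINT s:{1..t}|lborel. g s)\<bar> \<le> A u - A t"
    and "1 \<le> t \<Longrightarrow> t \<le> u \<Longrightarrow> ennreal (A u - A t) \<le> (\<integral>\<^sup>+s. ennreal \<bar>g s\<bar> * indicator {t..u} s \<partial>lborel)"
    and "0 \<le> A t"
proof -
  have int': "set_integrable lborel {1..t} (\<lambda>s. \<bar>g s\<bar>)" if "1 \<le> t" for t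
    using int that by (intro set_integrable_abs) auto
  show "\<bar>(LINT s:{1..u}|lborel. g s) - (LINT s:{1..t}|lborel. g s)\<bar> \<le> A u - A t" if t: "1 \<le> t" "t \<le> u"
  proof -
    have u: "1 \<le> u" using t by linarith
    note i = int[rule_format, OF u]
    have "\<bar>LINT s:{t<..u}|lborel. g s\<bar> \<le> (LINT s:{t<..u}|lborel. \<bar>g s\<bar>)"
      using integral_abs_bound[of lborel "\<lambda>s. indicator {t<..u} s *\<^sub>R g s"]
      by (simp add: set_lebesgue_integral_def abs_mult)
    then show ?thesis
      unfolding A_def set_integral_increment(1)[OF i t] set_integral_increment(1)[OF int'[OF u] t] .
  qed
  show "ennreal (A u - A t) \<le> (\<integral>\<^sup>+s. ennreal \<bar>g s\<bar> * indicator {t..u} s \<partial>lborel)" if t: "1 \<le> t" "t \<le> u"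
  proof -
    have u: "1 \<le> u" using t by linarith
    have "ennreal (A u - A t) = ennreal (LINT s|lborel. indicator {t<..u} s * \<bar>g s\<bar>)"
      unfolding A_def set_integral_increment(1)[OF int'[OF u] t] by (simp add: set_lebesgue_integral_def)
    also have "\<dots> = (\<integral>\<^sup>+s. ennreal (indicator {t<..u} s * \<bar>g s\<bar>) \<partial>lborel)"
      using set_integral_increment(2)[OF int'[OF u] t] unfolding set_integrable_def
      by (intro nn_integral_eq_integral[symmetric]) auto
    also have "\<dots> \<le> (\<integral>\<^sup>+s. ennreal \<bar>g s\<bar> * indicator {t..u} s \<partial>lborel)"
      by (intro nn_integral_mono) (auto simp: indicator_def)
    finally show ?thesis .
  qed
  show "0 \<le> A t" unfolding A_def set_lebesgue_integral_def by (intro Bochner_Integration.integral_nonneg) auto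
qed

lemma abs_drift_le:
  assumes "0 < r" "r \<le> s" "0 \<le> \<beta>"
  shows "\<bar>drift \<rho> \<alpha> \<beta> s x\<bar> \<le> \<bar>\<rho>\<bar> * r powr (- \<beta>) * \<bar>x\<bar> powr \<alpha>"
proof -
  have "s powr - \<beta> \<le> r powr - \<beta>" using assms by (intro powr_mono2') auto
  then have "\<bar>\<rho>\<bar> * (s powr - \<beta> * \<bar>x\<bar> powr \<alpha>) \<le> \<bar>\<rho>\<bar> * (r powr - \<beta> * \<bar>x\<bar> powr \<alpha>)"
    by (intro mult_left_mono mult_right_mono) auto
  moreover have "\<bar>drift \<rho> \<alpha> \<beta> s x\<bar> \<le> \<bar>\<rho>\<bar> * (s powr - \<beta> * \<bar>x\<bar> powr \<alpha>)"
    by (auto simp: drift_def abs_mult powr_minus divide_inverse sgn_if)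
  ultimately show ?thesis by (simp add: mult.assoc)
qed

text \<open>The windows are \<open>{s..s + 4 ^ n}\<close> with \<open>s = j * 4 ^ n\<close>, at spatial scale \<open>E = 2 ^ n\<close>. Regularity is only available for
  \<open>b >= n / d\<close>; the choice of \<open>d\<close> makes the trivial bound on the drift farther away from 0 good enough.\<close>

lemma drift_variation_singular:
  fixes x w :: "real \<Rightarrow> real"
  defines "g \<equiv> \<lambda>\<rho> \<alpha> \<beta> s. drift \<rho> \<alpha> \<beta> s (x s)"
  assumes cont: "continuous_on {1..} x"
    and int: "\<forall>t\<ge>1. set_integrable lborel {1..t} (g \<rho> \<alpha> \<beta>)"
    and eq: "\<And>t. 1 \<le> t \<Longrightarrow> x t = x0 + (w t - w 1) + (LINT s:{1..t}|lborel. g \<rho> \<alpha> \<beta> s)"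
    and \<alpha>: "-1 < \<alpha>" "\<alpha> < 0" and \<beta>: "\<alpha> + 1 < 2 * \<beta>"
    and q: "5 \<le> real q * (1 + \<alpha>)" and d: "2 * real (q * q) \<le> real d * (2 * \<beta> - \<alpha> - 1)" "0 < d"
    and reg: "\<forall>\<^sub>F b in sequentially. \<forall>n\<le>d * b. \<forall>j\<in>{1..3::nat}. \<forall>i<q. \<forall>l<2 ^ (2 * b * q * i).
      regular_block q b w (real j * 4 ^ n + real l * (2 ^ n / 2 ^ (b * q * i))\<^sup>2) (2 ^ n / 2 ^ (b * q * Suc i))"
  shows "((\<lambda>t. (LINT s:{1..t}|lborel. \<bar>g \<rho> \<alpha> \<beta> s\<bar>) / sqrt t) \<longlongrightarrow> 0) at_top"
proof -
  define h where "h = g \<rho> \<alpha> \<beta>"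
  define A where "A t = (LINT s:{1..t}|lborel. \<bar>h s\<bar>)" for t
  define V where "V t = x0 - w 1 + (LINT s:{1..t}|lborel. h s)" for t
  note vp = variation_props[OF int[folded h_def], folded A_def]
  have VA: "\<bar>V u - V t\<bar> \<le> A u - A t" if "1 \<le> t" "t \<le> u" for t u
    using vp(1)[OF that] by (simp add: V_def)
  have xV: "x t = w t + V t" if "1 \<le> t" for t
    using eq[OF that] by (simp add: V_def h_def)
  \<comment> \<open>Scaling: on a window of length \<open>E\<^sup>2\<close> the drift, if
    \<open>\<bar>x\<bar>\<close> is of order E, has variation of order E^(-2 \<beta>) E^2
    E^\<alpha>. Divided by E this is E^(-\<delta>).\<close>
  define \<delta> where "\<delta> = 2 * \<beta> - \<alpha> - 1"
  have \<delta>: "0 < \<delta>" using \<beta> by (simp add: \<delta>_def)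
  have \<beta>0: "0 \<le> \<beta>" using \<alpha> \<beta> by simp
  define C where "C = 2 * real q * 2 ^ (q * q)"
  \<comment> \<open>The rounding up guarantees \<open>n \<le> d * b n\<close>, so that window n is
    regular for all parameters from \<open>b n\<close> on, once \<open>b n\<close> has passed the
    random threshold b1.\<close>
  define b where "b n = n div d + 1" for n
  define \<theta> where "\<theta> n = \<bar>\<rho>\<bar> * 2 powr (- \<delta> * real n) * (2 ^ (b n * q * q) + C)" for n
  have C0: "0 \<le> C" by (simp add: C_def)
  have \<theta>0: "0 \<le> \<theta> n" for n using C0 by (simp add: \<theta>_def)
  \<comment> \<open>By the choice of d the crude term \<open>2 ^ (b n * q * q)\<close> is at most a
    constant times 2^(\<delta> n / 2). It spends half of the decay 2^(-\<delta> n), and the other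
    half remains.\<close>
  have \<theta>: "\<theta> \<longlonglongrightarrow> 0"
  proof -
    have le: "\<theta> n \<le> \<bar>\<rho>\<bar> * (2 ^ (q * q) + C) * (2 powr (- \<delta> / 2)) ^ n" for n
    proof -
      have "real (n div d) \<le> real n / real d" by (rule of_nat_div_le_of_nat)
      have "real (n div d) * (2 * real (q * q)) \<le> real (n div d) * (real d * \<delta>)"
        using d(1) unfolding \<delta>_def by (intro mult_left_mono) auto
      also have "\<dots> = \<delta> * (real (n div d) * real d)" by simp
      also have "real (n div d) * real d \<le> real n"
        by (metis div_times_less_eq_dividend of_nat_le_iff of_nat_mult)
      finally have dd: "real (n div d) * (2 * real (q * q)) \<le> \<delta> * real n" using \<delta> by simp
      have "(2::real) ^ (b n * q * q) = 2 powr (real (n div d) * real (q * q)) * 2 ^ (q * q)"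
        by (simp add: b_def powr_realpow[symmetric] powr_add[symmetric] algebra_simps)
      also have "\<dots> \<le> 2 powr (\<delta> / 2 * real n) * 2 ^ (q * q)"
        using dd by (intro mult_right_mono powr_mono) auto
      finally have "2 ^ (b n * q * q) + C \<le> 2 powr (\<delta> / 2 * real n) * 2 ^ (q * q) + 2 powr (\<delta> / 2 * real n) * C"
        using C0 \<delta> by (intro add_mono mult_right_le_one_le) (auto simp: mult_le_cancel_right1 ge_one_powr_ge_zero)
      then have "\<theta> n \<le> \<bar>\<rho>\<bar> * 2 powr (- \<delta> * real n) * (2 powr (\<delta> / 2 * real n) * (2 ^ (q * q) + C))"
        unfolding \<theta>_def by (intro mult_left_mono) (auto simp: algebra_simps)
      also have "\<dots> = \<bar>\<rho>\<bar> * (2 ^ (q * q) + C) * (2 powr (- \<delta> * real n) * 2 powr (\<delta> / 2 * real n))"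
        by simp
      also have "2 powr (- \<delta> * real n) * 2 powr (\<delta> / 2 * real n) = 2 powr (- \<delta> / 2 * real n)"
        by (simp add: powr_add[symmetric])
      also have "\<dots> = (2 powr (- \<delta> / 2)) ^ n"
      proof -
        have "(2 powr (- \<delta> / 2)) ^ n = (2 powr (- \<delta> / 2)) powr real n"
          by (rule powr_realpow[symmetric]) simp
        then show ?thesis by (simp only: powr_powr)
      qed
      finally show ?thesis .
    qed
    have "2 powr (- \<delta> / 2) < 2 powr 0" using \<delta> by (intro powr_less_mono) auto
    then have "(\<lambda>n. \<bar>\<rho>\<bar> * (2 ^ (q * q) + C) * (2 powr (- \<delta> / 2)) ^ n) \<longlonglongrightarrow> \<bar>\<rho>\<bar> * (2 ^ (q * q) + C) * 0"
      by (intro tendsto_intros LIMSEQ_realpow_zero) auto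
    then show ?thesis
      by (intro tendsto_sandwich[of "\<lambda>_. 0" \<theta>]) (use le \<theta>0 in auto)
  qed
  from reg obtain b1 where b1: "\<And>b n j i l. b1 \<le> b \<Longrightarrow> n \<le> d * b \<Longrightarrow> j \<in> {1..3::nat} \<Longrightarrow> i < q \<Longrightarrow> l < 2 ^ (2 * b * q * i) \<Longrightarrow>
      regular_block q b w (real j * 4 ^ n + real l * (2 ^ n / 2 ^ (b * q * i))\<^sup>2) (2 ^ n / 2 ^ (b * q * Suc i))"
    unfolding eventually_sequentially by blast
  have main: "(A (real (Suc j) * 4 ^ n) - A (real j * 4 ^ n)) / 2 ^ n \<le> \<theta> n * (1 + (A (real (Suc j) * 4 ^ n) - A (real j * 4 ^ n)) / 2 ^ n)"
    if j: "j \<in> {1..3}" and n: "d * b1 \<le> n" for j n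
  proof -
    define E where "E = (2::real) ^ n"
    define s where "s = real j * 4 ^ n"
    define K where "K = A (s + E\<^sup>2) - A s"
    have E: "0 < E" by (simp add: E_def)
    have E2: "E\<^sup>2 = 4 ^ n" by (simp add: E_def power_mult[symmetric] mult.commute[of n] power_mult)
    have s: "E\<^sup>2 \<le> s" "1 \<le> E\<^sup>2" using j unfolding s_def E2 by auto
    have s1: "1 \<le> s" using s by linarith
    have sS: "s + E\<^sup>2 = real (Suc j) * 4 ^ n" unfolding E2 s_def by (simp add: algebra_simps)
    have b1n: "b1 \<le> b n" using n d(2) unfolding b_def
      by (metis div_le_mono nonzero_mult_div_cancel_left not_gr_zero trans_le_add1)
    have nb: "n \<le> d * b n"
      unfolding b_def by (metis add.commute d(2) dividend_less_times_div less_imp_le mult_Suc_right plus_1_eq_Suc)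
    have "(\<integral>\<^sup>+t. ennreal (\<bar>w t + V t\<bar> powr \<alpha>) * indicator {s..s+E\<^sup>2} t \<partial>lborel)
      \<le> ennreal (E\<^sup>2 * E powr \<alpha> * (2 ^ (b n * q * q) + 2 * real q * 2 ^ (q * q) * (1 + (A (s + E\<^sup>2) - A s) / E)))"
    proof (rule nn_integral_powr_le[OF E \<alpha> q])
      show "\<bar>V u - V t\<bar> \<le> A u - A t" if "s \<le> t" "t \<le> u" for t u using that s1 by (intro VA) auto
      have "continuous_on {s..s+E\<^sup>2} x" using s1 by (intro continuous_on_subset[OF cont]) auto
      then show "continuous_on {s..s+E\<^sup>2} (\<lambda>t. w t + V t)"
        using xV s1 by (subst continuous_on_cong[of _ "{s..s+E\<^sup>2}" _ x]) auto
      show "regular_block q b' w (s + real l * (E / 2 ^ (b' * q * i))\<^sup>2) (E / 2 ^ (b' * q * Suc i))"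
        if "b n \<le> b'" "i < q" "l < 2 ^ (2 * b' * q * i)" for b' i l
        unfolding s_def E_def
      proof (rule b1)
        show "b1 \<le> b'" using b1n that by simp
        have "d * b n \<le> d * b'" using that(1) by (rule mult_le_mono2)
        with nb show "n \<le> d * b'" by (rule order_trans)
      qed (use that j in auto)
    qed
    then have int_le: "(\<integral>\<^sup>+t. ennreal (\<bar>x t\<bar> powr \<alpha>) * indicator {s..s+E\<^sup>2} t \<partial>lborel)
      \<le> ennreal (E\<^sup>2 * E powr \<alpha> * (2 ^ (b n * q * q) + C * (1 + K / E)))"
      using xV s1 unfolding C_def K_def
      by (subst nn_integral_cong[where v = "\<lambda>t. ennreal (\<bar>w t + V t\<bar> powr \<alpha>) * indicator {s..s+E\<^sup>2} t"])
         (auto simp: indicator_def)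
    have K0: "0 \<le> K" using VA[of s "s + E\<^sup>2"] s1 by (simp add: K_def)
    define R where "R = \<bar>\<rho>\<bar> * (E\<^sup>2) powr (- \<beta>)"
    have xm: "(\<lambda>t. ennreal (\<bar>x t\<bar> powr \<alpha>) * indicator {s..s+E\<^sup>2} t) \<in> borel_measurable lborel"
    proof -
      have "continuous_on {s..s+E\<^sup>2} x" using s1 by (intro continuous_on_subset[OF cont]) auto
      then have 1: "(\<lambda>t. indicator {s..s+E\<^sup>2} t *\<^sub>R x t) \<in> borel_measurable borel"
        by (intro borel_measurable_continuous_on_indicator) auto
      \<comment> \<open>Continuity of x is available only on the window. Extending x by 0 makes it
        measurable, and the outer indicator hides the change.\<close>
      have 2: "(\<lambda>t. ennreal (\<bar>x t\<bar> powr \<alpha>) * indicator {s..s+E\<^sup>2} t)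
        = (\<lambda>t. ennreal (\<bar>indicator {s..s+E\<^sup>2} t *\<^sub>R x t\<bar> powr \<alpha>) * indicator {s..s+E\<^sup>2} t)"
        by (auto simp: indicator_def fun_eq_iff)
      show ?thesis unfolding 2 using 1 by measurable
    qed
    have "ennreal K \<le> (\<integral>\<^sup>+t. ennreal \<bar>h t\<bar> * indicator {s..s+E\<^sup>2} t \<partial>lborel)"
      unfolding K_def using s1 by (intro vp(2)) auto
    also have "\<dots> \<le> (\<integral>\<^sup>+t. ennreal R * (ennreal (\<bar>x t\<bar> powr \<alpha>) * indicator {s..s+E\<^sup>2} t) \<partial>lborel)"
    proof (rule nn_integral_mono)
      fix t
      have "ennreal \<bar>h t\<bar> \<le> ennreal (R * \<bar>x t\<bar> powr \<alpha>)" if "t \<in> {s..s+E\<^sup>2}"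
        unfolding h_def g_def R_def using that s E by (intro ennreal_leI abs_drift_le \<beta>0) auto
      then show "ennreal \<bar>h t\<bar> * indicator {s..s+E\<^sup>2} t \<le> ennreal R * (ennreal (\<bar>x t\<bar> powr \<alpha>) * indicator {s..s+E\<^sup>2} t)"
        by (auto simp: indicator_def ennreal_mult R_def)
    qed
    also have "\<dots> = ennreal R * (\<integral>\<^sup>+t. ennreal (\<bar>x t\<bar> powr \<alpha>) * indicator {s..s+E\<^sup>2} t \<partial>lborel)"
      by (rule nn_integral_cmult[OF xm])
    also have "\<dots> \<le> ennreal R * ennreal (E\<^sup>2 * E powr \<alpha> * (2 ^ (b n * q * q) + C * (1 + K / E)))"
      by (intro mult_left_mono int_le) auto
    also have "\<dots> = ennreal (R * (E\<^sup>2 * E powr \<alpha> * (2 ^ (b n * q * q) + C * (1 + K / E))))"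
      using C0 K0 E by (intro ennreal_mult[symmetric]) (auto simp: R_def)
    finally have "K \<le> R * (E\<^sup>2 * E powr \<alpha> * (2 ^ (b n * q * q) + C * (1 + K / E)))"
      using C0 K0 E by (subst (asm) ennreal_le_iff) (auto simp: R_def)
    then have "K / E \<le> R * (E\<^sup>2 * E powr \<alpha> * (2 ^ (b n * q * q) + C * (1 + K / E))) / E"
      using E by (intro divide_right_mono) auto
    also have "\<dots> = (R * E * E powr \<alpha>) * (2 ^ (b n * q * q) + C * (1 + K / E))"
      using E by (simp add: power2_eq_square)
    also have "R * E * E powr \<alpha> = \<bar>\<rho>\<bar> * 2 powr (- \<delta> * real n)"
    proof -
      have "E = 2 powr real n" by (simp add: E_def powr_realpow)
      moreover have "(E\<^sup>2) powr - \<beta> = 2 powr (2 * real n * - \<beta>)"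
        unfolding \<open>E = 2 powr real n\<close> by (simp add: power2_eq_square powr_add[symmetric] powr_powr)
      ultimately have "(E\<^sup>2) powr - \<beta> * E * E powr \<alpha> = 2 powr (2 * real n * - \<beta> + real n + real n * \<alpha>)"
        by (simp only: powr_add powr_powr)
      also have "2 * real n * - \<beta> + real n + real n * \<alpha> = - \<delta> * real n" by (simp add: \<delta>_def algebra_simps)
      finally show ?thesis by (simp add: R_def)
    qed
    also have "\<bar>\<rho>\<bar> * 2 powr (- \<delta> * real n) * (2 ^ (b n * q * q) + C * (1 + K / E)) \<le> \<theta> n * (1 + K / E)"
    proof -
      have "2 ^ (b n * q * q) * 1 \<le> (2::real) ^ (b n * q * q) * (1 + K / E)"
        using K0 E by (intro mult_left_mono) auto
      then have "2 ^ (b n * q * q) + C * (1 + K / E) \<le> (2 ^ (b n * q * q) + C) * (1 + K / E)"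
        by (simp add: distrib_right)
      then show ?thesis unfolding \<theta>_def mult.assoc by (intro mult_left_mono) (auto simp: mult.assoc)
    qed
    finally have "K / E \<le> \<theta> n * (1 + K / E)" .
    moreover have "K = A (real (Suc j) * 4 ^ n) - A (real j * 4 ^ n)"
      unfolding K_def sS by (simp only: s_def)
    ultimately show ?thesis by (simp only: E_def)
  qed
  have mono: "A t \<le> A u" if "1 \<le> t" "t \<le> u" for t u using VA[OF that] by linarith
  have "(\<lambda>n. (A (real (Suc j) * 4 ^ n) - A (real j * 4 ^ n)) / 2 ^ n) \<longlonglongrightarrow> 0" if j: "j \<in> {1..3}" for j
  proof (rule tendsto_sandwich[of "\<lambda>_. 0" _ _ "\<lambda>n. 2 * \<theta> n"])
    let ?y = "\<lambda>n. (A (real (Suc j) * 4 ^ n) - A (real j * 4 ^ n)) / 2 ^ n"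
    have y0: "0 \<le> ?y n" for n
    proof -
      have "1 * 1 \<le> real j * 4 ^ n" using j by (intro mult_mono) auto
      then have "A (real j * 4 ^ n) \<le> A (real (Suc j) * 4 ^ n)" by (intro mono mult_right_mono) auto
      then show ?thesis by simp
    qed
    then show "\<forall>\<^sub>F n in sequentially. 0 \<le> ?y n" by simp
    \<comment> \<open>The variation appears on both sides of \<open>main\<close>. It is finite, so
      once \<theta> < 1/2 it can be absorbed: y \<le> \<theta> (1 + y) implies y \<le> 2
      \<theta>.\<close>
    have "\<forall>\<^sub>F n in sequentially. \<theta> n < 1 / 2" using \<theta> by (intro order_tendstoD) auto
    with eventually_ge_at_top[of "d * b1"] show "\<forall>\<^sub>F n in sequentially. ?y n \<le> 2 * \<theta> n"
    proof eventually_elim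
      case (elim n)
      have "?y n \<le> \<theta> n * (1 + ?y n)" using main[OF j elim(1)] .
      moreover have "\<theta> n * ?y n \<le> 1 / 2 * ?y n" using elim(2) y0[of n] by (intro mult_right_mono) auto
      ultimately show ?case by (simp only: distrib_left)
    qed
    show "(\<lambda>n. 2 * \<theta> n) \<longlonglongrightarrow> 0" using tendsto_mult_right_zero[OF \<theta>] by simp
  qed simp
  then have "((\<lambda>t. A t / sqrt t) \<longlongrightarrow> 0) at_top"
    using mono vp(3)[of 1] by (intro negligible_from_windows) auto
  then show ?thesis by (simp add: A_def h_def)
qed

section \<open>Nonnegative \<alpha>: control of the solution by the running maximum of the driving
  path\<close>

lemma attracted_upper_bound:
  fixes x w g :: "real \<Rightarrow> real"
  assumes cont: "continuous_on {1..} x"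
    and int: "\<forall>t\<ge>1. set_integrable lborel {1..t} g"
    and eq: "\<And>t. 1 \<le> t \<Longrightarrow> x t = x0 + (w t - w 1) + (LINT s:{1..t}|lborel. g s)"
    and attr: "\<And>s. 1 \<le> s \<Longrightarrow> 0 < x s \<Longrightarrow> g s \<le> 0"
    and t: "1 \<le> t" and m: "\<And>s. 1 \<le> s \<Longrightarrow> s \<le> t \<Longrightarrow> \<bar>w s\<bar> \<le> m"
  shows "x t \<le> \<bar>x0\<bar> + 2 * m"
proof -
  have m0: "0 \<le> m" using m[of t] t by force
  have le: "(LINT s:S|lborel. g s) \<le> 0" if "\<And>s. s \<in> S \<Longrightarrow> g s \<le> 0" for S
  proof -
    have "0 \<le> (LINT s|lborel. - (indicator S s *\<^sub>R g s))"
      using that by (intro Bochner_Integration.integral_nonneg) (auto simp: indicator_def)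
    then show ?thesis by (simp add: set_lebesgue_integral_def)
  qed
  let ?Z = "{1..t} \<inter> x -` {..0}"
  show ?thesis
  proof (cases "?Z = {}")
    case True
    then have "0 < x s" if "s \<in> {1..t}" for s using that by (auto simp: not_le[symmetric])
    then have "(LINT s:{1..t}|lborel. g s) \<le> 0" by (intro le attr) auto
    then show ?thesis using eq[OF t] m[of t] m[of 1] t by auto
  next
    case False
    \<comment> \<open>Let r be the last time up to t with \<open>x r \<le> 0\<close>. After r the
      drift pulls downwards, so x rises above \<open>x r\<close> by at most the increment of w,
      which is at most 2 m.\<close>
    have "closed ?Z"
      by (intro continuous_closed_preimage continuous_on_subset[OF cont]) auto
    then have "compact ?Z"
      by (intro compact_Int_closed[of "{1..t}" ?Z, simplified]) (auto simp: compact_eq_bounded_closed bounded_subset[of "{1..t}"])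
    with False obtain r where r: "r \<in> ?Z" "\<And>s. s \<in> ?Z \<Longrightarrow> s \<le> r"
      using compact_attains_sup[of ?Z] by blast
    then have r1: "1 \<le> r" "r \<le> t" "x r \<le> 0" by auto
    have "0 < x s" if "s \<in> {r<..t}" for s
      using r(2)[of s] r1 that by (auto simp: not_le[symmetric])
    then have "(LINT s:{r<..t}|lborel. g s) \<le> 0" using r1 by (intro le attr) auto
    moreover have "x t - x r = w t - w r + (LINT s:{r<..t}|lborel. g s)"
      using set_integral_increment(1)[OF int[rule_format, OF t] r1(1,2)] eq[OF t] eq[OF r1(1)] by simp
    ultimately show ?thesis using r1 m[of t] m[of r] t by auto
  qed
qed

lemma attracted_abs_bound:
  fixes x w g :: "real \<Rightarrow> real"
  assumes cont: "continuous_on {1..} x"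
    and int: "\<forall>t\<ge>1. set_integrable lborel {1..t} g"
    and eq: "\<And>t. 1 \<le> t \<Longrightarrow> x t = x0 + (w t - w 1) + (LINT s:{1..t}|lborel. g s)"
    and attr: "\<And>s. 1 \<le> s \<Longrightarrow> 0 < x s \<Longrightarrow> g s \<le> 0" "\<And>s. 1 \<le> s \<Longrightarrow> x s < 0 \<Longrightarrow> 0 \<le> g s"
    and t: "1 \<le> t" and m: "\<And>s. 1 \<le> s \<Longrightarrow> s \<le> t \<Longrightarrow> \<bar>w s\<bar> \<le> m"
  shows "\<bar>x t\<bar> \<le> \<bar>x0\<bar> + 2 * m"
proof -
  have "x t \<le> \<bar>x0\<bar> + 2 * m"
    using attracted_upper_bound[OF cont int eq attr(1) t m] by simp
  moreover have "- x t \<le> \<bar>- x0\<bar> + 2 * m"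
  proof (rule attracted_upper_bound[where x = "\<lambda>t. - x t" and w = "\<lambda>t. - w t" and g = "\<lambda>t. - g t"])
    show "continuous_on {1..} (\<lambda>t. - x t)" using cont by (rule continuous_on_minus)
    show "\<forall>t\<ge>1. set_integrable lborel {1..t} (\<lambda>t. - g t)"
      using int by (simp add: set_integrable_def)
    show "- x t = - x0 + (- w t - - w 1) + (LINT s:{1..t}|lborel. - g s)" if "1 \<le> t" for t
      using eq[OF that] by (simp add: set_lebesgue_integral_def)
  qed (use attr t m in auto)
  ultimately show ?thesis by simp
qed

text \<open>For \<alpha> \<ge> 0 the drift is largest far from 0, so an upper bound for
  \<open>\<bar>x\<bar>\<close> suffices on each window. The exponent \<eta> is room for the iterated
  logarithm in the growth of the driving path.\<close>

lemma drift_variation_regular: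
  fixes x w :: "real \<Rightarrow> real"
  defines "g \<equiv> \<lambda>\<rho> \<alpha> \<beta> s. drift \<rho> \<alpha> \<beta> s (x s)"
  assumes cont: "continuous_on {1..} x"
    and int: "\<forall>t\<ge>1. set_integrable lborel {1..t} (g \<rho> \<alpha> \<beta>)"
    and eq: "\<And>t. 1 \<le> t \<Longrightarrow> x t = x0 + (w t - w 1) + (LINT s:{1..t}|lborel. g \<rho> \<alpha> \<beta> s)"
    and \<rho>: "\<rho> \<le> 0" and \<alpha>: "0 \<le> \<alpha>" and \<beta>: "\<alpha> + 1 < 2 * \<beta>"
    and \<eta>: "0 < \<eta>" "4 * \<alpha> * \<eta> \<le> 2 * \<beta> - \<alpha> - 1"
    and growth: "\<And>t. 1 \<le> t \<Longrightarrow> \<bar>w t\<bar> \<le> C * t powr (1 / 2 + \<eta>)"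
  shows "((\<lambda>t. (LINT s:{1..t}|lborel. \<bar>g \<rho> \<alpha> \<beta> s\<bar>) / sqrt t) \<longlongrightarrow> 0) at_top"
proof -
  define h where "h = g \<rho> \<alpha> \<beta>"
  define A where "A t = (LINT s:{1..t}|lborel. \<bar>h s\<bar>)" for t
  note vp = variation_props[OF int[folded h_def], folded A_def]
  have mono: "A t \<le> A u" if "1 \<le> t" "t \<le> u" for t u using vp(1)[OF that] by linarith
  have C0: "0 \<le> C" using growth[of 1] by simp
  define p where "p = 1 / 2 + \<eta>"
  define D where "D = \<bar>x0\<bar> + 2 * C"
  have p: "0 < p" using \<eta> by (simp add: p_def)
  have x_bound: "\<bar>x t\<bar> \<le> D * u powr p" if "1 \<le> t" "t \<le> u" for t u
  proof -
    have "\<bar>x t\<bar> \<le> \<bar>x0\<bar> + 2 * (C * u powr p)"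
    proof (rule attracted_abs_bound[OF cont int eq])
      show "g \<rho> \<alpha> \<beta> s \<le> 0" if "0 < x s" for s
        using that \<rho> by (auto simp: g_def drift_def divide_nonpos_nonneg mult_nonpos_nonneg)
      show "0 \<le> g \<rho> \<alpha> \<beta> s" if "x s < 0" for s
        using that \<rho> by (auto simp: g_def drift_def divide_nonpos_nonneg mult_nonpos_nonneg)
      show "\<bar>w s\<bar> \<le> C * u powr p" if "1 \<le> s" "s \<le> t" for s
      proof -
        have "s powr p \<le> u powr p" using that \<open>t \<le> u\<close> p by (intro powr_mono2) auto
        then show ?thesis using growth[OF that(1)] C0 unfolding p_def[symmetric]
          by (meson mult_left_mono order_trans)
      qed
    qed (use that in auto)
    also have "\<dots> \<le> \<bar>x0\<bar> * u powr p + 2 * (C * u powr p)"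
      using that p by (intro add_right_mono mult_le_cancel_left1[THEN iffD2]) (auto simp: ge_one_powr_ge_zero)
    finally show ?thesis by (simp add: D_def algebra_simps)
  qed
  define \<delta> where "\<delta> = 2 * \<beta> - \<alpha> - 1"
  have \<delta>: "0 < \<delta>" using \<beta> by (simp add: \<delta>_def)
  have \<beta>0: "0 \<le> \<beta>" using \<alpha> \<beta> by simp
  define F where "F = \<bar>\<rho>\<bar> * D powr \<alpha> * 4 powr (p * \<alpha>)"
  have F: "0 \<le> F" by (simp add: F_def)
  have D0: "0 \<le> D" using C0 by (simp add: D_def)
  have main: "(A (real (Suc j) * 4 ^ n) - A (real j * 4 ^ n)) / 2 ^ n \<le> F * (2 powr (- \<delta> / 2)) ^ n"
    if j: "j \<in> {1..3}" for j n
  proof -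
    define E where "E = (2::real) powr real n"
    have E: "0 < E" by (simp add: E_def)
    have E2: "4 ^ n = E\<^sup>2"
      by (simp add: E_def powr_realpow power_mult[symmetric] mult.commute[of n] power_mult)
    define s u where "s = real j * E\<^sup>2" and "u = real (Suc j) * E\<^sup>2"
    have "1 * E\<^sup>2 \<le> s" using j unfolding s_def by (intro mult_right_mono) auto
    moreover have "1 \<le> E\<^sup>2" unfolding E2[symmetric] by simp
    moreover have "u \<le> 4 * E\<^sup>2" using j unfolding u_def by (intro mult_right_mono) auto
    moreover have "u - s = E\<^sup>2" unfolding u_def s_def by (simp add: algebra_simps)
    ultimately have s: "E\<^sup>2 \<le> s" "1 \<le> s" "s \<le> u" "u \<le> 4 * E\<^sup>2" "u - s = E\<^sup>2" "0 < E\<^sup>2" by linarith+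
    define R where "R = \<bar>\<rho>\<bar> * (E\<^sup>2) powr (- \<beta>) * (D * (4 * E\<^sup>2) powr p) powr \<alpha>"
    have "ennreal (A u - A s) \<le> (\<integral>\<^sup>+t. ennreal \<bar>h t\<bar> * indicator {s..u} t \<partial>lborel)"
      using s by (intro vp(2)) auto
    also have "\<dots> \<le> (\<integral>\<^sup>+t. ennreal R * indicator {s..u} t \<partial>lborel)"
    proof (rule nn_integral_mono)
      fix t
      have "\<bar>h t\<bar> \<le> R" if t: "t \<in> {s..u}"
      proof -
        have "\<bar>h t\<bar> \<le> \<bar>\<rho>\<bar> * (E\<^sup>2) powr (- \<beta>) * \<bar>x t\<bar> powr \<alpha>"
          unfolding h_def g_def using t s by (intro abs_drift_le \<beta>0) auto
        also have "\<dots> \<le> R"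
          unfolding R_def using t s \<alpha> by (intro mult_left_mono powr_mono2 x_bound) auto
        finally show ?thesis .
      qed
      then show "ennreal \<bar>h t\<bar> * indicator {s..u} t \<le> ennreal R * indicator {s..u} t"
        by (auto simp: indicator_def ennreal_leI)
    qed
    also have "\<dots> = ennreal (R * E\<^sup>2)"
      using s by (simp add: nn_integral_cmult_indicator ennreal_mult R_def)
    finally have "A u - A s \<le> R * E\<^sup>2"
      by (subst (asm) ennreal_le_iff) (auto simp: R_def)
    then have "(A u - A s) / E \<le> R * E\<^sup>2 / E" using E by (intro divide_right_mono) auto
    also have "\<dots> = R * E" using E by (simp add: power2_eq_square)
    also have "\<dots> = F * (E powr (- 2 * \<beta>) * E powr (2 * p * \<alpha>) * E)"
    proof -
      have EE: "E\<^sup>2 = E powr 2" using E by (simp add: powr_realpow[of E 2, simplified])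
      have "(D * (4 * E\<^sup>2) powr p) powr \<alpha> = D powr \<alpha> * (4 powr (p * \<alpha>) * E powr (2 * p * \<alpha>))"
        unfolding EE by (simp add: powr_mult powr_powr mult.assoc)
      moreover have "(E\<^sup>2) powr (- \<beta>) = E powr (- 2 * \<beta>)" unfolding EE by (simp add: powr_powr)
      ultimately show ?thesis unfolding R_def F_def by (simp only: mult_ac)
    qed
    also have "E powr (- 2 * \<beta>) * E powr (2 * p * \<alpha>) * E = E powr (- 2 * \<beta> + 2 * p * \<alpha> + 1)"
    proof -
      have "E powr 1 = E" using E by simp
      then show ?thesis by (simp only: powr_add)
    qed
    \<comment> \<open>With p = 1/2 + \<eta> the exponent equals -\<delta> + 2 \<alpha> \<eta>; the
      condition 4 \<alpha> \<eta> \<le> \<delta> lets the excess growth use at most half of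
      \<delta>.\<close>
    also have "\<dots> \<le> E powr (- \<delta> / 2)"
    proof (rule powr_mono)
      have "4 * (\<alpha> * \<eta>) \<le> 2 * \<beta> - \<alpha> - 1" using \<eta>(2) by simp
      then show "- 2 * \<beta> + 2 * p * \<alpha> + 1 \<le> - \<delta> / 2" by (simp add: p_def \<delta>_def field_simps)
      show "1 \<le> E" by (simp add: E_def ge_one_powr_ge_zero)
    qed
    also have "E powr (- \<delta> / 2) = (2 powr (- \<delta> / 2)) ^ n"
    proof -
      have "(2 powr (- \<delta> / 2)) ^ n = (2 powr (- \<delta> / 2)) powr real n"
        by (rule powr_realpow[symmetric]) simp
      then show ?thesis by (simp only: powr_powr E_def mult.commute)
    qed
    finally have "(A u - A s) / E \<le> F * (2 powr (- \<delta> / 2)) ^ n" using F by (simp add: mult_left_mono)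
    moreover have "E = 2 ^ n" by (simp add: E_def powr_realpow)
    ultimately show ?thesis unfolding u_def s_def E2 by simp
  qed
  have "(\<lambda>n. (A (real (Suc j) * 4 ^ n) - A (real j * 4 ^ n)) / 2 ^ n) \<longlonglongrightarrow> 0" if j: "j \<in> {1..3}" for j
  proof (rule tendsto_sandwich[of "\<lambda>_. 0" _ _ "\<lambda>n. F * (2 powr (- \<delta> / 2)) ^ n"])
    have "0 \<le> (A (real (Suc j) * 4 ^ n) - A (real j * 4 ^ n)) / 2 ^ n" for n
    proof -
      have "1 * 1 \<le> real j * 4 ^ n" using j by (intro mult_mono) auto
      then have "A (real j * 4 ^ n) \<le> A (real (Suc j) * 4 ^ n)" by (intro mono mult_right_mono) auto
      then show ?thesis by simp
    qed
    then show "\<forall>\<^sub>F n in sequentially. 0 \<le> (A (real (Suc j) * 4 ^ n) - A (real j * 4 ^ n)) / 2 ^ n" by simp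
    show "\<forall>\<^sub>F n in sequentially. (A (real (Suc j) * 4 ^ n) - A (real j * 4 ^ n)) / 2 ^ n \<le> F * (2 powr (- \<delta> / 2)) ^ n"
      using main[OF j] by simp
    have "2 powr (- \<delta> / 2) < 2 powr 0" using \<delta> by (intro powr_less_mono) auto
    then have "(\<lambda>n. F * (2 powr (- \<delta> / 2)) ^ n) \<longlonglongrightarrow> F * 0"
      by (intro tendsto_intros LIMSEQ_realpow_zero) auto
    then show "(\<lambda>n. F * (2 powr (- \<delta> / 2)) ^ n) \<longlonglongrightarrow> 0" by simp
  qed simp
  then have "((\<lambda>t. A t / sqrt t) \<longlongrightarrow> 0) at_top"
    using mono vp(3)[of 1] by (intro negligible_from_windows) auto
  then show ?thesis by (simp add: A_def h_def)
qed

text \<open>The iterated logarithm for B and -B settles large times, compactness the others. A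
  random constant C is enough, because the bound is applied path by path.\<close>

lemma (in brownian_motion) AE_growth:
  assumes \<eta>: "0 < \<eta>"
  shows "AE \<omega> in M. \<exists>C. \<forall>t\<ge>1. \<bar>B t \<omega>\<bar> \<le> C * t powr (1 / 2 + \<eta>)"
proof -
  interpret m: brownian_motion M "\<lambda>t \<omega>. - B t \<omega>" by (rule minus)
  have ev: "\<forall>\<^sub>F t in at_top. 2 * sqrt (2 * t * ln (ln t)) \<le> t powr (1 / 2 + \<eta>)"
    using \<eta> by real_asymp
  from iterated_log_upper[of 1, simplified] m.iterated_log_upper[of 1, simplified] AE_space
  show ?thesis
  proof eventually_elim
    case (elim \<omega>)
    from elim(1,2) ev have "\<forall>\<^sub>F t in at_top. \<bar>B t \<omega>\<bar> \<le> t powr (1 / 2 + \<eta>)"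
      by eventually_elim linarith
    then obtain T where T: "\<And>t. T \<le> t \<Longrightarrow> \<bar>B t \<omega>\<bar> \<le> t powr (1 / 2 + \<eta>)"
      by (auto simp: eventually_at_top_linorder)
    have "compact ((\<lambda>t. B t \<omega>) ` {1..T})"
      by (intro compact_continuous_image continuous_on_subset[OF continuous_B[OF elim(3)]]) auto
    then have "bounded ((\<lambda>t. B t \<omega>) ` {1..T})" by (rule compact_imp_bounded)
    then obtain b where b: "\<forall>t\<in>{1..T}. \<bar>B t \<omega>\<bar> \<le> b"
      by (auto simp: bounded_iff)
    show ?case
    proof (intro exI[of _ "max b 1"] allI impI)
      fix t :: real assume t: "1 \<le> t"
      have pw: "1 \<le> t powr (1 / 2 + \<eta>)" using t \<eta> by (intro ge_one_powr_ge_zero) auto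
      show "\<bar>B t \<omega>\<bar> \<le> max b 1 * t powr (1 / 2 + \<eta>)"
      proof (cases "T \<le> t")
        case True
        have "1 * t powr (1 / 2 + \<eta>) \<le> max b 1 * t powr (1 / 2 + \<eta>)" by (intro mult_right_mono) auto
        then show ?thesis using T[OF True] by linarith
      next
        case False
        have "max b 1 * 1 \<le> max b 1 * t powr (1 / 2 + \<eta>)" using pw by (intro mult_left_mono) auto
        moreover have "\<bar>B t \<omega>\<bar> \<le> b" using b False t by auto
          ultimately show ?thesis by linarith
      qed
    qed
  qed
qed

section \<open>Transfer from the Brownian motion to the solution\<close>

lemma close_iterated_log:
  fixes x w :: "real \<Rightarrow> real"
  assumes close: "((\<lambda>t. (x t - w t) / sqrt t) \<longlongrightarrow> 0) at_top" and \<epsilon>: "0 < \<epsilon>"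
  shows "\<forall>\<^sub>F t in at_top. \<bar>x t - w t\<bar> \<le> \<epsilon> * sqrt (2 * t * ln (ln t))"
proof -
  have "\<forall>\<^sub>F t in at_top. \<bar>(x t - w t) / sqrt t\<bar> < \<epsilon>"
    using tendstoD[OF close \<epsilon>] by (simp add: dist_real_def)
  moreover have "\<forall>\<^sub>F t in at_top. sqrt t \<le> sqrt (2 * t * ln (ln t))" by real_asymp
  ultimately show ?thesis using eventually_gt_at_top[of 0]
  proof eventually_elim
    case (elim t)
    then have "\<bar>x t - w t\<bar> \<le> \<epsilon> * sqrt t" by (simp add: abs_divide divide_simps)
    also have "\<dots> \<le> \<epsilon> * sqrt (2 * t * ln (ln t))" using elim \<epsilon> by (intro mult_left_mono) auto
    finally show ?case .
  qed
qed

text \<open>The slack runs only through \<open>1 / real (Suc k)\<close>, so that the exceptional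
  null sets can be united.\<close>

lemma Limsup_eq_1:
  fixes f :: "real \<Rightarrow> real"
  assumes upper: "\<And>k::nat. \<forall>\<^sub>F t in at_top. f t \<le> 1 + 1 / real (Suc k)"
    and lower: "\<And>k::nat. \<exists>\<^sub>F t in at_top. 1 - 1 / real (Suc k) \<le> f t"
  shows "Limsup at_top (\<lambda>t. ereal (f t)) = 1"
proof (rule antisym)
  show "Limsup at_top (\<lambda>t. ereal (f t)) \<le> 1"
  proof (rule ereal_le_epsilon2)
    fix e :: real assume "0 < e"
    then obtain k where k: "1 / real (Suc k) < e" using nat_approx_posE by blast
    have "Limsup at_top (\<lambda>t. ereal (f t)) \<le> ereal (1 + 1 / real (Suc k))"
      using upper[of k] by (intro Limsup_bounded) simp
    also have "\<dots> \<le> 1 + ereal e" using k by (simp add: one_ereal_def)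
    finally show "Limsup at_top (\<lambda>t. ereal (f t)) \<le> 1 + ereal e" .
  qed
  show "1 \<le> Limsup at_top (\<lambda>t. ereal (f t))"
  proof (rule ccontr)
    assume "\<not> 1 \<le> Limsup at_top (\<lambda>t. ereal (f t))"
    then obtain c where c: "Limsup at_top (\<lambda>t. ereal (f t)) < ereal c" "ereal c < 1"
      using ereal_dense2[of "Limsup at_top (\<lambda>t. ereal (f t))" 1] by (auto simp: not_le)
    then have "0 < 1 - c" by (simp add: one_ereal_def)
    then obtain k where k: "1 / real (Suc k) < 1 - c" using nat_approx_posE by blast
    have "\<forall>\<^sub>F t in at_top. ereal (f t) < ereal c" by (rule Limsup_lessD[OF c(1)])
    then have "\<forall>\<^sub>F t in at_top. \<not> 1 - 1 / real (Suc k) \<le> f t"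
      by eventually_elim (use k in simp)
    with lower[of k] show False by (simp add: frequently_def)
  qed
qed

text \<open>Arbitrarily late the path is above and below every given level, and the image of a
  half-line under a continuous map is connected. The factor 1/2 is the lower half of
  \<open>iterated_log_close\<close> with \<epsilon> = 1/2, for the path and for its
  negative.\<close>

lemma hits_level:
  fixes x :: "real \<Rightarrow> real"
  assumes cont: "continuous_on {1..} x"
    and up: "\<exists>\<^sub>F t in at_top. 1 / 2 * sqrt (2 * t * ln (ln t)) \<le> x t"
    and down: "\<exists>\<^sub>F t in at_top. 1 / 2 * sqrt (2 * t * ln (ln t)) \<le> - x t"
  shows "\<exists>t\<ge>max 1 T. x t = a"
proof -
  have *: "\<exists>t\<ge>max 1 T. c \<le> y t" if "\<exists>\<^sub>F t in at_top. 1 / 2 * sqrt (2 * t * ln (ln t)) \<le> y t" for y :: "real \<Rightarrow> real" and c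
  proof -
    have "filterlim (\<lambda>t::real. 1 / 2 * sqrt (2 * t * ln (ln t))) at_top at_top" by real_asymp
    then have "\<forall>\<^sub>F t::real in at_top. c \<le> 1 / 2 * sqrt (2 * t * ln (ln t))"
      by (simp only: filterlim_at_top)
    with eventually_ge_at_top[of "max 1 T"] have "\<forall>\<^sub>F t in at_top. max 1 T \<le> t \<and> c \<le> 1 / 2 * sqrt (2 * t * ln (ln t))"
      by (rule eventually_conj)
    from frequently_eventually_conj[OF that this] have "\<exists>t. 1 / 2 * sqrt (2 * t * ln (ln t)) \<le> y t \<and> max 1 T \<le> t \<and> c \<le> 1 / 2 * sqrt (2 * t * ln (ln t))"
      by (auto dest: frequently_ex)
    then show ?thesis by (meson order_trans)
  qed
  obtain t1 where t1: "max 1 T \<le> t1" "a \<le> x t1" using *[OF up] by blast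
  obtain t2 where t2: "max 1 T \<le> t2" "- a \<le> - x t2" using *[OF down] by blast
  have "connected (x ` {max 1 T..})"
    by (intro connected_continuous_image continuous_on_subset[OF cont]) auto
  moreover have "x t1 \<in> x ` {max 1 T..}" "x t2 \<in> x ` {max 1 T..}" using t1 t2 by auto
  ultimately have "a \<in> x ` {max 1 T..}" using t1(2) t2(2) by (auto intro: connectedD_interval[of _ "x t2" "x t1"])
  then show ?thesis by auto
qed

section \<open>Normal limit, negligible drift and iterated logarithm for the solution\<close>

context brownian_motion
begin

lemma normalised_B:
  assumes "0 < t"
  shows "distr M borel (\<lambda>\<omega>. B t \<omega> / sqrt t) = std_normal_distribution"
proof -
  have "distributed M lborel (\<lambda>\<omega>. 0 + 1 / sqrt t * (B t \<omega> - B 0 \<omega>)) (normal_density (0 + 1 / sqrt t * 0) (\<bar>1 / sqrt t\<bar> * sqrt (t - 0)))"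
    using assms by (intro normal_density_affine distributed_increment) auto
  then have "distributed M lborel (\<lambda>\<omega>. 1 / sqrt t * (B t \<omega> - B 0 \<omega>)) std_normal_density"
    using assms by simp
  then have "distr M lborel (\<lambda>\<omega>. 1 / sqrt t * (B t \<omega> - B 0 \<omega>)) = std_normal_distribution"
    by (simp add: distributed_def)
  moreover have "distr M lborel (\<lambda>\<omega>. 1 / sqrt t * (B t \<omega> - B 0 \<omega>)) = distr M borel (\<lambda>\<omega>. B t \<omega> / sqrt t)"
    by (intro distr_cong) (auto simp: B_0)
  ultimately show ?thesis by simp
qed

text \<open>The normalised Brownian motion has exactly the standard normal law, so its
  characteristic function does not depend on time. Almost sure closeness makes the difference of the
  bounded exponentials vanish by dominated convergence, and Levy's continuity theorem finishes.
  Times are first replaced by sequences tending to infinity, for which both theorems are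
  stated.\<close>

lemma central_limit_transfer:
  fixes X :: "real \<Rightarrow> 'a \<Rightarrow> real" and f :: "real \<Rightarrow> real"
  assumes X [measurable]: "\<And>t. X t \<in> borel_measurable M"
    and close: "AE \<omega> in M. ((\<lambda>t. (X t \<omega> - B t \<omega>) / sqrt t) \<longlongrightarrow> 0) at_top"
    and f: "continuous_on UNIV f" "bounded (range f)"
  shows "((\<lambda>t. \<integral>\<omega>. f (X t \<omega> / sqrt t) \<partial>M) \<longlongrightarrow> integral\<^sup>L std_normal_distribution f) at_top"
proof (rule tendsto_at_topI_sequentially)
  fix \<tau> :: "nat \<Rightarrow> real" assume \<tau>: "filterlim \<tau> at_top sequentially"
  define Z where "Z n \<omega> = X (\<tau> n) \<omega> / sqrt (\<tau> n)" for n \<omega>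
  define Y where "Y n \<omega> = B (\<tau> n) \<omega> / sqrt (\<tau> n)" for n \<omega>
  have [measurable]: "Z n \<in> borel_measurable M" "Y n \<in> borel_measurable M" for n
    unfolding Z_def Y_def by measurable
  have rd: "real_distribution (distr M borel (Z n))" for n
    by (rule real_distribution_distr) simp
  have pos: "\<forall>\<^sub>F n in sequentially. 0 < \<tau> n"
    using \<tau> by (simp add: filterlim_at_top_dense)
  have char: "(\<lambda>n. char (distr M borel (Z n)) u) \<longlonglongrightarrow> char std_normal_distribution u" for u
  proof -
    have "(\<lambda>n. \<integral>\<omega>. iexp (u * Z n \<omega>) - iexp (u * Y n \<omega>) \<partial>M) \<longlonglongrightarrow> (\<integral>\<omega>. 0 \<partial>M)"
    proof (rule integral_dominated_convergence[where w = "\<lambda>_. 2"])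
      show "AE \<omega> in M. (\<lambda>n. iexp (u * Z n \<omega>) - iexp (u * Y n \<omega>)) \<longlonglongrightarrow> 0"
        using close
      proof eventually_elim
        case (elim \<omega>)
        have "(\<lambda>n. Z n \<omega> - Y n \<omega>) \<longlonglongrightarrow> 0"
          using filterlim_compose[OF elim \<tau>] by (simp add: Z_def Y_def diff_divide_distrib)
        then have "(\<lambda>n. iexp (u * (Z n \<omega> - Y n \<omega>)) - 1) \<longlonglongrightarrow> iexp (u * 0) - 1"
          by (intro tendsto_intros)
        then have lim: "(\<lambda>n. norm (iexp (u * (Z n \<omega> - Y n \<omega>)) - 1)) \<longlonglongrightarrow> 0"
          by (intro tendsto_norm_zero) simp
        have norm_eq: "norm (iexp (u * Z n \<omega>) - iexp (u * Y n \<omega>)) = norm (iexp (u * (Z n \<omega> - Y n \<omega>)) - 1)" for n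
        proof -
          have "iexp (u * Z n \<omega>) - iexp (u * Y n \<omega>) = iexp (u * Y n \<omega>) * (iexp (u * (Z n \<omega> - Y n \<omega>)) - 1)"
            by (simp add: exp_add[symmetric] algebra_simps)
          then show ?thesis by (simp add: norm_mult)
        qed
        show ?case
          by (rule tendsto_norm_zero_cancel) (unfold norm_eq, rule lim)
      qed
      show "AE \<omega> in M. norm (iexp (u * Z n \<omega>) - iexp (u * Y n \<omega>)) \<le> 2" for n
        by (intro AE_I2 order_trans[OF norm_triangle_ineq4]) simp
    qed auto
    then have diff: "(\<lambda>n. (\<integral>\<omega>. iexp (u * Z n \<omega>) \<partial>M) - (\<integral>\<omega>. iexp (u * Y n \<omega>) \<partial>M)) \<longlonglongrightarrow> 0"
    proof -
      have "integrable M (\<lambda>\<omega>. iexp (u * Z n \<omega>))" "integrable M (\<lambda>\<omega>. iexp (u * Y n \<omega>))" for n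
        by (intro integrable_const_bound[where B = 1]; simp)+
      then show ?thesis using \<open>(\<lambda>n. \<integral>\<omega>. iexp (u * Z n \<omega>) - iexp (u * Y n \<omega>) \<partial>M) \<longlonglongrightarrow> (\<integral>\<omega>. 0 \<partial>M)\<close>
        by (simp add: Bochner_Integration.integral_diff)
    qed
    have "\<forall>\<^sub>F n in sequentially. (\<integral>\<omega>. iexp (u * Y n \<omega>) \<partial>M) = char std_normal_distribution u"
      using pos
    proof eventually_elim
      case (elim n)
      have "char std_normal_distribution u = char (distr M borel (Y n)) u"
        using normalised_B[OF elim] by (simp add: Y_def[abs_def])
      also have "\<dots> = (\<integral>\<omega>. iexp (u * Y n \<omega>) \<partial>M)"
        unfolding char_def by (subst integral_distr) auto
      finally show ?case ..
    qed
    then have "(\<lambda>n. \<integral>\<omega>. iexp (u * Y n \<omega>) \<partial>M) \<longlonglongrightarrow> char std_normal_distribution u"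
      by (rule tendsto_eventually)
    from tendsto_add[OF diff this] have "(\<lambda>n. \<integral>\<omega>. iexp (u * Z n \<omega>) \<partial>M) \<longlonglongrightarrow> char std_normal_distribution u"
      by simp
    moreover have "char (distr M borel (Z n)) u = (\<integral>\<omega>. iexp (u * Z n \<omega>) \<partial>M)" for n
      unfolding char_def by (subst integral_distr) auto
    ultimately show ?thesis by simp
  qed
  obtain b where b: "\<And>y. norm (f y) \<le> b" using f(2) by (auto simp: bounded_iff)
  have fc: "isCont f y" for y using f(1) by (simp add: continuous_on_eq_continuous_at)
  have [measurable]: "f \<in> borel_measurable borel" using f(1) by (rule borel_measurable_continuous_onI)
  have "weak_conv_m (\<lambda>n. distr M borel (Z n)) std_normal_distribution"
    by (rule levy_continuity[OF rd real_dist_normal_dist char])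
  then have "(\<lambda>n. integral\<^sup>L (distr M borel (Z n)) f) \<longlonglongrightarrow> integral\<^sup>L std_normal_distribution f"
    by (rule weak_conv_imp_integral_bdd_continuous_conv[OF rd real_dist_normal_dist _ fc b])
  moreover have "integral\<^sup>L (distr M borel (Z n)) f = (\<integral>\<omega>. f (Z n \<omega>) \<partial>M)" for n
    by (rule integral_distr) auto
  ultimately show "(\<lambda>n. \<integral>\<omega>. f (X (\<tau> n) \<omega> / sqrt (\<tau> n)) \<partial>M) \<longlonglongrightarrow> integral\<^sup>L std_normal_distribution f"
    by (simp add: Z_def)
qed

lemma solution_close:
  assumes \<rho>: "\<rho> \<le> 0" and \<alpha>: "-1 < \<alpha>" and \<beta>: "\<alpha> + 1 < 2 * \<beta>"
    and sol: "is_solution M B \<rho> \<alpha> \<beta> x0 X"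
  shows "AE \<omega> in M. ((\<lambda>t. (X t \<omega> - B t \<omega>) / sqrt t) \<longlongrightarrow> 0) at_top"
proof -
  let ?g = "\<lambda>\<omega> s. drift \<rho> \<alpha> \<beta> s (X s \<omega>)"
  have solAE: "AE \<omega> in M. continuous_on {1..} (\<lambda>t. X t \<omega>) \<and> (\<forall>t\<ge>1. set_integrable lborel {1..t} (?g \<omega>) \<and>
     X t \<omega> = x0 + (B t \<omega> - B 1 \<omega>) + (LINT s:{1..t}|lborel. ?g \<omega> s))"
    using sol by (simp add: is_solution_def)
  have "AE \<omega> in M. ((\<lambda>t. (LINT s:{1..t}|lborel. \<bar>?g \<omega> s\<bar>) / sqrt t) \<longlongrightarrow> 0) at_top"
  proof (cases "\<alpha> < 0")
    case True
    obtain q :: nat where "5 / (1 + \<alpha>) < real q" using reals_Archimedean2 by blast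
    then have q: "5 \<le> real q * (1 + \<alpha>)" using \<alpha> by (simp add: field_simps)
    obtain d :: nat where "2 * real (q * q) / (2 * \<beta> - \<alpha> - 1) < real d" using reals_Archimedean2 by blast
    moreover have "0 \<le> 2 * real (q * q) / (2 * \<beta> - \<alpha> - 1)" using \<beta> by simp
    ultimately have d: "2 * real (q * q) \<le> real d * (2 * \<beta> - \<alpha> - 1)" and "0 < real d"
      using \<beta> by (simp add: field_simps, linarith)
    then have d0: "0 < d" by simp
    from solAE AE_regular_blocks[of d q] show ?thesis
    proof eventually_elim
      case (elim \<omega>)
      show ?case
        by (rule drift_variation_singular[where x = "\<lambda>t. X t \<omega>" and w = "\<lambda>t. B t \<omega>", OF _ _ _ \<alpha> True \<beta> q d d0 elim(2)])
           (use elim(1) in auto)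
    qed
  next
    case False
    \<comment> \<open>Dividing by \<alpha> + 1 rather than \<alpha> keeps \<eta> positive and well
      defined at \<alpha> = 0, and still gives 4 \<alpha> \<eta> \<le> 2 \<beta> - \<alpha> -
      1.\<close>
    define \<eta> where "\<eta> = (2 * \<beta> - \<alpha> - 1) / (4 * (\<alpha> + 1))"
    have \<eta>: "0 < \<eta>" "4 * \<alpha> * \<eta> \<le> 2 * \<beta> - \<alpha> - 1"
      using False \<beta> by (auto simp: \<eta>_def divide_simps mult_left_mono)
    from solAE AE_growth[OF \<eta>(1)] show ?thesis
    proof eventually_elim
      case (elim \<omega>)
      then obtain C where C: "\<And>t. 1 \<le> t \<Longrightarrow> \<bar>B t \<omega>\<bar> \<le> C * t powr (1 / 2 + \<eta>)" by blast
      show ?case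
        by (rule drift_variation_regular[where x = "\<lambda>t. X t \<omega>" and w = "\<lambda>t. B t \<omega>", OF _ _ _ \<rho> _ \<beta> \<eta> C])
           (use elim(1) False in auto)
    qed
  qed
  with solAE show ?thesis
  proof eventually_elim
    case (elim \<omega>)
    have lim: "((\<lambda>t. \<bar>x0 - B 1 \<omega>\<bar> / sqrt t + (LINT s:{1..t}|lborel. \<bar>?g \<omega> s\<bar>) / sqrt t) \<longlongrightarrow> 0 + 0) at_top"
      by (intro tendsto_add elim(2)) real_asymp
    have bound: "\<forall>\<^sub>F t in at_top. norm ((X t \<omega> - B t \<omega>) / sqrt t) \<le> \<bar>x0 - B 1 \<omega>\<bar> / sqrt t + (LINT s:{1..t}|lborel. \<bar>?g \<omega> s\<bar>) / sqrt t"
      using eventually_ge_at_top[of 1]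
    proof eventually_elim
      case t: (elim t)
      have "\<bar>LINT s:{1..t}|lborel. ?g \<omega> s\<bar> \<le> (LINT s:{1..t}|lborel. \<bar>?g \<omega> s\<bar>)"
        using integral_abs_bound[of lborel "\<lambda>s. indicator {1..t} s *\<^sub>R ?g \<omega> s"]
        by (simp add: set_lebesgue_integral_def abs_mult)
      then have "\<bar>X t \<omega> - B t \<omega>\<bar> \<le> \<bar>x0 - B 1 \<omega>\<bar> + (LINT s:{1..t}|lborel. \<bar>?g \<omega> s\<bar>)"
        using elim(1) t by auto
      then show ?case using t by (simp add: add_divide_distrib[symmetric] divide_right_mono)
    qed
    show ?case by (rule Lim_null_comparison[OF bound lim[unfolded add_0_left]])
  qed
qed

lemma iterated_log_close:
  assumes close: "AE \<omega> in M. ((\<lambda>t. (X t \<omega> - B t \<omega>) / sqrt t) \<longlongrightarrow> 0) at_top"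
    and \<epsilon>: "0 < \<epsilon>" "\<epsilon> \<le> 1"
  shows "AE \<omega> in M. (\<forall>\<^sub>F t in at_top. X t \<omega> \<le> (1 + \<epsilon>) * sqrt (2 * t * ln (ln t))) \<and>
    (\<exists>\<^sub>F t in at_top. (1 - \<epsilon>) * sqrt (2 * t * ln (ln t)) \<le> X t \<omega>)"
proof -
  \<comment> \<open>Half of the slack is for B, the other half for the difference X - B.\<close>
  have \<epsilon>2: "0 < \<epsilon> / 2" "\<epsilon> / 2 < 1" using \<epsilon> by auto
  from iterated_log_upper[OF \<epsilon>2(1)] iterated_log_lower[OF \<epsilon>2] close
  show ?thesis
  proof eventually_elim
    case (elim \<omega>)
    note tr = close_iterated_log[OF elim(3) \<epsilon>2(1)]
    have "\<forall>\<^sub>F t in at_top. X t \<omega> \<le> (1 + \<epsilon>) * sqrt (2 * t * ln (ln t))"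
      using elim(1) tr
    proof eventually_elim
      case (elim t)
      moreover have "(1 + \<epsilon>) * sqrt (2 * t * ln (ln t))
          = (1 + \<epsilon> / 2) * sqrt (2 * t * ln (ln t)) + \<epsilon> / 2 * sqrt (2 * t * ln (ln t))"
        by (simp add: field_simps)
      ultimately show ?case by linarith
    qed
    moreover have "\<exists>\<^sub>F t in at_top. (1 - \<epsilon>) * sqrt (2 * t * ln (ln t)) \<le> X t \<omega>"
    proof (rule frequently_rev_mp[OF elim(2) eventually_mono[OF tr]], rule impI)
      fix t assume "\<bar>X t \<omega> - B t \<omega>\<bar> \<le> \<epsilon> / 2 * sqrt (2 * t * ln (ln t))"
        "(1 - \<epsilon> / 2) * sqrt (2 * t * ln (ln t)) \<le> B t \<omega>"
      moreover have "(1 - \<epsilon>) * sqrt (2 * t * ln (ln t))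
          = (1 - \<epsilon> / 2) * sqrt (2 * t * ln (ln t)) - \<epsilon> / 2 * sqrt (2 * t * ln (ln t))"
        by (simp add: field_simps)
      ultimately show "(1 - \<epsilon>) * sqrt (2 * t * ln (ln t)) \<le> X t \<omega>" by linarith
    qed
    ultimately show ?case ..
  qed
qed

end

theorem theorem4p6:
  fixes M :: "'a measure" and B X :: "real \<Rightarrow> 'a \<Rightarrow> real"
    and \<rho> \<alpha> \<beta> x0 :: real
  assumes BM: "std_brownian_motion M B"
    and rho: "\<rho> \<le> 0" and alpha: "\<alpha> > -1" and beta: "2 * \<beta> > \<alpha> + 1"
    and x0: "x0 \<ge> 0"
    and sol: "is_solution M B \<rho> \<alpha> \<beta> x0 X"
  shows "(\<forall>x::real. AE \<omega> in M. \<forall>T. \<exists>t\<ge>max 1 T. X t \<omega> = x)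
    \<and> (\<forall>f :: real \<Rightarrow> real. continuous_on UNIV f \<and> bounded (range f) \<longrightarrow>
         ((\<lambda>t. integral\<^sup>L M (\<lambda>\<omega>. f (X t \<omega> / sqrt t)))
            \<longlongrightarrow> integral\<^sup>L (density lborel std_normal_density) f) at_top)
    \<and> (AE \<omega> in M. Limsup at_top (\<lambda>t. ereal (X t \<omega> / sqrt (2 * t * ln (ln t)))) = 1)"
proof -
  interpret brownian_motion M B
    using BM by (auto simp: brownian_motion_def brownian_motion_axioms_def std_brownian_motion_def)
  interpret m: brownian_motion M "\<lambda>t \<omega>. - B t \<omega>" by (rule minus)
  have close: "AE \<omega> in M. ((\<lambda>t. (X t \<omega> - B t \<omega>) / sqrt t) \<longlongrightarrow> 0) at_top"
    by (rule solution_close[OF rho alpha beta sol])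
  \<comment> \<open>Closeness is all that the transfer lemmas ask for, so they apply to -X and the
    Brownian motion -B; this supplies the downward excursions for recurrence.\<close>
  have close': "AE \<omega> in M. ((\<lambda>t. (- X t \<omega> - - B t \<omega>) / sqrt t) \<longlongrightarrow> 0) at_top"
    using close
  proof eventually_elim
    case (elim \<omega>)
    from tendsto_minus[OF elim] show ?case by (simp add: minus_divide_left)
  qed
  have X: "X t \<in> borel_measurable M" for t
    using sol by (simp add: is_solution_def)
  have cont: "AE \<omega> in M. continuous_on {1..} (\<lambda>t. X t \<omega>)"
    using sol by (auto simp: is_solution_def)
  have half: "0 < (1 / 2 :: real)" "(1 / 2 :: real) \<le> 1" by simp_all
  have recurrent: "AE \<omega> in M. \<forall>T. \<exists>t\<ge>max 1 T. X t \<omega> = x" for x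
    using cont iterated_log_close[OF close half] m.iterated_log_close[OF close' half]
  proof eventually_elim
    case (elim \<omega>)
    then show ?case by (intro allI hits_level) auto
  qed
  have "AE \<omega> in M. \<forall>k::nat. (\<forall>\<^sub>F t in at_top. X t \<omega> \<le> (1 + 1 / real (Suc k)) * sqrt (2 * t * ln (ln t))) \<and>
    (\<exists>\<^sub>F t in at_top. (1 - 1 / real (Suc k)) * sqrt (2 * t * ln (ln t)) \<le> X t \<omega>)"
    unfolding AE_all_countable by (intro allI iterated_log_close[OF close]) auto
  then have "AE \<omega> in M. Limsup at_top (\<lambda>t. ereal (X t \<omega> / sqrt (2 * t * ln (ln t)))) = 1"
  proof eventually_elim
    case (elim \<omega>)
    have pos: "\<forall>\<^sub>F t::real in at_top. 0 < sqrt (2 * t * ln (ln t))" by real_asymp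
    show ?case
    proof (rule Limsup_eq_1)
      fix k :: nat
      from elim[rule_format, of k] have 1: "\<forall>\<^sub>F t in at_top. X t \<omega> \<le> (1 + 1 / real (Suc k)) * sqrt (2 * t * ln (ln t))"
        and 2: "\<exists>\<^sub>F t in at_top. (1 - 1 / real (Suc k)) * sqrt (2 * t * ln (ln t)) \<le> X t \<omega>" by auto
      show "\<forall>\<^sub>F t in at_top. X t \<omega> / sqrt (2 * t * ln (ln t)) \<le> 1 + 1 / real (Suc k)"
        using 1 pos by eventually_elim (simp only: pos_divide_le_eq)
      show "\<exists>\<^sub>F t in at_top. 1 - 1 / real (Suc k) \<le> X t \<omega> / sqrt (2 * t * ln (ln t))"
        by (rule frequently_rev_mp[OF 2 eventually_mono[OF pos]]) (simp only: pos_le_divide_eq simp_thms)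
    qed
  qed
  with recurrent central_limit_transfer[OF X close] show ?thesis by blast
qed

end
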